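(* Let $m\in\mathbb{N}$. The assignment $\Delta_{\overline{\mathcal{O}(m)}_\infty}$ defines a linear operator $A^{(0,0)}(\mathbb{P}^1,\mathcal{O}(m))\to\mathcal{H}^{(m)}$ (the canonical Laplacian), and for all $\xi,\eta\in A^{(0,0)}(\mathbb{P}^1,\mathcal{O}(m))$: 1. $\ker \Delta_{\overline{\mathcal{O}(m)}_\infty}=H^0(\mathbb{P}^1,\mathcal{O}(m))$ (the space of holomorphic global sections); 2. $(\xi,\Delta_{\overline{\mathcal{O}(m)}_\infty}\eta)_{L^2,\infty}=(\Delta_{\overline{\mathcal{O}(m)}_\infty}\xi,\eta)_{L^2,\infty}$; 3. $(\xi,\Delta_{\overline{\mathcal{O}(m)}_\infty}\xi)_{L^2,\infty}\ge 0$.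
   Context: $\mathbb{N}=\{0,1,2,\dots\}$. $\mathbb{P}^1$ is the complex projective line with homogeneous coordinates $[x_0:x_1]$ and affine coordinate $z=x_1/x_0$; $\mathbb{S}^1=\{|z|=1\}$. $A^{(0,0)}(\mathbb{P}^1)$ is the space of $C^\infty$ complex functions on $\mathbb{P}^1$ and $A^{(0,0)}(\mathbb{P}^1,\mathcal{O}(m))$ the space of $C^\infty$ global sections of the line bundle $\mathcal{O}(m)$. The holomorphic global sections of $\mathcal{O}(m)$ have basis $1,z,\dots,z^m$ ($z^k$ corresponds to the monomial $x_0^{m-k}x_1^k$); $f\otimes z^k$ denotes the section $f\cdot z^k$, $f$ a function. Every element of $A^{(0,0)}(\mathbb{P}^1,\mathcal{O}(m))$ is of the form $\sum_{k=0}^m f_k\otimes z^k$ with $f_k\in A^{(0,0)}(\mathbb{P}^1)$. Canonical metric on $\mathcal{O}(m)$: $h_m(s,s)(x)=|s(x)|^2/\max(|x_0|,|x_1|)^{2m}$, so $h_m(z^k,z^l)(z)=z^k\bar z^l/\max(1,|z|)^{2m}$. Canonical Kähler form: $\omega_\infty=\frac{i}{2\pi}\frac{dz\wedge d\bar z}{\max(1,|z|)^4}$, with corresponding metric $h_T(\partial_z,\partial_z)=\max(1,|z|)^{-4}$ on $T\mathbb{P}^1$. Hermitian product: $(\xi,\xi')_{L^2,\infty}=\int_{\mathbb{P}^1}h_m(\xi,\xi')\,\omega_\infty$; $\mathcal{H}^{(m)}$ is the Hilbert space completion of $A^{(0,0)}(\mathbb{P}^1,\mathcal{O}(m))$ for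 it. $\Delta_{\overline{\mathcal{O}(m)}_\infty}$ is defined on $\mathbb{P}^1\setminus\mathbb{S}^1$ (hence almost everywhere) by $$\Delta_{\overline{\mathcal{O}(m)}_\infty}(f\otimes z^k)=-h_T(\partial_z,\partial_z)^{-1}h_m(z^k,z^k)^{-1}\frac{\partial}{\partial z}\Bigl(h_m(z^k,z^k)\frac{\partial f}{\partial\bar z}\Bigr)\otimes z^k,\qquad f\in A^{(0,0)}(\mathbb{P}^1),\ 0\le k\le m,$$ and extended by linearity to $A^{(0,0)}(\mathbb{P}^1,\mathcal{O}(m))$. *)

theory Defs
  imports "HOL-Analysis.Analysis"
begin

section \<open>The complex projective line\<close>

definition proj_equiv :: "complex \<times> complex \<Rightarrow> complex \<times> complex \<Rightarrow> bool" where
  "proj_equiv x y \<longleftrightarrow> x \<noteq> 0 \<and> y \<noteq> 0 \<and> (\<exists>c. c \<noteq> 0 \<and> y = (c * fst x, c * snd x))"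

lemma part_equivp_proj_equiv: "part_equivp proj_equiv"
proof (rule part_equivpI)
  have "proj_equiv (1, 0) (1, 0)"
    unfolding proj_equiv_def by (auto simp: zero_prod_def intro!: exI[of _ 1])
  then show "\<exists>x. proj_equiv x x" by blast
  show "symp proj_equiv"
  proof (rule sympI)
    fix x y assume "proj_equiv x y"
    then obtain c where c: "x \<noteq> 0" "y \<noteq> 0" "c \<noteq> 0" "y = (c * fst x, c * snd x)"
      unfolding proj_equiv_def by blast
    then have "x = (inverse c * fst y, inverse c * snd y)"
      by (simp add: prod_eq_iff field_simps)
    then show "proj_equiv y x"
      unfolding proj_equiv_def using c(1-3) by (metis inverse_nonzero_iff_nonzero)
  qed
  show "transp proj_equiv"
  proof (rule transpI)
    fix x y z assume "proj_equiv x y" "proj_equiv y z"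
    then obtain c d where "x \<noteq> 0" "z \<noteq> 0" "c \<noteq> 0" "d \<noteq> 0"
      "y = (c * fst x, c * snd x)" "z = (d * fst y, d * snd y)"
      unfolding proj_equiv_def by blast
    then show "proj_equiv x z"
      unfolding proj_equiv_def by (intro conjI exI[of _ "d * c"]) (auto simp: mult.assoc)
  qed
qed

quotient_type P1 = "complex \<times> complex" / partial: proj_equiv
  by (rule part_equivp_proj_equiv)

text \<open>\<open>pt x0 x1\<close> is the point \<open>[x0 : x1]\<close>; it is only meaningful for \<open>(x0, x1) \<noteq> (0, 0)\<close>.\<close>

definition pt :: "complex \<Rightarrow> complex \<Rightarrow> P1" where
  "pt x0 x1 = abs_P1 (x0, x1)"

abbreviation hcoords :: "P1 \<Rightarrow> complex \<times> complex" where
  "hcoords \<equiv> rep_P1"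

instantiation P1 :: topological_space
begin

definition open_P1 :: "P1 set \<Rightarrow> bool" where
  "open_P1 U \<longleftrightarrow> open {x. x \<noteq> 0 \<and> abs_P1 x \<in> U}"

instance
proof
  have "{x :: complex \<times> complex. x \<noteq> 0 \<and> abs_P1 x \<in> UNIV} = - {0}" by auto
  then show "open (UNIV :: P1 set)"
    unfolding open_P1_def by (metis open_Compl closed_singleton)
next
  fix S T :: "P1 set" assume "open S" "open T"
  moreover have "{x. x \<noteq> 0 \<and> abs_P1 x \<in> S \<inter> T} =
      {x. x \<noteq> 0 \<and> abs_P1 x \<in> S} \<inter> {x. x \<noteq> 0 \<and> abs_P1 x \<in> T}" by auto
  ultimately show "open (S \<inter> T)"
    unfolding open_P1_def by (simp add: open_Int)
next
  fix K :: "P1 set set" assume "\<forall>S\<in>K. open S"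
  moreover have "{x. x \<noteq> 0 \<and> abs_P1 x \<in> \<Union>K} = (\<Union>S\<in>K. {x. x \<noteq> 0 \<and> abs_P1 x \<in> S})" by auto
  ultimately show "open (\<Union>K)"
    unfolding open_P1_def by (simp add: open_UN)
qed

end

text \<open>The affine coordinate \<open>z = x1 / x0\<close>; it is a junk value at the point \<open>[0 : 1]\<close>.\<close>

definition zcoord :: "P1 \<Rightarrow> complex" where
  "zcoord p = snd (hcoords p) / fst (hcoords p)"

definition unit_circle_P1 :: "P1 set" where
  "unit_circle_P1 = {pt 1 z | z. cmod z = 1}"


section \<open>Smooth functions and Wirtinger derivatives on the complex plane\<close>

text \<open>Differentiability is real differentiability: \<open>frechet_derivative\<close> is the real derivative.\<close>

primrec C_k :: "nat \<Rightarrow> (complex \<Rightarrow> complex) \<Rightarrow> bool" where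
  "C_k 0 g \<longleftrightarrow> continuous_on UNIV g"
| "C_k (Suc n) g \<longleftrightarrow> (\<forall>z. g differentiable (at z)) \<and>
     (\<forall>v. C_k n (\<lambda>z. frechet_derivative g (at z) v))"

definition C_infinity :: "(complex \<Rightarrow> complex) \<Rightarrow> bool" where
  "C_infinity g \<longleftrightarrow> (\<forall>n. C_k n g)"

definition d_dz :: "(complex \<Rightarrow> complex) \<Rightarrow> complex \<Rightarrow> complex" where
  "d_dz g z = (frechet_derivative g (at z) 1 - \<i> * frechet_derivative g (at z) \<i>) / 2"

definition d_dzbar :: "(complex \<Rightarrow> complex) \<Rightarrow> complex \<Rightarrow> complex" where
  "d_dzbar g z = (frechet_derivative g (at z) 1 + \<i> * frechet_derivative g (at z) \<i>) / 2"


section \<open>Sections of $\mathcal{O}(m)$\<close>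

text \<open>
  The fibre of $\mathcal{O}(m)$ over a line $\ell \subset \mathbb{C}^2$ consists of the functions on
  $\ell \setminus 0$ that are homogeneous of degree \<open>m\<close>. So a section is a function of the homogeneous
  coordinates, homogeneous of degree \<open>m\<close> away from the origin; its value at the origin, which carries no
  information, is fixed to be 0 so that distinct functions are distinct sections.
  The functions \<open>\<lambda>z. s (1, z)\<close> and \<open>\<lambda>w. s (w, 1)\<close> are the expressions of the section in the
  standard charts, with respect to the frames $x_0^m$ and $x_1^m$.
\<close>

type_synonym hom_fun = "complex \<times> complex \<Rightarrow> complex"

definition is_section :: "nat \<Rightarrow> hom_fun \<Rightarrow> bool" where
  "is_section m s \<longleftrightarrow> s 0 = 0 \<and>
     (\<forall>c x0 x1. c \<noteq> 0 \<longrightarrow> (x0, x1) \<noteq> 0 \<longrightarrow> s (c * x0, c * x1) = c ^ m * s (x0, x1))"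

definition smooth_functions :: "(P1 \<Rightarrow> complex) set" where
  "smooth_functions = {f. C_infinity (\<lambda>z. f (pt 1 z)) \<and> C_infinity (\<lambda>w. f (pt w 1))}"

definition smooth_sections :: "nat \<Rightarrow> hom_fun set" where
  "smooth_sections m =
     {s. is_section m s \<and> C_infinity (\<lambda>z. s (1, z)) \<and> C_infinity (\<lambda>w. s (w, 1))}"

definition holomorphic_sections :: "nat \<Rightarrow> hom_fun set" where
  "holomorphic_sections m =
     {s. is_section m s \<and> (\<lambda>z. s (1, z)) holomorphic_on UNIV \<and> (\<lambda>w. s (w, 1)) holomorphic_on UNIV}"

text \<open>\<open>tensor m f k\<close> is $f \otimes z^k$, where $z^k$ stands for the monomial $x_0^{m-k} x_1^k$.\<close>

definition tensor :: "nat \<Rightarrow> (P1 \<Rightarrow> complex) \<Rightarrow> nat \<Rightarrow> hom_fun" where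
  "tensor m f k = (\<lambda>(x0, x1). if (x0, x1) = 0 then 0 else f (pt x0 x1) * (x0 ^ (m - k) * x1 ^ k))"


section \<open>Canonical metrics and the Hilbert space\<close>

definition h_metric :: "nat \<Rightarrow> hom_fun \<Rightarrow> hom_fun \<Rightarrow> P1 \<Rightarrow> complex" where
  "h_metric m s t p = (let x = hcoords p in
     s x * cnj (t x) / of_real (max (cmod (fst x)) (cmod (snd x)) ^ (2 * m)))"

definition h_T :: "complex \<Rightarrow> real" where
  "h_T z = 1 / max 1 (cmod z) ^ 4"

lemma chart_measurable: "(\<lambda>z. pt 1 z) \<in> borel_measurable borel"
proof (rule borel_measurable_continuous_onI, subst continuous_on_open_vimage)
  show "\<forall>B. open B \<longrightarrow> open ((\<lambda>z. pt 1 z) -` B \<inter> UNIV)"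
  proof (intro allI impI)
    fix B :: "P1 set" assume "open B"
    then have "open {x. x \<noteq> 0 \<and> abs_P1 x \<in> B}"
      by (simp add: open_P1_def)
    then have "open ((\<lambda>z. (1, z)) -` {x. x \<noteq> 0 \<and> abs_P1 x \<in> B})"
      by (intro open_vimage continuous_intros)
    moreover have "(\<lambda>z. (1, z)) -` {x. x \<noteq> 0 \<and> abs_P1 x \<in> B} = (\<lambda>z. pt 1 z) -` B \<inter> UNIV"
      by (auto simp: pt_def zero_prod_def)
    ultimately show "open ((\<lambda>z. pt 1 z) -` B \<inter> UNIV)" by simp
  qed
qed simp

text \<open>
  Since $\frac{i}{2\pi} dz \wedge d\bar z = \frac{1}{\pi} dx \wedge dy$, integration against
  $\omega_\infty$ is integration against the Lebesgue measure with density $h_T / \pi$;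
  the point \<open>[0 : 1]\<close> has measure zero.
\<close>

definition omega :: "P1 measure" where
  "omega = distr (density lborel (\<lambda>z. ennreal (h_T z / pi))) borel (\<lambda>z. pt 1 z)"

definition L2_product :: "nat \<Rightarrow> hom_fun \<Rightarrow> hom_fun \<Rightarrow> complex" where
  "L2_product m s t = integral\<^sup>L omega (h_metric m s t)"

definition L2_sections :: "nat \<Rightarrow> hom_fun set" where
  "L2_sections m = {s. is_section m s \<and>
     (\<lambda>z. s (1, z)) \<in> borel_measurable borel \<and> (\<lambda>w. s (w, 1)) \<in> borel_measurable borel \<and>
     integrable omega (h_metric m s s)}"

text \<open>
  The completion of the smooth sections is realised as their closure in the (complete) space of
  square-integrable sections, where sections that agree almost everywhere are identified.
\<close>

definition L2_closure :: "nat \<Rightarrow> hom_fun set" where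
  "L2_closure m = {s \<in> L2_sections m. \<forall>e>0. \<exists>t\<in>smooth_sections m.
     sqrt (Re (L2_product m (\<lambda>x. s x - t x) (\<lambda>x. s x - t x))) < e}"

definition ae_equal :: "nat \<Rightarrow> (hom_fun \<times> hom_fun) set" where
  "ae_equal m = {(s, t). s \<in> L2_closure m \<and> t \<in> L2_closure m \<and>
     (AE p in omega. s (hcoords p) = t (hcoords p))}"

definition Hilbert :: "nat \<Rightarrow> hom_fun set set" where
  "Hilbert m = L2_closure m // ae_equal m"

definition H_class :: "nat \<Rightarrow> hom_fun \<Rightarrow> hom_fun set" where
  "H_class m s = ae_equal m `` {s}"

definition H_rep :: "hom_fun set \<Rightarrow> hom_fun" where
  "H_rep U = (SOME s. s \<in> U)"

definition H_add :: "nat \<Rightarrow> hom_fun set \<Rightarrow> hom_fun set \<Rightarrow> hom_fun set" where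
  "H_add m U V = H_class m (\<lambda>x. H_rep U x + H_rep V x)"

definition H_scale :: "nat \<Rightarrow> complex \<Rightarrow> hom_fun set \<Rightarrow> hom_fun set" where
  "H_scale m c U = H_class m (\<lambda>x. c * H_rep U x)"

definition H_zero :: "nat \<Rightarrow> hom_fun set" where
  "H_zero m = H_class m (\<lambda>x. 0)"

definition H_product :: "nat \<Rightarrow> hom_fun set \<Rightarrow> hom_fun set \<Rightarrow> complex" where
  "H_product m U V = L2_product m (H_rep U) (H_rep V)"


section \<open>The canonical Laplacian\<close>

text \<open>
  The Laplacian of $f \otimes z^k$ off the unit circle, given by the formula in the affine
  coordinate. The values put on the unit circle, at \<open>[0 : 1]\<close>, and (where the formula has a
  removable singularity if \<open>k > 0\<close>) at \<open>[1 : 0]\<close> concern a set of measure zero only.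
\<close>

definition laplacian_coeff :: "nat \<Rightarrow> (P1 \<Rightarrow> complex) \<Rightarrow> nat \<Rightarrow> complex \<Rightarrow> complex" where
  "laplacian_coeff m f k z =
     (let h = (\<lambda>w. h_metric m (tensor m (\<lambda>_. 1) k) (tensor m (\<lambda>_. 1) k) (pt 1 w)) in
      - inverse (of_real (h_T z)) * inverse (h z) *
          d_dz (\<lambda>w. h w * d_dzbar (\<lambda>u. f (pt 1 u)) w) z)"

definition laplacian_tensor :: "nat \<Rightarrow> (P1 \<Rightarrow> complex) \<Rightarrow> nat \<Rightarrow> hom_fun" where
  "laplacian_tensor m f k =
     tensor m (\<lambda>p. if p \<in> unit_circle_P1 \<or> p = pt 0 1 then 0
                   else laplacian_coeff m f k (zcoord p)) k"

definition is_linear_operator :: "nat \<Rightarrow> (hom_fun \<Rightarrow> hom_fun set) \<Rightarrow> bool" where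
  "is_linear_operator m D \<longleftrightarrow> D \<in> smooth_sections m \<rightarrow>\<^sub>E Hilbert m \<and>
     (\<forall>\<xi>\<in>smooth_sections m. \<forall>\<eta>\<in>smooth_sections m.
        D (\<lambda>x. \<xi> x + \<eta> x) = H_add m (D \<xi>) (D \<eta>)) \<and>
     (\<forall>c. \<forall>\<xi>\<in>smooth_sections m. D (\<lambda>x. c * \<xi> x) = H_scale m c (D \<xi>))"

definition is_canonical_laplacian :: "nat \<Rightarrow> (hom_fun \<Rightarrow> hom_fun set) \<Rightarrow> bool" where
  "is_canonical_laplacian m D \<longleftrightarrow> is_linear_operator m D \<and>
     (\<forall>f\<in>smooth_functions. \<forall>k\<le>m. D (tensor m f k) = H_class m (laplacian_tensor m f k))"

end

theory Submission
  imports Defs "HOL-Complex_Analysis.Complex_Analysis"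
begin

text \<open>
  Write $a(z) = s(1,z)$ and $a'(w) = s(w,1)$ for the two chart expressions of a section $s$ of
  $\mathcal{O}(m)$. They satisfy $a'(w) = w^m a(1/w)$, and the two closed unit discs $|z| \le 1$ and
  $|w| \le 1$ cover the projective line, meeting in the unit circle.

  The metric data are flat on each disc. For $|z| < 1$ both $h_T$ and the denominator of $h_m$ are 1 and
  $h_m(z^k,z^k) = z^k \bar z^k$; the antiholomorphic factor $\bar z^k$ passes through $\partial_z$ and
  cancels, the holomorphic one passes through $\partial_{\bar z}$, and the defining formula becomes
  $-\partial_z \partial_{\bar z}$ applied to the chart expression $f z^k$ of the whole section. For
  $|z| > 1$ the same computation gives $-\partial_w \partial_{\bar w}$ of the expression in the other
  chart (\<open>laplacian_tensor_affine\<close>). So the Laplacian agrees almost everywhere with an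
  operator \<open>lap\<close> that refers only to $s$ and not to a decomposition into tensors; this yields
  well-definedness and linearity. Uniqueness follows because every smooth section is a finite sum of
  tensors: multiply $s$ by $(|x_0|^2+|x_1|^2)^m$, expand by the binomial theorem and divide again
  (\<open>sum_components\<close>).

  The section \<open>lap m s\<close> is bounded but in general discontinuous along the unit circle. Multiplying
  it by $\exp(-1/(n(1-|z|^2)))$ on each disc makes it smooth, since the cutoff vanishes to infinite order
  on the circle, and by dominated convergence these products tend to it in $L^2$. Hence it represents an
  element of the completion (\<open>lap_L2_closure\<close>).

  The inversion $w = 1/z$ turns the Hermitian product into $1/\pi$ times the sum of the two integrals
  of $a \bar b$ and $a' \bar b'$ over the unit disc $D$, where $b$ and $b'$ are the chart expressions of
  the second section $t$ (\<open>h_metric_two_discs\<close>). Green's formula on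
  each disc (\<open>green_disc\<close>) moves one derivative to the other factor. The boundary terms are
  integrals over the same circle with opposite orientations, and they agree because
  $\partial_{\bar z}$ of a section is again well defined, the transition function $w^m$ being
  holomorphic (\<open>boundary_terms_cancel\<close>). What is left is
  $$ (s, \Delta t) = \frac{1}{\pi} \Bigl( \int_D \partial_{\bar z} a\, \overline{\partial_{\bar z} b}
     + \int_D \partial_{\bar w} a'\, \overline{\partial_{\bar w} b'} \Bigr), $$
  a Hermitian and nonnegative form, called \<open>dirichlet\<close> below. Symmetry and positivity are then
  immediate. If $\Delta s = 0$ then the form vanishes at $(s,s)$, so both $\partial_{\bar z} a$ and
  $\partial_{\bar w} a'$ vanish on the open discs, by the change of charts also outside the closed discs,
  and by continuity on the circle: $s$ is holomorphic.
\<close>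

section \<open>Smooth functions on open subsets of the plane\<close>

text \<open>
  Smoothness is needed locally, since chart changes such as $z \mapsto 1/z$ are defined only on open
  subsets. The recursion is that of \<open>C_k\<close>, with the points restricted to \<open>S\<close>; being a
  pointwise condition it glues along open covers.
\<close>

primrec C_on :: "nat \<Rightarrow> complex set \<Rightarrow> (complex \<Rightarrow> complex) \<Rightarrow> bool" where
  "C_on 0 S g \<longleftrightarrow> continuous_on S g"
| "C_on (Suc n) S g \<longleftrightarrow> (\<forall>z\<in>S. g differentiable (at z)) \<and>
     (\<forall>v. C_on n S (\<lambda>z. frechet_derivative g (at z) v))"

definition smooth_on :: "complex set \<Rightarrow> (complex \<Rightarrow> complex) \<Rightarrow> bool" where
  "smooth_on S g \<longleftrightarrow> (\<forall>n. C_on n S g)"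

lemma C_k_eq_C_on: "C_k n g \<longleftrightarrow> C_on n UNIV g"
  by (induction n arbitrary: g) auto

lemma C_infinity_iff: "C_infinity g \<longleftrightarrow> smooth_on UNIV g"
  by (simp add: C_infinity_def smooth_on_def C_k_eq_C_on)

lemma C_on_cong:
  assumes "open S" "\<And>z. z \<in> S \<Longrightarrow> f z = g z" "C_on n S f"
  shows "C_on n S g"
  using assms(2,3)
proof (induction n arbitrary: f g)
  case 0
  then show ?case by (simp cong: continuous_on_cong)
next
  case (Suc n)
  have der: "(g has_derivative frechet_derivative f (at z)) (at z)" if "z \<in> S" for z
    using has_derivative_transform_within_open[OF _ assms(1) that] Suc.prems that
    by (metis C_on.simps(2) frechet_derivative_works)
  then have "frechet_derivative g (at z) = frechet_derivative f (at z)" if "z \<in> S" for z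
    using frechet_derivative_at that by metis
  then show ?case
    using Suc.prems(2) der Suc.IH[of "\<lambda>z. frechet_derivative f (at z) v" "\<lambda>z. frechet_derivative g (at z) v" for v]
    by (auto simp: differentiable_def)
qed

lemma C_on_SucI:
  assumes "open S" "\<And>z. z \<in> S \<Longrightarrow> (g has_derivative g' z) (at z)"
    and "\<And>v. C_on n S (\<lambda>z. g' z v)"
  shows "C_on (Suc n) S g"
proof -
  have "g' z = frechet_derivative g (at z)" if "z \<in> S" for z
    using frechet_derivative_at assms(2)[OF that] by blast
  then have "C_on n S (\<lambda>z. frechet_derivative g (at z) v)" for v
    by (intro C_on_cong[OF assms(1) _ assms(3)[of v]]) auto
  then show ?thesis using assms(2) by (auto simp: differentiable_def)
qed

lemma C_on_SucD:
  assumes "C_on (Suc n) S g"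
  shows "z \<in> S \<Longrightarrow> (g has_derivative frechet_derivative g (at z)) (at z)"
    and "C_on n S (\<lambda>z. frechet_derivative g (at z) v)"
  using assms by (auto simp: frechet_derivative_works)

lemma C_on_pred: "C_on (Suc n) S g \<Longrightarrow> C_on n S g"
proof (induction n arbitrary: g)
  case 0
  then show ?case
    by (auto intro!: continuous_at_imp_continuous_on differentiable_imp_continuous_within)
next
  case (Suc n)
  then show ?case by (metis C_on.simps(2))
qed

lemma C_on_Un:
  assumes "open S" "open T" shows "C_on n S g \<Longrightarrow> C_on n T g \<Longrightarrow> C_on n (S \<union> T) g"
  by (induction n arbitrary: g) (use assms in \<open>auto intro: continuous_on_open_Un\<close>)

lemma C_on_const: "open S \<Longrightarrow> C_on n S (\<lambda>z. c)"
proof (induction n arbitrary: c)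
  case (Suc n)
  show ?case by (rule C_on_SucI[OF Suc.prems has_derivative_const]) (use Suc in simp)
qed simp

lemma C_on_add:
  assumes "open S" shows "C_on n S f \<Longrightarrow> C_on n S g \<Longrightarrow> C_on n S (\<lambda>z. f z + g z)"
proof (induction n arbitrary: f g)
  case 0 then show ?case by (simp add: continuous_on_add)
next
  case (Suc n)
  show ?case
    by (rule C_on_SucI[OF assms], rule has_derivative_add, erule C_on_SucD(1)[OF Suc.prems(1)],
        erule C_on_SucD(1)[OF Suc.prems(2)])
      (intro Suc.IH C_on_SucD(2)[OF Suc.prems(1)] C_on_SucD(2)[OF Suc.prems(2)])
qed

lemma C_on_mult:
  assumes "open S" shows "C_on n S f \<Longrightarrow> C_on n S g \<Longrightarrow> C_on n S (\<lambda>z. f z * g z)"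
proof (induction n arbitrary: f g)
  case 0 then show ?case by (simp add: continuous_on_mult)
next
  case (Suc n)
  show ?case
  proof (rule C_on_SucI[OF assms], rule has_derivative_mult, erule C_on_SucD(1)[OF Suc.prems(1)],
      erule C_on_SucD(1)[OF Suc.prems(2)])
    fix v
    show "C_on n S (\<lambda>z. f z * frechet_derivative g (at z) v + frechet_derivative f (at z) v * g z)"
      by (intro C_on_add[OF assms] Suc.IH C_on_SucD(2)[OF Suc.prems(1)] C_on_SucD(2)[OF Suc.prems(2)]
          C_on_pred[OF Suc.prems(1)] C_on_pred[OF Suc.prems(2)])
  qed
qed

lemma C_on_bounded_linear:
  assumes "open S" "bounded_linear L"
  shows "C_on n S f \<Longrightarrow> C_on n S (\<lambda>z. L (f z))"
proof (induction n arbitrary: f)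
  case 0
  then show ?case
    using bounded_linear.continuous_on[OF assms(2)] by simp
next
  case (Suc n)
  show ?case
    by (rule C_on_SucI[OF assms(1)], rule bounded_linear.has_derivative[OF assms(2)],
        erule C_on_SucD(1)[OF Suc.prems], rule Suc.IH, rule C_on_SucD(2)[OF Suc.prems])
qed

text \<open>
  The derivative of the composite is the outer derivative, at the inner point, applied to the inner
  derivative. The outer one is linear over the reals in its argument, so this is a combination, with the
  real and imaginary parts of the inner derivative as coefficients, of the outer derivatives in the
  directions 1 and \<open>\<i>\<close> composed with the inner map, and the induction hypothesis applies.
\<close>

lemma C_on_compose:
  assumes "open S" "open T" "\<phi> ` S \<subseteq> T"
  shows "C_on n T g \<Longrightarrow> C_on n S \<phi> \<Longrightarrow> C_on n S (\<lambda>z. g (\<phi> z))"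
proof (induction n arbitrary: g)
  case 0 then show ?case
    using assms(3) by (auto intro!: continuous_on_compose2[of T g])
next
  case (Suc n)
  let ?g' = "\<lambda>z. frechet_derivative g (at z)" and ?\<phi>' = "\<lambda>z. frechet_derivative \<phi> (at z)"
  have der: "((\<lambda>z. g (\<phi> z)) has_derivative (\<lambda>v. ?g' (\<phi> z) (?\<phi>' z v))) (at z)" if "z \<in> S" for z
    by (rule has_derivative_compose[OF C_on_SucD(1)[OF Suc.prems(2) that]])
      (use C_on_SucD(1)[OF Suc.prems(1)] that assms(3) in auto)
  have bl: "bounded_linear (?g' (\<phi> z))" if "z \<in> S" for z
    by (rule has_derivative_bounded_linear[OF C_on_SucD(1)[OF Suc.prems(1)]]) (use that assms(3) in blast)
  have lin: "?g' (\<phi> z) w = of_real (Re w) * ?g' (\<phi> z) 1 + of_real (Im w) * ?g' (\<phi> z) \<i>"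
    if "z \<in> S" for z w
  proof -
    note lin = bounded_linear.linear[OF bl[OF that]]
    have "w = Re w *\<^sub>R 1 + Im w *\<^sub>R \<i>"
      by (simp add: complex_eq_iff)
    then have "?g' (\<phi> z) w = ?g' (\<phi> z) (Re w *\<^sub>R 1 + Im w *\<^sub>R \<i>)"
      by (rule arg_cong)
    also have "\<dots> = Re w *\<^sub>R ?g' (\<phi> z) 1 + Im w *\<^sub>R ?g' (\<phi> z) \<i>"
      by (simp only: linear_add[OF lin] linear_scale[OF lin])
    finally show ?thesis by (simp add: scaleR_conv_of_real)
  qed
  show ?case
  proof (rule C_on_SucI[OF assms(1)], erule der)
    fix v
    have \<phi>n: "C_on n S \<phi>" and \<phi>v: "C_on n S (\<lambda>z. ?\<phi>' z v)"
      by (rule C_on_pred[OF Suc.prems(2)], rule C_on_SucD(2)[OF Suc.prems(2)])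
    have g'n: "C_on n S (\<lambda>z. ?g' (\<phi> z) u)" for u
      by (rule Suc.IH[OF C_on_SucD(2)[OF Suc.prems(1)] \<phi>n])
    have ReIm: "C_on n S (\<lambda>z. of_real (Re (?\<phi>' z v)))" "C_on n S (\<lambda>z. of_real (Im (?\<phi>' z v)))"
      using C_on_bounded_linear[OF assms(1) _ \<phi>v, of "\<lambda>z. complex_of_real (Re z)"]
        C_on_bounded_linear[OF assms(1) _ \<phi>v, of "\<lambda>z. complex_of_real (Im z)"]
      by (auto intro: bounded_linear_compose[OF bounded_linear_of_real] bounded_linear_Re bounded_linear_Im)
    have *: "C_on n S (\<lambda>z. of_real (Re (?\<phi>' z v)) * ?g' (\<phi> z) 1 + of_real (Im (?\<phi>' z v)) * ?g' (\<phi> z) \<i>)"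
      by (rule C_on_add[OF assms(1) C_on_mult[OF assms(1) ReIm(1) g'n] C_on_mult[OF assms(1) ReIm(2) g'n]])
    show "C_on n S (\<lambda>z. ?g' (\<phi> z) (?\<phi>' z v))"
      by (rule C_on_cong[OF assms(1) _ *]) (rule lin[symmetric])
  qed
qed

lemma C_on_holomorphic:
  assumes "open S" shows "g holomorphic_on S \<Longrightarrow> C_on n S g"
proof (induction n arbitrary: g)
  case 0 then show ?case by (simp add: holomorphic_on_imp_continuous_on)
next
  case (Suc n)
  have der: "(g has_derivative (\<lambda>v. deriv g z * v)) (at z)" if "z \<in> S" for z
    using holomorphic_derivI[OF Suc.prems assms that] by (simp add: has_field_derivative_def)
  have "C_on n S (\<lambda>z. deriv g z * v)" for v
    by (rule Suc.IH, rule holomorphic_on_mult, rule holomorphic_deriv[OF Suc.prems assms]) simp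
  then show ?case
    by (intro C_on_SucI[OF assms der])
qed

lemma smooth_on_const: "open S \<Longrightarrow> smooth_on S (\<lambda>z. c)"
  by (simp add: smooth_on_def C_on_const)

lemma smooth_on_add: "open S \<Longrightarrow> smooth_on S f \<Longrightarrow> smooth_on S g \<Longrightarrow> smooth_on S (\<lambda>z. f z + g z)"
  by (simp add: smooth_on_def C_on_add)

lemma smooth_on_mult: "open S \<Longrightarrow> smooth_on S f \<Longrightarrow> smooth_on S g \<Longrightarrow> smooth_on S (\<lambda>z. f z * g z)"
  by (simp add: smooth_on_def C_on_mult)

lemma smooth_on_holomorphic: "open S \<Longrightarrow> f holomorphic_on S \<Longrightarrow> smooth_on S f"
  by (simp add: smooth_on_def C_on_holomorphic)

lemma smooth_on_Un: "open S \<Longrightarrow> open T \<Longrightarrow> smooth_on S f \<Longrightarrow> smooth_on T f \<Longrightarrow> smooth_on (S \<union> T) f"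
  by (simp add: smooth_on_def C_on_Un)

lemma smooth_on_compose:
  assumes "open S" "open T" "\<phi> ` S \<subseteq> T" "smooth_on T g" "smooth_on S \<phi>"
  shows "smooth_on S (\<lambda>z. g (\<phi> z))"
  unfolding smooth_on_def
proof
  fix n show "C_on n S (\<lambda>z. g (\<phi> z))"
    by (rule C_on_compose[OF assms(1-3)]) (use assms(4,5) in \<open>simp_all add: smooth_on_def\<close>)
qed

lemma smooth_on_cong:
  "open S \<Longrightarrow> smooth_on S f \<Longrightarrow> (\<And>z. z \<in> S \<Longrightarrow> f z = g z) \<Longrightarrow> smooth_on S g"
  unfolding smooth_on_def using C_on_cong[of S f g] by simp

lemma smooth_on_continuous: "smooth_on S f \<Longrightarrow> continuous_on S f"
  using C_on.simps(1)[of S f] unfolding smooth_on_def by simp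

lemma smooth_on_has_derivative:
  "smooth_on S f \<Longrightarrow> z \<in> S \<Longrightarrow> (f has_derivative frechet_derivative f (at z)) (at z)"
  by (rule C_on_SucD(1)[of 0 S]) (simp_all only: smooth_on_def)

lemma smooth_on_frechet: "smooth_on S f \<Longrightarrow> smooth_on S (\<lambda>z. frechet_derivative f (at z) v)"
  unfolding smooth_on_def using C_on_SucD(2)[of _ S f v] by simp

lemma smooth_on_cnj: "open S \<Longrightarrow> smooth_on S f \<Longrightarrow> smooth_on S (\<lambda>z. cnj (f z))"
  unfolding smooth_on_def using C_on_bounded_linear[of S cnj _ f] bounded_linear_cnj by simp

lemma smooth_on_id: "open S \<Longrightarrow> smooth_on S (\<lambda>z. z)"
  by (intro smooth_on_holomorphic holomorphic_intros)

lemma smooth_on_diff: "open S \<Longrightarrow> smooth_on S f \<Longrightarrow> smooth_on S g \<Longrightarrow> smooth_on S (\<lambda>z. f z - g z)"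
  using smooth_on_add[of S f "\<lambda>z. (-1) * g z"] smooth_on_mult[of S "\<lambda>_. -1" g] smooth_on_const[of S "-1"]
  by simp

lemma smooth_on_power: "open S \<Longrightarrow> smooth_on S f \<Longrightarrow> smooth_on S (\<lambda>z. f z ^ n)"
proof (induction n)
  case 0
  show ?case using smooth_on_const[OF 0(1)] by simp
next
  case (Suc n)
  show ?case using smooth_on_mult[OF Suc(2,3) Suc.IH[OF Suc(2,3)]] by simp
qed

lemma smooth_on_inverse:
  assumes "open S" "smooth_on S f" "\<And>z. z \<in> S \<Longrightarrow> f z \<noteq> 0"
  shows "smooth_on S (\<lambda>z. inverse (f z))"
proof -
  have op: "open (-{0::complex})" by (intro open_Compl closed_singleton)
  have hol: "(inverse :: complex \<Rightarrow> complex) holomorphic_on -{0}"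
    using holomorphic_on_inverse[OF holomorphic_on_ident[of "-{0}"]] by simp
  have im: "f ` S \<subseteq> -{0}" by (auto simp: assms(3))
  show ?thesis
    by (rule smooth_on_compose[OF assms(1) op im smooth_on_holomorphic[OF op hol] assms(2)])
qed

section \<open>A flat cutoff\<close>

text \<open>
  The factor $x^{-j}$ makes the family closed under differentiation: the derivative of a member is a
  linear combination of two others, so smoothness of all members follows by one induction.
\<close>

definition flat_exp :: "nat \<Rightarrow> real \<Rightarrow> real" where
  "flat_exp j x = (if x \<le> 0 then 0 else exp (- (1 / x)) / x ^ j)"

lemma flat_exp_tendsto_0: "((\<lambda>x. flat_exp j x) \<longlongrightarrow> 0) (at 0)"
proof -
  have "((\<lambda>x::real. exp (- (1 / x)) / x ^ j) \<longlongrightarrow> 0) (at_right 0)"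
  proof -
    have "((\<lambda>y::real. y ^ j / exp y) \<longlongrightarrow> 0) at_top"
      by (rule tendsto_power_div_exp_0)
    then have "((\<lambda>x::real. inverse x ^ j / exp (inverse x)) \<longlongrightarrow> 0) (at_right 0)"
      by (rule filterlim_compose) (rule filterlim_inverse_at_top_right)
    then show ?thesis
      by (simp add: field_simps exp_minus power_inverse)
  qed
  then have R: "(flat_exp j \<longlongrightarrow> 0) (at_right 0)"
    by (rule Lim_transform_eventually)
      (auto simp: flat_exp_def eventually_at_right_less intro!: eventually_mono[OF eventually_at_right_less])
  have L: "(flat_exp j \<longlongrightarrow> 0) (at_left 0)"
    by (rule Lim_transform_eventually[OF tendsto_const])
      (auto simp: flat_exp_def eventually_at_filter)
  show ?thesis
    using R L by (simp add: filterlim_split_at)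
qed

lemma flat_exp_has_derivative:
  "(flat_exp j has_real_derivative (flat_exp (j + 2) x - of_nat j * flat_exp (Suc j) x)) (at x)"
proof -
  consider "x < 0" | "x = 0" | "x > 0" by linarith
  then show ?thesis
  proof cases
    case 1
    have "((\<lambda>_. 0) has_real_derivative 0) (at x)" by simp
    then have "(flat_exp j has_real_derivative 0) (at x)"
      by (rule has_field_derivative_transform_within_open[of _ _ _ "{..<0}"])
        (use 1 in \<open>auto simp: flat_exp_def\<close>)
    then show ?thesis using 1 by (simp add: flat_exp_def)
  next
    case 2
    have "((\<lambda>h. flat_exp j h / h) \<longlongrightarrow> 0) (at 0)"
      by (rule Lim_transform_eventually[OF flat_exp_tendsto_0[of "Suc j"]])
        (auto simp: flat_exp_def eventually_at_filter)
    then show ?thesis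
      by (simp add: 2 DERIV_def) (simp add: flat_exp_def)
  next
    case 3
    have *: "((\<lambda>x. exp (- (1 / x)) / x ^ j) has_real_derivative
        (flat_exp (j + 2) x - of_nat j * flat_exp (Suc j) x)) (at x)"
    proof -
      have e: "((\<lambda>x. exp (- (1 / x))) has_real_derivative exp (- (1 / x)) * (1 / x\<^sup>2)) (at x)"
        using 3 by (auto intro!: derivative_eq_intros simp: power2_eq_square)
      have "((\<lambda>x. exp (- (1 / x)) / x ^ j) has_real_derivative
          (exp (- (1 / x)) * (1 / x\<^sup>2) * x ^ j - exp (- (1 / x)) * (real j * x ^ (j - 1))) / (x ^ j * x ^ j)) (at x)"
        using 3 by (intro DERIV_divide e) (auto intro!: derivative_eq_intros)
      moreover have "(exp (- (1 / x)) * (1 / x\<^sup>2) * x ^ j - exp (- (1 / x)) * (real j * x ^ (j - 1))) / (x ^ j * x ^ j)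
          = flat_exp (j + 2) x - real j * flat_exp (Suc j) x"
        using 3 by (cases j) (simp_all add: flat_exp_def field_simps power2_eq_square)
      ultimately show ?thesis by simp
    qed
    show ?thesis
      by (rule has_field_derivative_transform_within_open[OF *, of "{0<..}"])
        (use 3 in \<open>auto simp: flat_exp_def\<close>)
  qed
qed

lemma C_on_flat_exp:
  assumes S: "open S"
  shows "C_on n S (\<lambda>z. of_real (\<rho> z)) \<Longrightarrow> C_on n S (\<lambda>z. of_real (flat_exp j (\<rho> z)))"
proof (induction n arbitrary: j)
  case 0
  have cont: "continuous_on UNIV (flat_exp j)"
    using DERIV_continuous[OF flat_exp_has_derivative] by (auto intro: continuous_at_imp_continuous_on)
  have "continuous_on S (\<lambda>z. Re (of_real (\<rho> z)))"
    using 0 by (intro continuous_intros) simp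
  then have "continuous_on S \<rho>" by simp
  then have "continuous_on S (\<lambda>z. flat_exp j (\<rho> z))"
    using continuous_on_compose2[OF cont] by blast
  then show ?case by (simp add: continuous_on_of_real)
next
  case (Suc n)
  let ?\<rho> = "\<lambda>z. complex_of_real (\<rho> z)"
  let ?\<rho>' = "\<lambda>z. frechet_derivative ?\<rho> (at z)"
  let ?c = "\<lambda>z. complex_of_real (flat_exp (j + 2) (\<rho> z)) - of_nat j * complex_of_real (flat_exp (Suc j) (\<rho> z))"
  have der: "((\<lambda>z. complex_of_real (flat_exp j (\<rho> z))) has_derivative (\<lambda>v. ?c z * ?\<rho>' z v)) (at z)"
    if z: "z \<in> S" for z
  proof -
    have d: "(?\<rho> has_derivative ?\<rho>' z) (at z)"
      by (rule C_on_SucD(1)[OF Suc.prems z])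
    have dre: "(\<rho> has_derivative (\<lambda>v. Re (?\<rho>' z v))) (at z)"
      using bounded_linear.has_derivative[OF bounded_linear_Re d] by simp
    have real: "?\<rho>' z v = of_real (Re (?\<rho>' z v))" for v
      using has_derivative_unique[OF d bounded_linear.has_derivative[OF bounded_linear_of_real dre]]
      by metis
    have "((\<lambda>z. complex_of_real (flat_exp j (\<rho> z))) has_derivative
        (\<lambda>v. of_real ((flat_exp (j + 2) (\<rho> z) - of_nat j * flat_exp (Suc j) (\<rho> z)) * Re (?\<rho>' z v)))) (at z)"
      by (rule bounded_linear.has_derivative[OF bounded_linear_of_real])
        (rule has_derivative_compose[OF dre flat_exp_has_derivative[unfolded has_field_derivative_def]])
    moreover have "(\<lambda>v. of_real ((flat_exp (j + 2) (\<rho> z) - of_nat j * flat_exp (Suc j) (\<rho> z)) * Re (?\<rho>' z v)))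
        = (\<lambda>v. ?c z * ?\<rho>' z v)"
      by (subst (2) real) simp
    ultimately show ?thesis by simp
  qed
  note pr = C_on_pred[OF Suc.prems]
  have c: "C_on n S ?c"
    using C_on_add[OF S Suc.IH[OF pr, of "j + 2"] C_on_mult[OF S C_on_const[OF S] Suc.IH[OF pr, of "Suc j"]],
        of "- of_nat j"] by simp
  show ?case
    by (rule C_on_SucI[OF S], erule der, rule C_on_mult[OF S c C_on_SucD(2)[OF Suc.prems]])
qed

section \<open>Points of the projective line\<close>

lemma abs_P1_eq_iff: "x \<noteq> 0 \<Longrightarrow> y \<noteq> 0 \<Longrightarrow> abs_P1 x = abs_P1 y \<longleftrightarrow> proj_equiv x y"
proof -
  assume "x \<noteq> 0" "y \<noteq> 0"
  then have "proj_equiv x x" "proj_equiv y y"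
    unfolding proj_equiv_def by (auto intro!: exI[of _ 1])
  then show ?thesis using Quotient_rel[OF Quotient_P1, of x y] by simp
qed

lemma hcoords_nonzero: "hcoords p \<noteq> 0"
  using Quotient_rep_reflp[OF Quotient_P1, of p] by (simp add: proj_equiv_def)

lemma pt_hcoords: "pt (fst (hcoords p)) (snd (hcoords p)) = p"
  by (simp add: pt_def Quotient_abs_rep[OF Quotient_P1])

lemma pt_eq_iff:
  assumes "(x0, x1) \<noteq> 0" "(y0, y1) \<noteq> 0"
  shows "pt x0 x1 = pt y0 y1 \<longleftrightarrow> (\<exists>c. c \<noteq> 0 \<and> y0 = c * x0 \<and> y1 = c * x1)"
  using abs_P1_eq_iff[OF assms] assms by (auto simp: pt_def proj_equiv_def)

lemma hcoords_pt:
  assumes "(x0, x1) \<noteq> 0"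
  obtains c where "c \<noteq> 0" "hcoords (pt x0 x1) = (c * x0, c * x1)"
  using pt_hcoords[of "pt x0 x1"] hcoords_nonzero[of "pt x0 x1"]
    pt_eq_iff[OF assms, of "fst (hcoords (pt x0 x1))" "snd (hcoords (pt x0 x1))"]
  by (metis prod.collapse)

lemma pt_scale: "c \<noteq> 0 \<Longrightarrow> (x0, x1) \<noteq> 0 \<Longrightarrow> pt (c * x0) (c * x1) = pt x0 x1"
  using pt_eq_iff[of x0 x1 "c * x0" "c * x1"] by (auto simp: zero_prod_def)

lemma pt_affine: "x0 \<noteq> 0 \<Longrightarrow> pt x0 x1 = pt 1 (x1 / x0)"
  using pt_scale[of x0 1 "x1 / x0"] by (simp add: zero_prod_def)

lemma zcoord_pt: "(x0, x1) \<noteq> 0 \<Longrightarrow> zcoord (pt x0 x1) = x1 / x0"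
  by (rule hcoords_pt[of x0 x1]) (auto simp: zcoord_def)

lemma zcoord_affine [simp]: "zcoord (pt 1 z) = z"
  by (simp add: zcoord_pt zero_prod_def)

lemma pt_1_neq_infinity [simp]: "pt 1 z \<noteq> pt 0 1"
  using pt_eq_iff[of 1 z 0 1] by (simp add: zero_prod_def)

lemma pt_1_inj [simp]: "pt 1 z = pt 1 w \<longleftrightarrow> z = w"
  by (metis zcoord_affine)

lemma P1_cases:
  obtains "p = pt 1 (zcoord p)" "fst (hcoords p) \<noteq> 0" | "p = pt 0 1" "fst (hcoords p) = 0"
proof (cases "fst (hcoords p) = 0")
  case True
  then have "snd (hcoords p) \<noteq> 0"
    using hcoords_nonzero[of p] by (auto simp: prod_eq_iff)
  then have "p = pt 0 1"
    using pt_hcoords[of p] pt_scale[of "snd (hcoords p)" 0 1] True by (simp add: zero_prod_def)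
  with True that(2) show thesis by blast
next
  case False
  then have "p = pt 1 (zcoord p)"
    using pt_hcoords[of p] pt_affine[OF False, of "snd (hcoords p)"] by (simp add: zcoord_def)
  with False that(1) show thesis by blast
qed

lemma unit_circle_affine [simp]: "pt 1 z \<in> unit_circle_P1 \<longleftrightarrow> cmod z = 1"
  by (auto simp: unit_circle_P1_def)

text \<open>
  The affine chart covers everything but the single point \<open>[0 : 1]\<close>, and its inverse \<open>zcoord\<close> is
  continuous on its open image. So measurability can be tested in the affine coordinate.
\<close>

lemma borel_P1I:
  fixes F :: "P1 \<Rightarrow> 'b::topological_space"
  assumes [measurable]: "(\<lambda>z. F (pt 1 z)) \<in> borel_measurable borel"
  shows "F \<in> borel_measurable borel"
proof -
  let ?U = "{p. fst (hcoords p) \<noteq> 0}"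
  have pre: "{x. x \<noteq> 0 \<and> abs_P1 x \<in> {p. fst (hcoords p) \<noteq> 0 \<and> zcoord p \<in> B}} =
      {x. fst x \<noteq> 0} \<inter> (\<lambda>x. snd x / fst x) -` B" for B
  proof -
    have "abs_P1 x \<in> {p. fst (hcoords p) \<noteq> 0 \<and> zcoord p \<in> B} \<longleftrightarrow> fst x \<noteq> 0 \<and> snd x / fst x \<in> B"
      if "x \<noteq> 0" for x
    proof -
      have x: "(fst x, snd x) \<noteq> 0" using that by simp
      obtain c where "c \<noteq> 0" "hcoords (pt (fst x) (snd x)) = (c * fst x, c * snd x)"
        using hcoords_pt[OF x] by blast
      then show ?thesis using zcoord_pt[OF x] by (simp add: pt_def)
    qed
    then show ?thesis by (auto simp: prod_eq_iff)
  qed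
  have opn: "open {p. fst (hcoords p) \<noteq> 0 \<and> zcoord p \<in> B}" if "open B" for B
  proof -
    have "open {x :: complex \<times> complex. fst x \<noteq> 0}"
      by (intro open_Collect_neq continuous_intros)
    moreover have "continuous_on {x :: complex \<times> complex. fst x \<noteq> 0} (\<lambda>x. snd x / fst x)"
      by (intro continuous_intros) auto
    ultimately have "open ({x. fst x \<noteq> 0} \<inter> (\<lambda>x :: complex \<times> complex. snd x / fst x) -` B)"
      using that by (simp add: continuous_on_open_vimage inf_commute)
    then show ?thesis unfolding open_P1_def pre .
  qed
  have U: "open ?U" using opn[of UNIV] by simp
  have "continuous_on ?U zcoord"
    unfolding continuous_on_open_vimage[OF U]
  proof (intro allI impI)
    fix B :: "complex set" assume "open B"
    moreover have "zcoord -` B \<inter> ?U = {p. fst (hcoords p) \<noteq> 0 \<and> zcoord p \<in> B}" by auto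
    ultimately show "open (zcoord -` B \<inter> ?U)" using opn by simp
  qed
  then have "(\<lambda>p. if p \<in> ?U then zcoord p else 0) \<in> borel_measurable borel"
    using U by (intro borel_measurable_continuous_on_if) auto
  also have "(\<lambda>p. if p \<in> ?U then zcoord p else 0) = zcoord"
    by (auto simp: zcoord_def)
  finally have [measurable]: "zcoord \<in> borel_measurable borel" .
  have [measurable]: "?U \<in> sets borel" using U by simp
  have "(\<lambda>p. if p \<in> ?U then F (pt 1 (zcoord p)) else F (pt 0 1)) \<in> borel_measurable borel"
    by (intro measurable_If_set measurable_compose[OF _ assms]) auto
  also have "(\<lambda>p. if p \<in> ?U then F (pt 1 (zcoord p)) else F (pt 0 1)) = F"
  proof
    fix p show "(if p \<in> ?U then F (pt 1 (zcoord p)) else F (pt 0 1)) = F p"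
      by (cases p rule: P1_cases) simp_all
  qed
  finally show ?thesis .
qed

lemma h_T_measurable [measurable]: "h_T \<in> borel_measurable borel"
  unfolding h_T_def by measurable

lemma h_T_pos: "0 < h_T z"
  by (auto simp: h_T_def less_max_iff_disj)

context
  fixes F :: "P1 \<Rightarrow> complex"
  assumes F: "(\<lambda>z. F (pt 1 z)) \<in> borel_measurable borel"
begin

lemma omega_integrable_iff: "integrable omega F \<longleftrightarrow> integrable lborel (\<lambda>z. (h_T z / pi) *\<^sub>R F (pt 1 z))"
proof -
  note [measurable] = F chart_measurable borel_P1I[OF F]
  have "integrable omega F \<longleftrightarrow> integrable (density lborel (\<lambda>z. ennreal (h_T z / pi))) (\<lambda>z. F (pt 1 z))"
    unfolding omega_def by (subst integrable_distr_eq) auto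
  also have "\<dots> \<longleftrightarrow> integrable lborel (\<lambda>z. (h_T z / pi) *\<^sub>R F (pt 1 z))"
    using h_T_pos by (intro integrable_density) (auto simp: less_imp_le)
  finally show ?thesis .
qed

lemma omega_integral: "integral\<^sup>L omega F = (LINT z|lborel. (h_T z / pi) *\<^sub>R F (pt 1 z))"
proof -
  note [measurable] = F chart_measurable borel_P1I[OF F]
  have "integral\<^sup>L omega F = integral\<^sup>L (density lborel (\<lambda>z. ennreal (h_T z / pi))) (\<lambda>z. F (pt 1 z))"
    unfolding omega_def by (subst integral_distr) auto
  also have "\<dots> = (LINT z|lborel. (h_T z / pi) *\<^sub>R F (pt 1 z))"
    using h_T_pos by (intro integral_density) (auto simp: less_imp_le)
  finally show ?thesis .
qed

end

lemma omega_AE_iff: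
  assumes P: "Measurable.pred borel (\<lambda>z. P (pt 1 z))"
  shows "(AE p in omega. P p) \<longleftrightarrow> (AE z in lborel. P (pt 1 z))"
proof -
  note [measurable] = P chart_measurable h_T_measurable
  have "(\<lambda>z. P (pt 1 z)) \<in> borel_measurable borel"
    using measurable_compose[OF P, of id borel] by (simp add: measurable_def)
  then have "P \<in> borel_measurable borel" by (rule borel_P1I)
  then have [measurable]: "{p. P p} \<in> sets borel"
    using measurable_sets[of P borel borel "{True}"] by (simp add: vimage_def)
  show ?thesis unfolding omega_def
    using h_T_pos by (subst AE_distr_iff) (auto simp: AE_density)
qed

section \<open>Sections in the two charts\<close>

lemma is_sectionD:
  assumes "is_section m s"
  shows "s 0 = 0" "c \<noteq> 0 \<Longrightarrow> (x0, x1) \<noteq> 0 \<Longrightarrow> s (c * x0, c * x1) = c ^ m * s (x0, x1)"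
  using assms unfolding is_section_def by blast+

lemma section_eq_chart0:
  assumes "is_section m s" "x0 \<noteq> 0" shows "s (x0, x1) = x0 ^ m * s (1, x1 / x0)"
  using is_sectionD(2)[OF assms, of 1 "x1 / x0"] assms(2) by (simp add: zero_prod_def)

lemma section_eq_chart1:
  assumes "is_section m s" "x1 \<noteq> 0" shows "s (x0, x1) = x1 ^ m * s (x0 / x1, 1)"
  using is_sectionD(2)[OF assms, of "x0 / x1" 1] assms(2) by (simp add: zero_prod_def)

lemma is_section_add: "is_section m s \<Longrightarrow> is_section m t \<Longrightarrow> is_section m (\<lambda>x. s x + t x)"
  and is_section_scale: "is_section m s \<Longrightarrow> is_section m (\<lambda>x. a * s x)"
  and is_section_diff: "is_section m s \<Longrightarrow> is_section m t \<Longrightarrow> is_section m (\<lambda>x. s x - t x)"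
  and is_section_zero: "is_section m (\<lambda>x. 0)"
  by (auto simp: is_section_def algebra_simps)

text \<open>
  The representative chosen by \<open>hcoords\<close> is arbitrary; by homogeneity any other one gives the same value,
  because numerator and denominator both scale by $|c|^{2m}$.
\<close>

lemma h_metric_pt:
  assumes "is_section m s" "is_section m t" "(x0, x1) \<noteq> 0"
  shows "h_metric m s t (pt x0 x1) =
    s (x0, x1) * cnj (t (x0, x1)) / of_real (max (cmod x0) (cmod x1) ^ (2 * m))"
proof -
  obtain c where c: "c \<noteq> 0" "hcoords (pt x0 x1) = (c * x0, c * x1)"
    using hcoords_pt[OF assms(3)] by blast
  let ?M = "max (cmod x0) (cmod x1)"
  have M: "max (cmod (c * x0)) (cmod (c * x1)) = cmod c * ?M"
    by (simp add: norm_mult max_mult_distrib_left)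
  have "c ^ m * cnj c ^ m = (complex_of_real ((cmod c)\<^sup>2)) ^ m"
    by (simp only: complex_norm_square power_mult_distrib)
  then have k: "c ^ m * cnj c ^ m = complex_of_real (cmod c ^ (2 * m))"
    by (simp add: power_mult)
  have k0: "complex_of_real (cmod c ^ (2 * m)) \<noteq> 0" using c(1) by simp
  have "h_metric m s t (pt x0 x1) = (c ^ m * cnj c ^ m) * (s (x0, x1) * cnj (t (x0, x1))) /
      of_real ((cmod c * ?M) ^ (2 * m))"
    unfolding h_metric_def Let_def c(2) fst_conv snd_conv M
      is_sectionD(2)[OF assms(1) c(1) assms(3)] is_sectionD(2)[OF assms(2) c(1) assms(3)]
    by (simp add: mult_ac)
  also have "\<dots> = (of_real (cmod c ^ (2 * m)) * (s (x0, x1) * cnj (t (x0, x1)))) /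
      (of_real (cmod c ^ (2 * m)) * of_real (?M ^ (2 * m)))"
    by (simp only: k power_mult_distrib of_real_mult)
  also have "\<dots> = s (x0, x1) * cnj (t (x0, x1)) / of_real (?M ^ (2 * m))"
    by (rule mult_divide_mult_cancel_left[OF k0])
  finally show ?thesis .
qed

lemma h_metric_affine:
  assumes "is_section m s" "is_section m t"
  shows "h_metric m s t (pt 1 z) = s (1, z) * cnj (t (1, z)) / of_real (max 1 (cmod z) ^ (2 * m))"
  using h_metric_pt[OF assms, of 1 z] by (simp add: zero_prod_def)

section \<open>Change of variables in the complex plane\<close>

text \<open>
  The change of variables theorem is about Cartesian powers of the reals, so integrals over the complex
  plane are carried to \<open>real ^ 2\<close> and back.
\<close>

definition vec_of :: "complex \<Rightarrow> real ^ 2" where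
  "vec_of z = vector [Re z, Im z]"

definition complex_of :: "real ^ 2 \<Rightarrow> complex" where
  "complex_of v = Complex (v $ 1) (v $ 2)"

lemma vec_of_nth [simp]: "vec_of z $ 1 = Re z" "vec_of z $ 2 = Im z"
  by (simp_all add: vec_of_def)

lemma complex_of_vec_of [simp]: "complex_of (vec_of z) = z" "vec_of (complex_of v) = v"
  by (simp_all add: complex_of_def complex_eq_iff vec_eq_iff forall_2)

lemma linear_vec_of: "bounded_linear vec_of" and linear_complex_of: "bounded_linear complex_of"
proof -
  have "linear vec_of" "linear complex_of"
    by (auto intro!: linearI simp: vec_eq_iff forall_2 complex_of_def complex_eq_iff)
  then show "bounded_linear vec_of" "bounded_linear complex_of"
    by (simp_all add: linear_conv_bounded_linear)
qed

lemma measurable_vec_of [measurable]: "vec_of \<in> borel_measurable borel"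
  and measurable_complex_of [measurable]: "complex_of \<in> borel_measurable borel"
  using bounded_linear.linear linear_vec_of linear_complex_of
  by (auto intro!: borel_measurable_continuous_onI linear_continuous_on)

lemma lborel_complex_eq_distr_vec: "(lborel :: complex measure) = distr lborel borel complex_of"
proof (rule lborel_eqI)
  fix l u :: complex
  assume le: "\<And>b. b \<in> Basis \<Longrightarrow> l \<bullet> b \<le> u \<bullet> b"
  have pre: "complex_of -` box l u = box (vec_of l) (vec_of u)"
    by (auto simp: box_def Basis_complex_def complex_of_def mem_box_cart forall_2 Basis_vec_def UNIV_2 inner_axis)
  have "emeasure (distr lborel borel complex_of) (box l u) = emeasure lborel (box (vec_of l) (vec_of u))"
    by (subst emeasure_distr) (auto simp: pre)
  also have "\<dots> = (\<Prod>b\<in>Basis. (u - l) \<bullet> b)"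
    using le[of 1] le[of \<i>]
    by (subst emeasure_lborel_box)
      (auto simp: Basis_complex_def Basis_vec_def UNIV_2 inner_axis axis_eq_axis inner_diff_left)
  finally show "emeasure (distr lborel borel complex_of) (box l u) = (\<Prod>b\<in>Basis. (u - l) \<bullet> b)" .
qed simp

lemma lborel_complex_eq_distr_prod:
  "(lborel :: complex measure) = distr lborel borel (\<lambda>p. Complex (fst p) (snd p))"
proof (rule lborel_eqI)
  have [measurable]: "(\<lambda>p. Complex (fst p) (snd p)) \<in> borel_measurable borel"
    by (auto intro!: borel_measurable_continuous_onI continuous_intros simp: Complex_eq)
  fix l u :: complex
  assume le: "\<And>b. b \<in> Basis \<Longrightarrow> l \<bullet> b \<le> u \<bullet> b"
  have pre: "(\<lambda>p. Complex (fst p) (snd p)) -` box l u = box (Re l, Im l) (Re u, Im u)"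
    by (auto simp: box_def Basis_complex_def Basis_prod_def)
  have "emeasure (distr lborel borel (\<lambda>p. Complex (fst p) (snd p))) (box l u)
      = emeasure lborel (box (Re l, Im l) (Re u, Im u))"
    by (subst emeasure_distr) (auto simp: pre)
  also have "\<dots> = (\<Prod>b\<in>Basis. (u - l) \<bullet> b)"
    using le[of 1] le[of \<i>]
    by (subst emeasure_lborel_box) (auto simp: Basis_complex_def Basis_prod_def)
  finally show "emeasure (distr lborel borel (\<lambda>p. Complex (fst p) (snd p))) (box l u) = (\<Prod>b\<in>Basis. (u - l) \<bullet> b)" .
qed simp

lemma set_integral_via_vec:
  fixes K :: "complex \<Rightarrow> complex"
  assumes [measurable]: "(\<lambda>z. indicator S z *\<^sub>R K z) \<in> borel_measurable borel"
  shows "(\<lambda>v. vec_of (K (complex_of v))) absolutely_integrable_on (complex_of -` S)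
           \<longleftrightarrow> set_integrable lborel S K" (is ?A)
    and "set_integrable lborel S K \<Longrightarrow>
      integral (complex_of -` S) (\<lambda>v. vec_of (K (complex_of v))) = vec_of (LINT z:S|lborel. K z)" (is "_ \<Longrightarrow> ?B")
proof -
  let ?k = "\<lambda>z. indicator S z *\<^sub>R K z"
  have eq: "indicator (complex_of -` S) v *\<^sub>R vec_of (K (complex_of v)) = vec_of (?k (complex_of v))" for v
    using bounded_linear.linear[OF linear_vec_of] by (simp add: linear_scale indicator_def linear_0)
  have m: "(\<lambda>v. vec_of (?k (complex_of v))) \<in> borel_measurable borel" by measurable
  have "(\<lambda>v. vec_of (K (complex_of v))) absolutely_integrable_on (complex_of -` S)
      \<longleftrightarrow> integrable lborel (\<lambda>v. vec_of (?k (complex_of v)))"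
    unfolding set_integrable_def eq using m by (subst integrable_completion) auto
  also have "\<dots> \<longleftrightarrow> integrable lborel (\<lambda>v. ?k (complex_of v))"
    using integrable_bounded_linear[OF linear_vec_of, of lborel "\<lambda>v. ?k (complex_of v)"]
      integrable_bounded_linear[OF linear_complex_of, of lborel "\<lambda>v. vec_of (?k (complex_of v))"] by auto
  also have "\<dots> \<longleftrightarrow> integrable lborel ?k"
    by (subst lborel_complex_eq_distr_vec) (simp add: integrable_distr_eq)
  finally show A: ?A by (simp add: set_integrable_def)
  assume *: "set_integrable lborel S K"
  then have int: "integrable lborel (\<lambda>v. ?k (complex_of v))"
    unfolding set_integrable_def
    by (subst (asm) lborel_complex_eq_distr_vec) (simp add: integrable_distr_eq)
  have "integral (complex_of -` S) (\<lambda>v. vec_of (K (complex_of v)))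
      = integral\<^sup>L lebesgue (\<lambda>v. vec_of (?k (complex_of v)))"
    using A * by (subst set_lebesgue_integral_eq_integral(2)[symmetric])
      (auto simp: set_lebesgue_integral_def eq)
  also have "\<dots> = integral\<^sup>L lborel (\<lambda>v. vec_of (?k (complex_of v)))"
    using m by (subst integral_completion) auto
  also have "\<dots> = vec_of (integral\<^sup>L lborel (\<lambda>v. ?k (complex_of v)))"
    by (rule integral_bounded_linear[OF linear_vec_of int])
  also have "\<dots> = vec_of (LINT z:S|lborel. K z)"
    unfolding set_lebesgue_integral_def
    by (subst lborel_complex_eq_distr_vec) (simp add: integral_distr)
  finally show ?B .
qed

text \<open>
  The Jacobian determinant of a real-linear map $L$ of the plane is
  $\mathrm{Im}(\overline{L(1)} L(i))$; its absolute value is $|c|^2$ for multiplication by $c$.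
\<close>

lemma complex_change_of_variables:
  fixes f g :: "complex \<Rightarrow> complex"
  assumes S: "S \<in> sets borel" and gS: "g ` S \<in> sets borel"
    and der: "\<And>z. z \<in> S \<Longrightarrow> (g has_derivative g' z) (at z within S)"
    and inj: "inj_on g S"
    and f [measurable]: "f \<in> borel_measurable borel"
    and J: "\<And>z. z \<in> S \<Longrightarrow> \<bar>Im (cnj (g' z 1) * g' z \<i>)\<bar> = J z"
    and meas: "(\<lambda>z. indicator S z *\<^sub>R (J z *\<^sub>R f (g z))) \<in> borel_measurable borel"
  shows "set_integrable lborel S (\<lambda>z. J z *\<^sub>R f (g z)) \<longleftrightarrow> set_integrable lborel (g ` S) f"
    and "set_integrable lborel (g ` S) f \<Longrightarrow>
           (LINT z:S|lborel. J z *\<^sub>R f (g z)) = (LINT z:g ` S|lborel. f z)"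
proof -
  define G where "G = (\<lambda>v. vec_of (g (complex_of v)))"
  define G' where "G' = (\<lambda>v w. vec_of (g' (complex_of v) (complex_of w)))"
  define F where "F = (\<lambda>v. vec_of (f (complex_of v)))"
  let ?T = "complex_of -` S"
  have T: "?T \<in> sets lebesgue"
    using measurable_sets[OF measurable_complex_of S] by simp
  have derG: "(G has_derivative G' v) (at v within ?T)" if "v \<in> ?T" for v
  proof -
    have "((\<lambda>v. g (complex_of v)) has_derivative (\<lambda>w. g' (complex_of v) (complex_of w))) (at v within ?T)"
      by (rule has_derivative_in_compose[OF bounded_linear_imp_has_derivative[OF linear_complex_of]])
        (use that in \<open>auto intro!: has_derivative_subset[OF der]\<close>)
    then show ?thesis
      unfolding G_def G'_def by (rule bounded_linear.has_derivative[OF linear_vec_of])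
  qed
  have injG: "inj_on G ?T"
    using inj unfolding G_def inj_on_def by (metis complex_of_vec_of vimageE)
  have GT: "G ` ?T = complex_of -` (g ` S)"
  proof (intro set_eqI iffI)
    fix v assume "v \<in> complex_of -` (g ` S)"
    then obtain z where "z \<in> S" "complex_of v = g z" by auto
    then show "v \<in> G ` ?T"
      by (intro image_eqI[of _ _ "vec_of z"]) (auto simp: G_def, metis complex_of_vec_of(2))
  qed (auto simp: G_def)
  have det: "\<bar>det (matrix (G' v))\<bar> = J (complex_of v)" if "v \<in> ?T" for v
  proof -
    have "complex_of (axis 1 1) = 1" "complex_of (axis 2 1) = \<i>"
      by (simp_all add: complex_of_def complex_eq_iff axis_def)
    then have "det (matrix (G' v)) = Im (cnj (g' (complex_of v) 1) * g' (complex_of v) \<i>)"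
      by (simp add: det_2 matrix_def G'_def)
    then show ?thesis using J that by simp
  qed
  have meas': "(\<lambda>z. indicator (g ` S) z *\<^sub>R f z) \<in> borel_measurable borel"
    using gS by measurable
  note L = set_integral_via_vec[OF meas] and R = set_integral_via_vec[OF meas']
  let ?K = "\<lambda>v. vec_of (J (complex_of v) *\<^sub>R f (g (complex_of v)))"
  have K: "\<bar>det (matrix (G' v))\<bar> *\<^sub>R F (G v) = ?K v" if "v \<in> ?T" for v
    using det[OF that] linear_scale[OF bounded_linear.linear[OF linear_vec_of]]
    by (simp add: F_def G_def)
  have e1: "(\<lambda>v. \<bar>det (matrix (G' v))\<bar> *\<^sub>R F (G v)) absolutely_integrable_on ?T \<longleftrightarrow> ?K absolutely_integrable_on ?T"
    by (intro set_integrable_cong refl) (simp add: K)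
  have e2: "integral ?T (\<lambda>v. \<bar>det (matrix (G' v))\<bar> *\<^sub>R F (G v)) = integral ?T ?K"
    by (intro integral_cong) (simp add: K)
  have "(\<lambda>v. \<bar>det (matrix (G' v))\<bar> *\<^sub>R F (G v)) absolutely_integrable_on ?T \<and>
      integral ?T (\<lambda>v. \<bar>det (matrix (G' v))\<bar> *\<^sub>R F (G v)) = b \<longleftrightarrow>
      F absolutely_integrable_on (G ` ?T) \<and> integral (G ` ?T) F = b" for b
    by (rule has_absolute_integral_change_of_variables[OF T _ injG]) (rule derG)
  note cov = this[unfolded e1 e2 GT, unfolded F_def]
  show iff: "set_integrable lborel S (\<lambda>z. J z *\<^sub>R f (g z)) \<longleftrightarrow> set_integrable lborel (g ` S) f"
    using cov L(1) R(1) by blast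
  assume *: "set_integrable lborel (g ` S) f"
  then have "integral ?T ?K = vec_of (LINT z:g ` S|lborel. f z)"
    using cov[of "vec_of (LINT z:g ` S|lborel. f z)"] R by simp
  moreover have "integral ?T ?K = vec_of (LINT z:S|lborel. J z *\<^sub>R f (g z))"
    using L(2) iff * by simp
  ultimately show "(LINT z:S|lborel. J z *\<^sub>R f (g z)) = (LINT z:g ` S|lborel. f z)"
    by (metis complex_of_vec_of(1))
qed

section \<open>Wirtinger derivatives\<close>

lemma wirtinger_eqI:
  assumes "(f has_derivative (\<lambda>v. a * v + b * cnj v)) (at z)"
  shows "d_dz f z = a" "d_dzbar f z = b"
proof -
  have "frechet_derivative f (at z) = (\<lambda>v. a * v + b * cnj v)"
    using frechet_derivative_at[OF assms] by simp
  then show "d_dz f z = a" "d_dzbar f z = b"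
    by (simp_all add: d_dz_def d_dzbar_def algebra_simps)
qed

lemma has_wirtinger_derivative:
  assumes "(f has_derivative f') (at z)"
  shows "(f has_derivative (\<lambda>v. d_dz f z * v + d_dzbar f z * cnj v)) (at z)"
proof -
  have f': "frechet_derivative f (at z) = f'"
    using frechet_derivative_at[OF assms] by simp
  have "f' v = d_dz f z * v + d_dzbar f z * cnj v" for v
  proof -
    have v: "v = Re v *\<^sub>R 1 + Im v *\<^sub>R \<i>" by (simp add: complex_eq_iff)
    note lin = has_derivative_linear[OF assms]
    have "f' v = f' (Re v *\<^sub>R 1 + Im v *\<^sub>R \<i>)" using v by (rule arg_cong)
    also have "\<dots> = Re v *\<^sub>R f' 1 + Im v *\<^sub>R f' \<i>"
      by (simp only: linear_add[OF lin] linear_scale[OF lin])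
    also have "\<dots> = d_dz f z * v + d_dzbar f z * cnj v"
      unfolding d_dz_def d_dzbar_def f' by (simp add: complex_eq_iff field_simps)
    finally show ?thesis .
  qed
  then have "f' = (\<lambda>v. d_dz f z * v + d_dzbar f z * cnj v)" by blast
  then show ?thesis using assms by simp
qed

lemma smooth_on_wirtinger:
  "smooth_on S f \<Longrightarrow> z \<in> S \<Longrightarrow> (f has_derivative (\<lambda>v. d_dz f z * v + d_dzbar f z * cnj v)) (at z)"
  by (rule has_wirtinger_derivative[OF smooth_on_has_derivative])

lemma smooth_on_d_dz:
  assumes "open S" "smooth_on S f" shows "smooth_on S (d_dz f)"
proof -
  have "smooth_on S (\<lambda>z. (1 / 2) * (frechet_derivative f (at z) 1 - \<i> * frechet_derivative f (at z) \<i>))"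
    by (intro smooth_on_mult smooth_on_diff smooth_on_const smooth_on_frechet assms)
  then show ?thesis by (rule smooth_on_cong[OF assms(1)]) (simp add: d_dz_def)
qed

lemma smooth_on_d_dzbar:
  assumes "open S" "smooth_on S f" shows "smooth_on S (d_dzbar f)"
proof -
  have "smooth_on S (\<lambda>z. (1 / 2) * (frechet_derivative f (at z) 1 + \<i> * frechet_derivative f (at z) \<i>))"
    by (intro smooth_on_mult smooth_on_add smooth_on_const smooth_on_frechet assms)
  then show ?thesis by (rule smooth_on_cong[OF assms(1)]) (simp add: d_dzbar_def)
qed

lemma has_wirtinger_mult:
  assumes "(f has_derivative (\<lambda>v. a * v + b * cnj v)) (at z)"
    and "(g has_derivative (\<lambda>v. c * v + d * cnj v)) (at z)"
  shows "((\<lambda>z. f z * g z) has_derivative (\<lambda>v. (a * g z + f z * c) * v + (b * g z + f z * d) * cnj v)) (at z)"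
  by (rule has_derivative_eq_rhs[OF has_derivative_mult[OF assms]]) (simp add: algebra_simps)

lemma has_wirtinger_cnj:
  assumes "(f has_derivative (\<lambda>v. a * v + b * cnj v)) (at z)"
  shows "((\<lambda>z. cnj (f z)) has_derivative (\<lambda>v. cnj b * v + cnj a * cnj v)) (at z)"
  by (rule has_derivative_eq_rhs[OF bounded_linear.has_derivative[OF bounded_linear_cnj assms]]) auto

lemma has_wirtinger_holomorphic:
  assumes "(f has_field_derivative a) (at z)"
  shows "(f has_derivative (\<lambda>v. a * v + 0 * cnj v)) (at z)"
  using assms by (simp add: has_field_derivative_def)

lemma has_wirtinger_compose:
  assumes "(\<phi> has_field_derivative c) (at z)"
    and "(f has_derivative (\<lambda>v. a * v + b * cnj v)) (at (\<phi> z))"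
  shows "((\<lambda>z. f (\<phi> z)) has_derivative (\<lambda>v. (a * c) * v + (b * cnj c) * cnj v)) (at z)"
proof -
  have "(\<phi> has_derivative (\<lambda>v. c * v)) (at z)"
    using assms(1) by (simp add: has_field_derivative_def)
  from has_derivative_compose[OF this, of f "\<lambda>v. a * v + b * cnj v"] assms(2)
  have "((\<lambda>z. f (\<phi> z)) has_derivative (\<lambda>v. a * (c * v) + b * cnj (c * v))) (at z)" by simp
  then show ?thesis by (simp add: mult_ac)
qed

lemma wirtinger_cong:
  assumes "open S" "z \<in> S" "\<And>w. w \<in> S \<Longrightarrow> f w = g w"
  shows "d_dz f z = d_dz g z" "d_dzbar f z = d_dzbar g z"
proof -
  have "(f has_derivative F) (at z) \<longleftrightarrow> (g has_derivative F) (at z)" for F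
    using has_derivative_transform_within_open[OF _ assms(1,2), of f F UNIV g]
      has_derivative_transform_within_open[OF _ assms(1,2), of g F UNIV f] assms(3) by auto
  then have "frechet_derivative f (at z) = frechet_derivative g (at z)"
    by (simp add: frechet_derivative_def)
  then show "d_dz f z = d_dz g z" "d_dzbar f z = d_dzbar g z"
    by (simp_all add: d_dz_def d_dzbar_def)
qed

section \<open>Polar coordinates and Green's formula on the unit disc\<close>

lemma AE_lborel_negligible:
  assumes "negligible N" "N \<in> sets borel" shows "AE z in lborel. z \<notin> N"
proof (rule AE_not_in)
  show "N \<in> null_sets lborel"
    using assms null_sets_completion_iff[of N lborel] by (simp add: negligible_iff_null_sets)
qed

lemma unit_ball_measurable [measurable]:
  "ball (0::complex) 1 \<in> sets borel" "- cball (0::complex) 1 \<in> sets borel"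
  by auto

text \<open>
  Polar coordinates map the open rectangle onto the disc minus the slit along the nonpositive real
  axis, which has measure zero.
\<close>

lemma polar_integral:
  fixes f :: "complex \<Rightarrow> complex"
  assumes cont: "continuous_on UNIV f"
  shows "(LINT z:ball 0 1|lborel. f z) =
    integral (cbox (0, - pi) (1, pi)) (\<lambda>p. fst p *\<^sub>R f (of_real (fst p) * cis (snd p)))"
proof -
  define g where "g = (\<lambda>\<zeta>. of_real (Re \<zeta>) * cis (Im \<zeta>))"
  define g' where "g' = (\<lambda>\<zeta> v. of_real (Re v) * cis (Im \<zeta>) + of_real (Re \<zeta>) * (\<i> * of_real (Im v) * cis (Im \<zeta>)))"
  define S where "S = {\<zeta>. 0 < Re \<zeta> \<and> Re \<zeta> < 1 \<and> - pi < Im \<zeta> \<and> Im \<zeta> < pi}"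
  let ?k = "\<lambda>\<zeta>. Re \<zeta> *\<^sub>R f (g \<zeta>)"
  let ?H = "\<lambda>p. fst p *\<^sub>R f (of_real (fst p) * cis (snd p))"
  have f [measurable]: "f \<in> borel_measurable borel"
    using cont by (rule borel_measurable_continuous_onI)
  have [measurable]: "f \<in> borel_measurable lborel" "ball (0::complex) 1 \<in> sets borel"
    using f by auto
  have contg: "continuous_on UNIV g" unfolding g_def by (intro continuous_intros)
  have opS: "open S"
    unfolding S_def by (intro open_Collect_conj open_Collect_less continuous_intros)
  have gS: "g ` S = ball 0 1 - {z. Im z = 0 \<and> Re z \<le> 0}"
  proof (intro set_eqI iffI)
    fix z assume "z \<in> g ` S"
    then obtain \<zeta> where \<zeta>: "\<zeta> \<in> S" "z = g \<zeta>" by blast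
    have pos: "0 < Re \<zeta>" "Re \<zeta> < 1" "- pi < Im \<zeta>" "Im \<zeta> < pi" using \<zeta>(1) by (auto simp: S_def)
    have "cmod z < 1" using pos by (simp add: \<zeta>(2) g_def norm_mult)
    moreover have "\<not> (Im z = 0 \<and> Re z \<le> 0)"
    proof
      assume z: "Im z = 0 \<and> Re z \<le> 0"
      then have "sin (Im \<zeta>) = 0" using pos by (simp add: \<zeta>(2) g_def)
      then have "Im \<zeta> = 0" using pos sin_zero_pi_iff[of "Im \<zeta>"] by (auto simp: abs_less_iff)
      with z pos show False by (simp add: \<zeta>(2) g_def)
    qed
    ultimately show "z \<in> ball 0 1 - {z. Im z = 0 \<and> Re z \<le> 0}" by auto
  next
    fix z assume z: "z \<in> ball 0 1 - {z. Im z = 0 \<and> Re z \<le> 0}"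
    then have z0: "z \<noteq> 0" by auto
    have "Arg z \<noteq> pi" using z Arg_eq_pi[of z] by auto
    then have "Complex (cmod z) (Arg z) \<in> S"
      using z z0 Arg_bounded[of z] by (auto simp: S_def)
    moreover have "z = g (Complex (cmod z) (Arg z))"
      using rcis_cmod_Arg[of z] by (simp add: g_def rcis_def)
    ultimately show "z \<in> g ` S" by blast
  qed
  have der: "(g has_derivative g' \<zeta>) (at \<zeta> within S)" for \<zeta>
  proof -
    have "((\<lambda>\<zeta>. cis (Im \<zeta>)) has_derivative (\<lambda>v. \<i> * of_real (Im v) * cis (Im \<zeta>))) (at \<zeta> within S)"
    proof -
      have "((\<lambda>\<zeta>. \<i> * of_real (Im \<zeta>)) has_derivative (\<lambda>v. \<i> * of_real (Im v))) (at \<zeta> within S)"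
        by (intro has_derivative_mult_right has_derivative_of_real has_derivative_Im has_derivative_ident)
      from has_derivative_compose[OF this DERIV_exp[unfolded has_field_derivative_def]]
      show ?thesis unfolding cis_conv_exp by (simp add: mult_ac)
    qed
    moreover have "((\<lambda>\<zeta>. complex_of_real (Re \<zeta>)) has_derivative (\<lambda>v. of_real (Re v))) (at \<zeta> within S)"
      by (intro has_derivative_of_real has_derivative_Re has_derivative_ident)
    ultimately have "(g has_derivative (\<lambda>v. of_real (Re \<zeta>) * (\<i> * of_real (Im v) * cis (Im \<zeta>)) + of_real (Re v) * cis (Im \<zeta>)))
        (at \<zeta> within S)"
      unfolding g_def by (intro has_derivative_mult)
    then show ?thesis unfolding g'_def by (simp add: add.commute)
  qed
  have inj: "inj_on g S"
  proof (rule inj_onI)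
    fix \<zeta> \<eta> assume *: "\<zeta> \<in> S" "\<eta> \<in> S" "g \<zeta> = g \<eta>"
    have pos: "0 < Re \<zeta>" "- pi < Im \<zeta>" "Im \<zeta> < pi" "0 < Re \<eta>" "- pi < Im \<eta>" "Im \<eta> < pi"
      using *(1,2) by (auto simp: S_def)
    have "cmod (g \<zeta>) = Re \<zeta>" "cmod (g \<eta>) = Re \<eta>" using pos by (auto simp: g_def norm_mult)
    moreover have "Arg (g \<zeta>) = Im \<zeta>" "Arg (g \<eta>) = Im \<eta>"
      using pos by (auto simp: g_def Arg_times_of_real intro!: Arg_cis)
    ultimately show "\<zeta> = \<eta>" using *(3) by (simp add: complex_eq_iff)
  qed
  have J: "\<bar>Im (cnj (g' \<zeta> 1) * g' \<zeta> \<i>)\<bar> = Re \<zeta>" if "\<zeta> \<in> S" for \<zeta>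
  proof -
    have "cnj (g' \<zeta> 1) * g' \<zeta> \<i> = of_real (Re \<zeta>) * \<i> * (cis (Im \<zeta>) * cnj (cis (Im \<zeta>)))"
      by (simp add: g'_def)
    also have "cis (Im \<zeta>) * cnj (cis (Im \<zeta>)) = 1"
      by (simp add: complex_mult_cnj cis.simps)
    finally show ?thesis using that by (simp add: S_def)
  qed
  have meas: "(\<lambda>z. indicator S z *\<^sub>R ?k z) \<in> borel_measurable borel"
  proof -
    have [measurable]: "g \<in> borel_measurable borel" using contg by (rule borel_measurable_continuous_onI)
    have [measurable]: "S \<in> sets borel" using opS by simp
    show ?thesis by measurable
  qed
  have slit: "closed {z. Im z = 0 \<and> Re z \<le> 0}"
    by (intro closed_Collect_conj closed_Collect_eq closed_Collect_le continuous_intros)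
  have gSb [measurable]: "g ` S \<in> sets borel" unfolding gS using slit by auto
  have "negligible {z. \<i> \<bullet> z = 0}" by (rule negligible_hyperplane) simp
  then have AE: "AE z in lborel. Im z \<noteq> 0"
    using AE_lborel_negligible[of "{z. \<i> \<bullet> z = 0}"] by simp
  have "set_integrable lborel (cball 0 1) f"
    unfolding set_integrable_def
    by (rule borel_integrable_compact[OF compact_cball continuous_on_subset[OF cont]]) simp
  then have int_ball: "set_integrable lborel (ball 0 1) f"
    by (rule set_integrable_subset) auto
  have ind: "AE z in lborel. indicator (ball 0 1) z *\<^sub>R f z = indicator (g ` S) z *\<^sub>R f z"
    using AE unfolding gS by eventually_elim (auto simp: indicator_def)
  have eq1: "(LINT z:ball 0 1|lborel. f z) = (LINT z:g ` S|lborel. f z)"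
    unfolding set_lebesgue_integral_def by (rule integral_cong_AE[OF _ _ ind]; measurable)
  have int_gS: "set_integrable lborel (g ` S) f"
    by (rule set_integrable_subset[OF int_ball]) (use gSb in \<open>auto simp: gS\<close>)
  have eq2: "(LINT z:g ` S|lborel. f z) = (LINT z:S|lborel. ?k z)"
    using complex_change_of_variables(2)[OF _ gSb der inj _ J meas int_gS] opS by simp
  have bx: "(Complex (fst p) (snd p) \<in> S) = (p \<in> box (0, - pi) (1, pi))" for p
    by (cases p) (auto simp: S_def box_def Basis_prod_def)
  have eq3: "(LINT z:S|lborel. ?k z) = (LINT p:box (0, - pi) (1, pi)|lborel. ?H p)"
  proof -
    have [measurable]: "(\<lambda>p. Complex (fst p) (snd p)) \<in> borel_measurable borel"
      by (auto intro!: borel_measurable_continuous_onI continuous_intros simp: Complex_eq)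
    have "(LINT z:S|lborel. ?k z) = (LINT p|lborel. indicator S (Complex (fst p) (snd p)) *\<^sub>R ?k (Complex (fst p) (snd p)))"
      unfolding set_lebesgue_integral_def
      by (subst lborel_complex_eq_distr_prod, subst integral_distr) (use meas in auto)
    then show ?thesis
      by (simp add: set_lebesgue_integral_def indicator_def bx g_def)
  qed
  have contH: "continuous_on (cbox (0, - pi) (1, pi)) ?H"
    by (intro continuous_intros continuous_on_compose2[OF cont]) auto
  have "set_integrable lborel (cbox (0, - pi) (1, pi)) ?H"
    unfolding set_integrable_def by (rule borel_integrable_compact[OF compact_cbox contH])
  then have "set_integrable lborel (box (0, - pi) (1, pi)) ?H"
    by (rule set_integrable_subset) (auto simp: box_subset_cbox)
  then have "(LINT p:box (0, - pi) (1, pi)|lborel. ?H p) = integral (box (0, - pi) (1, pi)) ?H"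
    by (rule set_borel_integral_eq_integral(2))
  also have "\<dots> = integral (cbox (0, - pi) (1, pi)) ?H" by (rule integral_open_interval)
  finally show ?thesis using eq1 eq2 eq3 by simp
qed

lemma curve_derivative:
  assumes "(f has_derivative (\<lambda>v. a * v + b * cnj v)) (at (\<psi> t))"
    and "(\<psi> has_vector_derivative c) (at t within S)"
  shows "((\<lambda>t. f (\<psi> t)) has_vector_derivative (a * c + b * cnj c)) (at t within S)"
proof -
  have "(\<psi> has_derivative (\<lambda>h. h *\<^sub>R c)) (at t within S)"
    using assms(2) by (simp add: has_vector_derivative_def)
  from has_derivative_compose[OF this, of f "\<lambda>v. a * v + b * cnj v"] assms(1)
  have "((\<lambda>t. f (\<psi> t)) has_derivative (\<lambda>h. a * (h *\<^sub>R c) + b * cnj (h *\<^sub>R c))) (at t within S)"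
    by simp
  then show ?thesis
    by (simp add: has_vector_derivative_def algebra_simps scaleR_conv_of_real)
qed

text \<open>
  In polar coordinates the integrand $r\,\partial_{\bar z}P$ is the divergence
  $\frac12(\partial_r(r e^{i\theta}P) + \partial_\theta(i e^{i\theta}P))$. The angular part integrates to zero by
  periodicity, the radial one to its value at $r = 1$.
\<close>

lemma green_disc:
  assumes P: "smooth_on UNIV P"
  shows "(LINT z:ball 0 1|lborel. d_dzbar P z) = (1 / 2) * integral {- pi..pi} (\<lambda>\<theta>. cis \<theta> * P (cis \<theta>))"
proof -
  let ?z = "\<lambda>r \<theta>. complex_of_real r * cis \<theta>"
  \<comment> \<open>\<open>A\<close> and \<open>B\<close> are the radial and the angular derivative in this divergence\<close>
  define A where "A = (\<lambda>r \<theta>. (1 / 2) * (cis \<theta> * P (?z r \<theta>) +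
      of_real r * cis \<theta> * (d_dz P (?z r \<theta>) * cis \<theta> + d_dzbar P (?z r \<theta>) * cnj (cis \<theta>))))"
  define B where "B = (\<lambda>r \<theta>. (1 / 2) * (\<i> * (\<i> * cis \<theta>) * P (?z r \<theta>) +
      \<i> * cis \<theta> * (d_dz P (?z r \<theta>) * (of_real r * (\<i> * cis \<theta>)) +
        d_dzbar P (?z r \<theta>) * cnj (of_real r * (\<i> * cis \<theta>)))))"
  have cP: "continuous_on UNIV P" "continuous_on UNIV (d_dz P)" "continuous_on UNIV (d_dzbar P)"
    by (intro smooth_on_continuous smooth_on_d_dz smooth_on_d_dzbar P open_UNIV)+
  note cont = continuous_on_compose2[OF cP(1)] continuous_on_compose2[OF cP(2)] continuous_on_compose2[OF cP(3)]
  have cA: "continuous_on (cbox (0, - pi) (1, pi)) (\<lambda>(r, \<theta>). A r \<theta>)"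
    unfolding A_def case_prod_beta by (intro continuous_intros cont) auto
  have cB: "continuous_on (cbox (0, - pi) (1, pi)) (\<lambda>(r, \<theta>). B r \<theta>)"
    unfolding B_def case_prod_beta by (intro continuous_intros cont) auto
  have AB: "r *\<^sub>R d_dzbar P (?z r \<theta>) = A r \<theta> + B r \<theta>" for r \<theta>
  proof -
    have cc: "cis \<theta> * cnj (cis \<theta>) = 1"
      by (simp add: complex_mult_cnj cis.simps)
    have "A r \<theta> + B r \<theta> = (cis \<theta> * cnj (cis \<theta>)) * (of_real r * d_dzbar P (?z r \<theta>))"
      unfolding A_def B_def by (simp add: algebra_simps)
    then show ?thesis by (simp only: cc scaleR_conv_of_real mult_1)
  qed
  have der: "(P has_derivative (\<lambda>v. d_dz P z * v + d_dzbar P z * cnj v)) (at z)" for z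
    by (rule smooth_on_wirtinger[OF P]) simp
  have dr: "((\<lambda>r. P (?z r \<theta>)) has_vector_derivative (d_dz P (?z r \<theta>) * cis \<theta> + d_dzbar P (?z r \<theta>) * cnj (cis \<theta>)))
      (at r within S)" for r \<theta> S
    by (rule curve_derivative[OF der]) (auto intro!: derivative_eq_intros simp: has_vector_derivative_def scaleR_conv_of_real)
  have dcis: "(cis has_vector_derivative (\<i> * cis \<theta>)) (at \<theta> within S)" for \<theta> S
  proof -
    have "((\<lambda>t. \<i> * of_real t) has_vector_derivative (\<i> * of_real 1)) (at \<theta> within S)"
      by (rule has_vector_derivative_mult_right) (auto intro!: derivative_eq_intros simp: has_vector_derivative_def scaleR_conv_of_real)
    note curve_derivative[OF has_wirtinger_holomorphic[OF DERIV_exp] this]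
    moreover have "cis = (\<lambda>t. exp (\<i> * of_real t))" by (rule ext) (rule cis_conv_exp)
    ultimately show ?thesis by (simp add: mult_ac cis_conv_exp)
  qed
  have dt: "((\<lambda>\<theta>. P (?z r \<theta>)) has_vector_derivative (d_dz P (?z r \<theta>) * (of_real r * (\<i> * cis \<theta>)) +
      d_dzbar P (?z r \<theta>) * cnj (of_real r * (\<i> * cis \<theta>)))) (at \<theta> within S)" for r \<theta> S
    by (rule curve_derivative[OF der]) (rule has_vector_derivative_mult_right[OF dcis])
  have IA: "integral (cbox 0 1) (\<lambda>r. A r \<theta>) = (1 / 2) * (cis \<theta> * P (cis \<theta>))" for \<theta>
  proof -
    have "((\<lambda>r. A r \<theta>) has_integral
        ((1 / 2) * (of_real 1 * cis \<theta> * P (?z 1 \<theta>)) - (1 / 2) * (of_real 0 * cis \<theta> * P (?z 0 \<theta>)))) {0..1}"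
    proof (rule fundamental_theorem_of_calculus[where f = "\<lambda>r. (1 / 2) * (of_real r * cis \<theta> * P (?z r \<theta>))"])
      fix r :: real
      have "((\<lambda>r. of_real r * cis \<theta>) has_vector_derivative cis \<theta>) (at r within {0..1})"
        by (auto intro!: derivative_eq_intros simp: has_vector_derivative_def scaleR_conv_of_real)
      from has_vector_derivative_mult_right[OF has_vector_derivative_mult[OF this dr], of "1 / 2"]
      show "((\<lambda>r. (1 / 2) * (of_real r * cis \<theta> * P (?z r \<theta>))) has_vector_derivative A r \<theta>) (at r within {0..1})"
        by (rule has_vector_derivative_eq_rhs) (simp add: A_def algebra_simps)
    qed simp
    then show ?thesis by (simp add: integral_unique)
  qed
  have IB: "integral (cbox (- pi) pi) (\<lambda>\<theta>. B r \<theta>) = 0" for r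
  proof -
    have "((\<lambda>\<theta>. B r \<theta>) has_integral
        ((1 / 2) * (\<i> * cis pi * P (?z r pi)) - (1 / 2) * (\<i> * cis (- pi) * P (?z r (- pi))))) {- pi..pi}"
    proof (rule fundamental_theorem_of_calculus[where f = "\<lambda>\<theta>. (1 / 2) * (\<i> * cis \<theta> * P (?z r \<theta>))"])
      fix \<theta> :: real
      have "((\<lambda>\<theta>. \<i> * cis \<theta>) has_vector_derivative (\<i> * (\<i> * cis \<theta>))) (at \<theta> within {- pi..pi})"
        by (rule has_vector_derivative_mult_right[OF dcis])
      from has_vector_derivative_mult_right[OF has_vector_derivative_mult[OF this dt], of "1 / 2"]
      show "((\<lambda>\<theta>. (1 / 2) * (\<i> * cis \<theta> * P (?z r \<theta>))) has_vector_derivative B r \<theta>) (at \<theta> within {- pi..pi})"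
        by (rule has_vector_derivative_eq_rhs) (simp add: B_def algebra_simps)
    qed simp
    moreover have "cis (- pi) = cis pi" by (simp add: complex_eq_iff)
    ultimately have "((\<lambda>\<theta>. B r \<theta>) has_integral 0) {- pi..pi}"
      by (simp only: diff_self)
    then show ?thesis by (simp add: integral_unique)
  qed
  have "(LINT z:ball 0 1|lborel. d_dzbar P z) =
      integral (cbox (0, - pi) (1, pi)) (\<lambda>p. (\<lambda>(r, \<theta>). A r \<theta>) p + (\<lambda>(r, \<theta>). B r \<theta>) p)"
    unfolding polar_integral[OF cP(3)] AB by (simp add: case_prod_beta)
  also have "\<dots> = integral (cbox (0, - pi) (1, pi)) (\<lambda>(r, \<theta>). A r \<theta>) + integral (cbox (0, - pi) (1, pi)) (\<lambda>(r, \<theta>). B r \<theta>)"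
    by (intro integral_add integrable_continuous cA cB)
  also have "integral (cbox (0, - pi) (1, pi)) (\<lambda>(r, \<theta>). A r \<theta>)
      = integral (cbox 0 1) (\<lambda>r. integral (cbox (- pi) pi) (A r))"
    using integral_prod_continuous[OF cA] by simp
  also have "\<dots> = integral (cbox (- pi) pi) (\<lambda>\<theta>. integral (cbox 0 1) (\<lambda>r. A r \<theta>))"
    by (rule integral_swap_continuous[OF cA])
  also have "\<dots> = (1 / 2) * integral {- pi..pi} (\<lambda>\<theta>. cis \<theta> * P (cis \<theta>))"
    unfolding IA by simp
  also have "integral (cbox (0, - pi) (1, pi)) (\<lambda>(r, \<theta>). B r \<theta>)
      = integral (cbox 0 1) (\<lambda>r. integral (cbox (- pi) pi) (B r))"
    using integral_prod_continuous[OF cB] by simp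
  also have "\<dots> = 0" unfolding IB by simp
  finally show ?thesis by simp
qed

section \<open>The product of sections as an integral over two unit discs\<close>

lemma inversion_integral:
  fixes f :: "complex \<Rightarrow> complex"
  assumes [measurable]: "f \<in> borel_measurable borel"
  shows "set_integrable lborel (- cball 0 1) (\<lambda>z. (1 / cmod z ^ 4) *\<^sub>R f (inverse z)) \<longleftrightarrow>
           set_integrable lborel (ball 0 1) f"
    and "set_integrable lborel (ball 0 1) f \<Longrightarrow>
      (LINT z:- cball 0 1|lborel. (1 / cmod z ^ 4) *\<^sub>R f (inverse z)) = (LINT z:ball 0 1|lborel. f z)"
proof -
  let ?S = "- cball 0 1 :: complex set"
  have im: "inverse ` ?S = ball 0 1 - {0}"
  proof (intro set_eqI iffI)
    fix w :: complex assume "w \<in> inverse ` ?S"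
    then show "w \<in> ball 0 1 - {0}" by (auto simp: norm_inverse inverse_less_1_iff)
  next
    fix w :: complex assume "w \<in> ball 0 1 - {0}"
    then show "w \<in> inverse ` ?S"
      by (intro image_eqI[of _ _ "inverse w"]) (auto simp: norm_inverse one_less_inverse_iff not_le)
  qed
  have der: "(inverse has_derivative (\<lambda>v. - (inverse z ^ 2) * v)) (at z within ?S)" if "z \<in> ?S" for z
  proof -
    have "z \<noteq> 0" using that by auto
    from DERIV_inverse[OF this, of ?S] show ?thesis
      unfolding has_field_derivative_def
      by (rule has_derivative_eq_rhs) (simp add: fun_eq_iff power2_eq_square)
  qed
  have inj: "inj_on inverse ?S" by (auto intro: inj_onI)
  have J: "\<bar>Im (cnj (- (inverse z ^ 2) * 1) * (- (inverse z ^ 2) * \<i>))\<bar> = 1 / cmod z ^ 4" for z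
  proof -
    have "cnj (- (inverse z ^ 2) * 1) * (- (inverse z ^ 2) * \<i>) = \<i> * (inverse z ^ 2 * cnj (inverse z ^ 2))"
      by simp
    also have "inverse z ^ 2 * cnj (inverse z ^ 2) = of_real ((cmod (inverse z ^ 2))\<^sup>2)"
      by (rule complex_norm_square[symmetric])
    also have "(cmod (inverse z ^ 2))\<^sup>2 = 1 / cmod z ^ 4"
      by (simp add: norm_power norm_inverse power_inverse divide_inverse flip: power_mult)
    finally show ?thesis by simp
  qed
  have meas: "(\<lambda>z. indicator ?S z *\<^sub>R ((1 / cmod z ^ 4) *\<^sub>R f (inverse z))) \<in> borel_measurable borel"
    by measurable
  have gS: "inverse ` ?S \<in> sets borel" unfolding im by auto
  note cov = complex_change_of_variables[OF _ gS der inj assms J meas, unfolded im]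
  have AE: "AE z in lborel. indicator (ball 0 1 - {0}) z *\<^sub>R f z = indicator (ball 0 1) z *\<^sub>R f z"
    using AE_lborel_singleton[of "0::complex"] by eventually_elim (auto simp: indicator_def)
  have iff: "set_integrable lborel (ball 0 1 - {0}) f \<longleftrightarrow> set_integrable lborel (ball 0 1) f"
    unfolding set_integrable_def by (rule integrable_cong_AE[OF _ _ AE]; measurable)
  have eq: "(LINT z:ball 0 1 - {0}|lborel. f z) = (LINT z:ball 0 1|lborel. f z)"
    unfolding set_lebesgue_integral_def by (rule integral_cong_AE[OF _ _ AE]; measurable)
  show "set_integrable lborel ?S (\<lambda>z. (1 / cmod z ^ 4) *\<^sub>R f (inverse z)) \<longleftrightarrow>
      set_integrable lborel (ball 0 1) f"
    using cov(1) iff by simp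
  show "(LINT z:?S|lborel. (1 / cmod z ^ 4) *\<^sub>R f (inverse z)) = (LINT z:ball 0 1|lborel. f z)"
    if "set_integrable lborel (ball 0 1) f"
    using cov(2) iff eq that by simp
qed

lemma measurable_cnj [measurable]: "cnj \<in> borel_measurable borel"
  by (intro borel_measurable_continuous_onI continuous_intros)

definition measurable_section :: "nat \<Rightarrow> hom_fun \<Rightarrow> bool" where
  "measurable_section m s \<longleftrightarrow> is_section m s \<and>
     (\<lambda>z. s (1, z)) \<in> borel_measurable borel \<and> (\<lambda>w. s (w, 1)) \<in> borel_measurable borel"

lemma h_metric_affine_measurable:
  assumes "measurable_section m s" "measurable_section m t"
  shows "(\<lambda>z. h_metric m s t (pt 1 z)) \<in> borel_measurable borel"
proof -
  have [measurable]: "(\<lambda>z. s (1, z)) \<in> borel_measurable borel" "(\<lambda>z. t (1, z)) \<in> borel_measurable borel"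
    using assms by (auto simp: measurable_section_def)
  have "(\<lambda>z. h_metric m s t (pt 1 z)) =
      (\<lambda>z. s (1, z) * cnj (t (1, z)) / of_real (max 1 (cmod z) ^ (2 * m)))"
    using assms by (simp add: h_metric_affine measurable_section_def)
  then show ?thesis by simp
qed

lemma set_integrable_scale_iff:
  fixes f :: "'a \<Rightarrow> complex" and c :: real
  assumes "c \<noteq> 0"
  shows "set_integrable M A (\<lambda>z. c *\<^sub>R f z) \<longleftrightarrow> set_integrable M A f"
  using set_integrable_scaleR_right[of c M A f] assms
    set_integrable_scaleR_right[of "1 / c" M A "\<lambda>z. c *\<^sub>R f z"] by auto

text \<open>
  On the inner disc the density $h_T$ and the weight of the metric are 1. Outside, the factor $|z|^{-4}$ of
  $h_T$ is the Jacobian of $w = 1/z$, and the weight $|z|^{-2m}$ of the metric is absorbed by the change of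
  frame $s(1,z) = z^m s(1/z,1)$. The unit circle is a null set.
\<close>

lemma h_metric_two_discs:
  assumes s: "measurable_section m s" and t: "measurable_section m t"
  defines "F0 \<equiv> \<lambda>z. s (1, z) * cnj (t (1, z))" and "F1 \<equiv> \<lambda>w. s (w, 1) * cnj (t (w, 1))"
  shows "integrable omega (h_metric m s t) \<longleftrightarrow>
           set_integrable lborel (ball 0 1) F0 \<and> set_integrable lborel (ball 0 1) F1" (is ?I)
    and "integrable omega (h_metric m s t) \<Longrightarrow>
      L2_product m s t = (1 / pi) *\<^sub>R ((LINT z:ball 0 1|lborel. F0 z) + (LINT w:ball 0 1|lborel. F1 w))"
proof -
  have sec: "is_section m s" "is_section m t" using s t by (auto simp: measurable_section_def)
  have [measurable]: "(\<lambda>z. s (1, z)) \<in> borel_measurable borel" "(\<lambda>z. t (1, z)) \<in> borel_measurable borel"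
    "(\<lambda>z. s (z, 1)) \<in> borel_measurable borel" "(\<lambda>z. t (z, 1)) \<in> borel_measurable borel"
    using s t by (auto simp: measurable_section_def)
  have [measurable]: "F0 \<in> borel_measurable borel" "F1 \<in> borel_measurable borel"
    unfolding F0_def F1_def by measurable
  define H where "H = (\<lambda>z. (h_T z / pi) *\<^sub>R h_metric m s t (pt 1 z))"
  have [measurable]: "H \<in> borel_measurable borel"
    unfolding H_def using h_metric_affine_measurable[OF s t] by measurable
  let ?D = "ball 0 1 :: complex set" and ?E = "- cball 0 1 :: complex set"
  have H0: "H z = (1 / pi) *\<^sub>R F0 z" if "z \<in> ?D" for z
    using that sec by (simp add: H_def h_metric_affine h_T_def F0_def max_absorb1)
  have H1: "H z = (1 / pi) *\<^sub>R ((1 / cmod z ^ 4) *\<^sub>R F1 (inverse z))" if "z \<in> ?E" for z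
  proof -
    have z: "cmod z > 1" "z \<noteq> 0" using that by auto
    have st: "s (1, z) = z ^ m * s (inverse z, 1)" "t (1, z) = z ^ m * t (inverse z, 1)"
      using section_eq_chart1[OF sec(1) z(2), of 1] section_eq_chart1[OF sec(2) z(2), of 1]
      by (simp_all add: inverse_eq_divide)
    have "z ^ m * cnj z ^ m = (complex_of_real ((cmod z)\<^sup>2)) ^ m"
      by (simp only: complex_norm_square power_mult_distrib)
    then have zz: "z ^ m * cnj z ^ m = complex_of_real (cmod z ^ (2 * m))"
      by (simp add: power_mult)
    have "s (1, z) * cnj (t (1, z)) = (z ^ m * cnj z ^ m) * F1 (inverse z)"
      unfolding st F1_def by (simp add: mult_ac)
    then have "s (1, z) * cnj (t (1, z)) = complex_of_real (cmod z ^ (2 * m)) * F1 (inverse z)"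
      unfolding zz .
    then show ?thesis
      using z sec by (simp add: H_def h_metric_affine h_T_def max_absorb2 mult_ac)
  qed
  have AE: "AE z in lborel. H z = indicator (?D \<union> ?E) z *\<^sub>R H z"
    using AE_lborel_negligible[OF negligible_sphere[of "0::complex" 1]]
    by (rule AE_mp) (auto simp: indicator_def intro!: AE_I2)
  have intH: "integrable lborel H \<longleftrightarrow> set_integrable lborel (?D \<union> ?E) H"
    unfolding set_integrable_def by (rule integrable_cong_AE[OF _ _ AE]; measurable)
  also have "\<dots> \<longleftrightarrow> set_integrable lborel ?D H \<and> set_integrable lborel ?E H"
    by (auto intro: set_integrable_Un set_integrable_subset)
  also have "set_integrable lborel ?D H \<longleftrightarrow> set_integrable lborel ?D (\<lambda>z. (1 / pi) *\<^sub>R F0 z)"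
    by (intro set_integrable_cong refl H0)
  also have "set_integrable lborel ?D (\<lambda>z. (1 / pi) *\<^sub>R F0 z) \<longleftrightarrow> set_integrable lborel ?D F0"
    by (rule set_integrable_scale_iff) simp
  also have "set_integrable lborel ?E H \<longleftrightarrow> set_integrable lborel ?E (\<lambda>z. (1 / pi) *\<^sub>R ((1 / cmod z ^ 4) *\<^sub>R F1 (inverse z)))"
    by (intro set_integrable_cong refl H1)
  also have "\<dots> \<longleftrightarrow> set_integrable lborel ?E (\<lambda>z. (1 / cmod z ^ 4) *\<^sub>R F1 (inverse z))"
    by (rule set_integrable_scale_iff) simp
  also have "\<dots> \<longleftrightarrow> set_integrable lborel ?D F1"
    by (rule inversion_integral) simp
  finally have I: "integrable lborel H \<longleftrightarrow> set_integrable lborel ?D F0 \<and> set_integrable lborel ?D F1" .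
  note om = omega_integrable_iff[OF h_metric_affine_measurable[OF s t], folded H_def]
  show ?I using I om by simp
  assume "integrable omega (h_metric m s t)"
  then have intH': "integrable lborel H" and ints: "set_integrable lborel ?D F0" "set_integrable lborel ?D F1"
    using I om by auto
  have "L2_product m s t = integral\<^sup>L lborel H"
    unfolding L2_product_def omega_integral[OF h_metric_affine_measurable[OF s t]] H_def ..
  also have "\<dots> = (LINT z:?D \<union> ?E|lborel. H z)"
    unfolding set_lebesgue_integral_def by (rule integral_cong_AE[OF _ _ AE]; measurable)
  also have "\<dots> = (LINT z:?D|lborel. H z) + (LINT z:?E|lborel. H z)"
    using intH' intH by (intro set_integral_Un) (auto intro: set_integrable_subset)
  also have "(LINT z:?D|lborel. H z) = (LINT z:?D|lborel. (1 / pi) *\<^sub>R F0 z)"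
    by (rule set_lebesgue_integral_cong) (simp, use H0 in blast)
  also have "(LINT z:?E|lborel. H z) = (LINT z:?E|lborel. (1 / pi) *\<^sub>R ((1 / cmod z ^ 4) *\<^sub>R F1 (inverse z)))"
    by (rule set_lebesgue_integral_cong) (simp, use H1 in blast)
  also have "\<dots> = (1 / pi) *\<^sub>R (LINT w:?D|lborel. F1 w)"
    unfolding set_integral_scaleR_right using inversion_integral(2)[OF _ ints(2)] by simp
  finally show "L2_product m s t = (1 / pi) *\<^sub>R ((LINT z:?D|lborel. F0 z) + (LINT w:?D|lborel. F1 w))"
    by (simp add: set_integral_scaleR_right scaleR_add_right)
qed

section \<open>Square-integrable sections\<close>

lemma sets_omega [measurable_cong]: "sets omega = sets borel"
  by (simp add: omega_def)

lemma h_metric_measurable: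
  assumes "measurable_section m s" "measurable_section m t"
  shows "h_metric m s t \<in> borel_measurable omega"
  using borel_P1I[OF h_metric_affine_measurable[OF assms]]
  by (simp add: measurable_cong_sets[OF sets_omega refl])

lemma measurable_section_add: "measurable_section m s \<Longrightarrow> measurable_section m t \<Longrightarrow> measurable_section m (\<lambda>x. s x + t x)"
  and measurable_section_scale: "measurable_section m s \<Longrightarrow> measurable_section m (\<lambda>x. a * s x)"
  and measurable_section_diff: "measurable_section m s \<Longrightarrow> measurable_section m t \<Longrightarrow> measurable_section m (\<lambda>x. s x - t x)"
  unfolding measurable_section_def
  by (auto intro!: is_section_add is_section_scale is_section_diff)

lemma L2_sections_iff:
  "s \<in> L2_sections m \<longleftrightarrow> measurable_section m s \<and> integrable omega (h_metric m s s)"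
  by (auto simp: L2_sections_def measurable_section_def)

definition h_weight :: "nat \<Rightarrow> P1 \<Rightarrow> real" where
  "h_weight m p = max (cmod (fst (hcoords p))) (cmod (snd (hcoords p))) ^ (2 * m)"

lemma h_weight_nonneg: "0 \<le> h_weight m p"
  by (simp add: h_weight_def le_max_iff_disj)

lemma h_metric_eq: "h_metric m s t p = s (hcoords p) * cnj (t (hcoords p)) / of_real (h_weight m p)"
  by (simp add: h_metric_def h_weight_def Let_def)

lemma h_metric_self: "h_metric m s s p = of_real ((cmod (s (hcoords p)))\<^sup>2 / h_weight m p)"
  unfolding h_metric_eq complex_norm_square[symmetric] by simp

lemma norm_h_metric_self: "cmod (h_metric m s s p) = (cmod (s (hcoords p)))\<^sup>2 / h_weight m p"
  unfolding h_metric_self norm_of_real using h_weight_nonneg[of m p] by simp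

lemma norm_h_metric_le: "cmod (h_metric m s t p) \<le> cmod (h_metric m s s p + h_metric m t t p)"
proof -
  let ?a = "cmod (s (hcoords p))" and ?b = "cmod (t (hcoords p))"
  have "0 \<le> (?a - ?b)\<^sup>2" by simp
  then have "?a * ?b * 2 \<le> ?a\<^sup>2 + ?b\<^sup>2" by (simp add: power2_diff)
  moreover have "0 \<le> ?a * ?b" by simp
  ultimately have "?a * ?b \<le> ?a\<^sup>2 + ?b\<^sup>2" by linarith
  then have "?a * ?b / h_weight m p \<le> (?a\<^sup>2 + ?b\<^sup>2) / h_weight m p"
    using h_weight_nonneg by (rule divide_right_mono)
  moreover have "cmod (h_metric m s t p) = ?a * ?b / h_weight m p"
    using h_weight_nonneg[of m p] by (simp add: h_metric_eq norm_divide norm_mult)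
  moreover have "h_metric m s s p + h_metric m t t p = of_real ((?a\<^sup>2 + ?b\<^sup>2) / h_weight m p)"
    by (simp add: h_metric_self add_divide_distrib)
  then have "cmod (h_metric m s s p + h_metric m t t p) = (?a\<^sup>2 + ?b\<^sup>2) / h_weight m p"
    using h_weight_nonneg[of m p] by (simp only: norm_of_real) simp
  ultimately show ?thesis by simp
qed

lemma norm_h_metric_add_le:
  "cmod (h_metric m (\<lambda>x. s x + t x) (\<lambda>x. s x + t x) p) \<le> 2 * cmod (h_metric m s s p) + 2 * cmod (h_metric m t t p)"
proof -
  let ?a = "cmod (s (hcoords p))" and ?b = "cmod (t (hcoords p))"
  have "(cmod (s (hcoords p) + t (hcoords p)))\<^sup>2 \<le> (?a + ?b)\<^sup>2"
    by (intro power_mono norm_triangle_ineq) simp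
  also have "\<dots> \<le> 2 * ?a\<^sup>2 + 2 * ?b\<^sup>2"
    using sum_squares_bound[of ?a ?b] by (simp add: power2_sum)
  finally have "(cmod (s (hcoords p) + t (hcoords p)))\<^sup>2 / h_weight m p \<le> (2 * ?a\<^sup>2 + 2 * ?b\<^sup>2) / h_weight m p"
    using h_weight_nonneg by (rule divide_right_mono)
  then show ?thesis by (simp add: norm_h_metric_self add_divide_distrib)
qed

lemma integrable_h_metric:
  assumes "s \<in> L2_sections m" "t \<in> L2_sections m"
  shows "integrable omega (h_metric m s t)"
proof (rule Bochner_Integration.integrable_bound)
  show "integrable omega (\<lambda>p. h_metric m s s p + h_metric m t t p)"
    using assms by (simp add: L2_sections_iff)
  show "h_metric m s t \<in> borel_measurable omega"
    using assms by (simp add: L2_sections_iff h_metric_measurable)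
qed (simp add: norm_h_metric_le)

definition norm_sq :: "nat \<Rightarrow> hom_fun \<Rightarrow> real" where
  "norm_sq m s = (LINT p|omega. cmod (h_metric m s s p))"

lemma L2_product_self: "L2_product m s s = of_real (norm_sq m s)"
proof -
  have "h_metric m s s = (\<lambda>p. of_real (cmod (h_metric m s s p)))"
    by (rule ext) (simp only: norm_h_metric_self, simp only: h_metric_self)
  then have "L2_product m s s = (LINT p|omega. complex_of_real (cmod (h_metric m s s p)))"
    unfolding L2_product_def by (rule arg_cong)
  then show ?thesis by (simp add: norm_sq_def)
qed

lemma norm_sq_nonneg: "0 \<le> norm_sq m s"
  unfolding norm_sq_def by simp

lemma L2_add:
  assumes s: "s \<in> L2_sections m" and t: "t \<in> L2_sections m"
  shows "(\<lambda>x. s x + t x) \<in> L2_sections m"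
    and "norm_sq m (\<lambda>x. s x + t x) \<le> 2 * norm_sq m s + 2 * norm_sq m t"
proof -
  let ?st = "\<lambda>x. s x + t x"
  have int: "integrable omega (\<lambda>p. cmod (h_metric m s s p))" "integrable omega (\<lambda>p. cmod (h_metric m t t p))"
    using s t by (auto simp: L2_sections_iff)
  have ms: "measurable_section m ?st"
    using s t by (simp add: L2_sections_iff measurable_section_add)
  have int': "integrable omega (\<lambda>p. 2 * cmod (h_metric m s s p) + 2 * cmod (h_metric m t t p))"
    using int by simp
  have "integrable omega (h_metric m ?st ?st)"
    by (rule Bochner_Integration.integrable_bound[OF int' h_metric_measurable[OF ms ms]])
      (use norm_h_metric_add_le in \<open>auto intro!: AE_I2 order_trans[OF norm_h_metric_add_le]\<close>)
  then show "?st \<in> L2_sections m" using ms by (simp add: L2_sections_iff)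
  from \<open>integrable omega (h_metric m ?st ?st)\<close>
  have "norm_sq m ?st \<le> (LINT p|omega. 2 * cmod (h_metric m s s p) + 2 * cmod (h_metric m t t p))"
    unfolding norm_sq_def using norm_h_metric_add_le by (intro integral_mono int') auto
  also have "\<dots> = 2 * norm_sq m s + 2 * norm_sq m t"
    using int by (simp add: norm_sq_def)
  finally show "norm_sq m ?st \<le> 2 * norm_sq m s + 2 * norm_sq m t" .
qed

lemma L2_scale:
  assumes s: "s \<in> L2_sections m"
  shows "(\<lambda>x. c * s x) \<in> L2_sections m" and "norm_sq m (\<lambda>x. c * s x) = (cmod c)\<^sup>2 * norm_sq m s"
proof -
  have eq: "h_metric m (\<lambda>x. c * s x) (\<lambda>x. c * s x) = (\<lambda>p. of_real ((cmod c)\<^sup>2) * h_metric m s s p)"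
    by (rule ext) (simp add: h_metric_self norm_mult power_mult_distrib)
  show "(\<lambda>x. c * s x) \<in> L2_sections m"
    using s unfolding L2_sections_iff eq by (auto intro: measurable_section_scale)
  show "norm_sq m (\<lambda>x. c * s x) = (cmod c)\<^sup>2 * norm_sq m s"
    unfolding norm_sq_def eq by (simp add: norm_mult norm_power)
qed

lemma L2_diff:
  assumes "s \<in> L2_sections m" "t \<in> L2_sections m"
  shows "(\<lambda>x. s x - t x) \<in> L2_sections m"
  using L2_add(1)[OF assms(1) L2_scale(1)[OF assms(2), of "-1"]] by simp

lemma smooth_sections_iff:
  "s \<in> smooth_sections m \<longleftrightarrow> is_section m s \<and> smooth_on UNIV (\<lambda>z. s (1, z)) \<and> smooth_on UNIV (\<lambda>w. s (w, 1))"
  by (simp add: smooth_sections_def C_infinity_iff)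

lemma smooth_sections_add:
  "s \<in> smooth_sections m \<Longrightarrow> t \<in> smooth_sections m \<Longrightarrow> (\<lambda>x. s x + t x) \<in> smooth_sections m"
  using smooth_on_add[of UNIV "\<lambda>z. s (1, z)" "\<lambda>z. t (1, z)"] smooth_on_add[of UNIV "\<lambda>z. s (z, 1)" "\<lambda>z. t (z, 1)"]
  by (simp add: smooth_sections_iff is_section_add)

lemma smooth_sections_scale: "s \<in> smooth_sections m \<Longrightarrow> (\<lambda>x. c * s x) \<in> smooth_sections m"
  using smooth_on_mult[of UNIV "\<lambda>_. c" "\<lambda>z. s (1, z)"] smooth_on_mult[of UNIV "\<lambda>_. c" "\<lambda>z. s (z, 1)"]
    smooth_on_const[of UNIV c]
  by (simp add: smooth_sections_iff is_section_scale)

lemma smooth_sections_zero: "(\<lambda>x. 0) \<in> smooth_sections m"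
  using smooth_on_const[of UNIV 0] by (simp add: smooth_sections_iff is_section_zero)

lemma set_integrable_unit_ball:
  assumes "continuous_on UNIV f" shows "set_integrable lborel (ball (0::complex) 1) (f :: complex \<Rightarrow> complex)"
proof -
  have "set_integrable lborel (cball 0 1) f"
    unfolding set_integrable_def
    by (rule borel_integrable_compact[OF compact_cball continuous_on_subset[OF assms]]) simp
  then show ?thesis by (rule set_integrable_subset) auto
qed

lemma L2_sectionsI:
  assumes s: "measurable_section m s"
    and "continuous_on UNIV u" "\<And>z. cmod z < 1 \<Longrightarrow> s (1, z) = u z"
    and "continuous_on UNIV v" "\<And>w. cmod w < 1 \<Longrightarrow> s (w, 1) = v w"
  shows "s \<in> L2_sections m"
proof -
  have "set_integrable lborel (ball 0 1) (\<lambda>z. u z * cnj (u z))" "set_integrable lborel (ball 0 1) (\<lambda>z. v z * cnj (v z))"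
    using assms by (auto intro!: set_integrable_unit_ball continuous_intros)
  moreover have "set_integrable lborel (ball 0 1) (\<lambda>z. s (1, z) * cnj (s (1, z))) \<longleftrightarrow> set_integrable lborel (ball 0 1) (\<lambda>z. u z * cnj (u z))"
    by (rule set_integrable_cong) (simp_all add: assms(3))
  moreover have "set_integrable lborel (ball 0 1) (\<lambda>z. s (z, 1) * cnj (s (z, 1))) \<longleftrightarrow> set_integrable lborel (ball 0 1) (\<lambda>z. v z * cnj (v z))"
    by (rule set_integrable_cong) (simp_all add: assms(5))
  ultimately show ?thesis
    using h_metric_two_discs(1)[OF s s] s by (simp add: L2_sections_iff)
qed

lemma smooth_sections_measurable:
  assumes "s \<in> smooth_sections m" shows "measurable_section m s"
proof -
  have s: "is_section m s" "smooth_on UNIV (\<lambda>z. s (1, z))" "smooth_on UNIV (\<lambda>w. s (w, 1))"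
    using assms unfolding smooth_sections_iff by blast+
  show ?thesis unfolding measurable_section_def
    using s(1) borel_measurable_continuous_onI[OF smooth_on_continuous[OF s(2)]]
      borel_measurable_continuous_onI[OF smooth_on_continuous[OF s(3)]] by simp
qed

lemma smooth_sections_L2:
  assumes "s \<in> smooth_sections m" shows "s \<in> L2_sections m"
proof -
  have "smooth_on UNIV (\<lambda>z. s (1, z))" "smooth_on UNIV (\<lambda>w. s (w, 1))"
    using assms unfolding smooth_sections_iff by blast+
  note cont = this[THEN smooth_on_continuous]
  show ?thesis
    by (rule L2_sectionsI[OF smooth_sections_measurable[OF assms] cont(1) refl cont(2) refl])
qed

lemma L2_closure_iff:
  "s \<in> L2_closure m \<longleftrightarrow> s \<in> L2_sections m \<and> (\<forall>e>0. \<exists>t\<in>smooth_sections m. norm_sq m (\<lambda>x. s x - t x) < e)"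
proof -
  have *: "sqrt (norm_sq m f) < e \<longleftrightarrow> norm_sq m f < e\<^sup>2" if "e > 0" for f and e :: real
    using real_sqrt_less_iff[of "norm_sq m f" "e\<^sup>2"] that by simp
  have "(\<forall>e>0. \<exists>t\<in>smooth_sections m. sqrt (norm_sq m (\<lambda>x. s x - t x)) < e) \<longleftrightarrow>
      (\<forall>e>0. \<exists>t\<in>smooth_sections m. norm_sq m (\<lambda>x. s x - t x) < e)"
  proof (intro iffI allI impI)
    fix e :: real assume "\<forall>e>0. \<exists>t\<in>smooth_sections m. sqrt (norm_sq m (\<lambda>x. s x - t x)) < e" "e > 0"
    then obtain t where "t \<in> smooth_sections m" "sqrt (norm_sq m (\<lambda>x. s x - t x)) < sqrt e"
      by (meson real_sqrt_gt_zero)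
    then show "\<exists>t\<in>smooth_sections m. norm_sq m (\<lambda>x. s x - t x) < e" by auto
  next
    fix e :: real assume "\<forall>e>0. \<exists>t\<in>smooth_sections m. norm_sq m (\<lambda>x. s x - t x) < e" "e > 0"
    then show "\<exists>t\<in>smooth_sections m. sqrt (norm_sq m (\<lambda>x. s x - t x)) < e"
      using * by (meson zero_less_power)
  qed
  then show ?thesis by (simp add: L2_closure_def L2_product_self)
qed

lemma smooth_sections_closure: "smooth_sections m \<subseteq> L2_closure m"
proof
  fix s assume s: "s \<in> smooth_sections m"
  have "norm_sq m (\<lambda>x. s x - s x) = 0" by (simp add: norm_sq_def h_metric_eq)
  then show "s \<in> L2_closure m"
    using s smooth_sections_L2[OF s] unfolding L2_closure_iff by (auto intro!: bexI[of _ s])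
qed

text \<open>
  The bound $\|s+t\|^2 \le 2\|s\|^2 + 2\|t\|^2$ holds pointwise before integration and can take the
  place of the triangle inequality.
\<close>

lemma L2_closure_add:
  assumes "s \<in> L2_closure m" "t \<in> L2_closure m"
  shows "(\<lambda>x. s x + t x) \<in> L2_closure m"
  unfolding L2_closure_iff
proof (intro conjI allI impI)
  have L2: "s \<in> L2_sections m" "t \<in> L2_sections m" using assms by (auto simp: L2_closure_iff)
  then show "(\<lambda>x. s x + t x) \<in> L2_sections m" by (rule L2_add)
  fix e :: real assume "e > 0"
  then have "e / 4 > 0" by simp
  then obtain s' t' where s': "s' \<in> smooth_sections m" "norm_sq m (\<lambda>x. s x - s' x) < e / 4"
    and t': "t' \<in> smooth_sections m" "norm_sq m (\<lambda>x. t x - t' x) < e / 4"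
    using assms unfolding L2_closure_iff by meson
  have "norm_sq m (\<lambda>x. (s x - s' x) + (t x - t' x)) \<le> 2 * norm_sq m (\<lambda>x. s x - s' x) + 2 * norm_sq m (\<lambda>x. t x - t' x)"
    by (intro L2_add L2_diff L2 smooth_sections_L2 s' t')
  also have "\<dots> < e" using s' t' by simp
  also have "(\<lambda>x. (s x - s' x) + (t x - t' x)) = (\<lambda>x. s x + t x - (s' x + t' x))" by (simp add: fun_eq_iff)
  finally show "\<exists>u\<in>smooth_sections m. norm_sq m (\<lambda>x. s x + t x - u x) < e"
    using smooth_sections_add[OF s'(1) t'(1)] by (intro bexI[of _ "\<lambda>x. s' x + t' x"])
qed

lemma L2_closure_scale:
  assumes "s \<in> L2_closure m"
  shows "(\<lambda>x. c * s x) \<in> L2_closure m"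
  unfolding L2_closure_iff
proof (intro conjI allI impI)
  have L2: "s \<in> L2_sections m" using assms by (auto simp: L2_closure_iff)
  then show "(\<lambda>x. c * s x) \<in> L2_sections m" by (rule L2_scale)
  fix e :: real assume e: "e > 0"
  have pos: "(cmod c)\<^sup>2 + 1 > 0" by (simp add: add_nonneg_pos)
  with e have "e / ((cmod c)\<^sup>2 + 1) > 0" by simp
  then obtain s' where s': "s' \<in> smooth_sections m" "norm_sq m (\<lambda>x. s x - s' x) < e / ((cmod c)\<^sup>2 + 1)"
    using assms unfolding L2_closure_iff by meson
  have "norm_sq m (\<lambda>x. c * (s x - s' x)) = (cmod c)\<^sup>2 * norm_sq m (\<lambda>x. s x - s' x)"
    by (intro L2_scale L2_diff L2 smooth_sections_L2 s')
  also have "\<dots> \<le> ((cmod c)\<^sup>2 + 1) * norm_sq m (\<lambda>x. s x - s' x)"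
    using norm_sq_nonneg by (intro mult_right_mono) auto
  also have "\<dots> < e" using s'(2) pos by (simp add: field_simps)
  finally have "norm_sq m (\<lambda>x. c * s x - c * s' x) < e" by (simp add: right_diff_distrib)
  then show "\<exists>u\<in>smooth_sections m. norm_sq m (\<lambda>x. c * s x - u x) < e"
    using smooth_sections_scale[OF s'(1)] by (intro bexI[of _ "\<lambda>x. c * s' x"])
qed

lemma L2_closure_zero: "(\<lambda>x. 0) \<in> L2_closure m"
  using smooth_sections_zero smooth_sections_closure by blast

section \<open>The Hilbert space of classes\<close>

lemma equiv_ae_equal: "equiv (L2_closure m) (ae_equal m)"
proof (rule equivI)
  show "ae_equal m \<subseteq> L2_closure m \<times> L2_closure m" by (auto simp: ae_equal_def)
  show "refl_on (L2_closure m) (ae_equal m)" by (auto simp: refl_on_def ae_equal_def)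
  show "sym (ae_equal m)" by (auto simp: sym_def ae_equal_def eq_commute)
  show "trans (ae_equal m)"
    unfolding trans_def ae_equal_def by (auto elim: eventually_elim2)
qed

lemma H_class_eq_iff:
  "s \<in> L2_closure m \<Longrightarrow> t \<in> L2_closure m \<Longrightarrow> H_class m s = H_class m t \<longleftrightarrow> (s, t) \<in> ae_equal m"
  unfolding H_class_def by (rule eq_equiv_class_iff[OF equiv_ae_equal])

lemma H_class_in_Hilbert: "s \<in> L2_closure m \<Longrightarrow> H_class m s \<in> Hilbert m"
  unfolding H_class_def Hilbert_def by (rule quotientI)

lemma H_rep_class:
  assumes "s \<in> L2_closure m" shows "(s, H_rep (H_class m s)) \<in> ae_equal m"
proof -
  have "s \<in> H_class m s"
    unfolding H_class_def by (rule equiv_class_self[OF equiv_ae_equal assms])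
  then have "H_rep (H_class m s) \<in> H_class m s" unfolding H_rep_def by (rule someI[of "\<lambda>t. t \<in> H_class m s"])
  then show ?thesis by (simp add: H_class_def)
qed

lemma ae_equalD:
  assumes "(s, t) \<in> ae_equal m"
  shows "s \<in> L2_closure m" "t \<in> L2_closure m" "AE p in omega. s (hcoords p) = t (hcoords p)"
  using assms by (auto simp: ae_equal_def)

text \<open>
  The operations on classes are defined through chosen representatives; a different choice changes the
  result only on a null set.
\<close>

lemma H_add_class:
  assumes "s \<in> L2_closure m" "t \<in> L2_closure m"
  shows "H_add m (H_class m s) (H_class m t) = H_class m (\<lambda>x. s x + t x)"
proof -
  note s = ae_equalD[OF H_rep_class[OF assms(1)]] and t = ae_equalD[OF H_rep_class[OF assms(2)]]
  have "AE p in omega. s (hcoords p) + t (hcoords p) =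
      H_rep (H_class m s) (hcoords p) + H_rep (H_class m t) (hcoords p)"
    using s(3) t(3) by eventually_elim simp
  then have *: "((\<lambda>x. s x + t x), (\<lambda>x. H_rep (H_class m s) x + H_rep (H_class m t) x)) \<in> ae_equal m"
    using s t by (auto simp: ae_equal_def intro!: L2_closure_add)
  then show ?thesis unfolding H_add_def
    using H_class_eq_iff[OF ae_equalD(1,2)[OF *]] * by simp
qed

lemma H_scale_class:
  assumes "s \<in> L2_closure m"
  shows "H_scale m c (H_class m s) = H_class m (\<lambda>x. c * s x)"
proof -
  note s = ae_equalD[OF H_rep_class[OF assms(1)]]
  have "AE p in omega. c * s (hcoords p) = c * H_rep (H_class m s) (hcoords p)"
    using s(3) by eventually_elim simp
  then have *: "((\<lambda>x. c * s x), (\<lambda>x. c * H_rep (H_class m s) x)) \<in> ae_equal m"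
    using s by (auto simp: ae_equal_def intro!: L2_closure_scale)
  then show ?thesis unfolding H_scale_def
    using H_class_eq_iff[OF ae_equalD(1,2)[OF *]] * by simp
qed

lemma H_product_class:
  assumes "s \<in> L2_closure m" "t \<in> L2_closure m"
  shows "H_product m (H_class m s) (H_class m t) = L2_product m s t"
proof -
  note s = ae_equalD[OF H_rep_class[OF assms(1)]] and t = ae_equalD[OF H_rep_class[OF assms(2)]]
  have "AE p in omega. h_metric m (H_rep (H_class m s)) (H_rep (H_class m t)) p = h_metric m s t p"
    using s(3) t(3) by eventually_elim (simp add: h_metric_eq)
  then show ?thesis unfolding H_product_def L2_product_def
    by (rule integral_cong_AE[rotated 2])
      (use s t in \<open>auto simp: L2_closure_iff L2_sections_iff intro!: h_metric_measurable\<close>)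
qed

section \<open>The Laplacian of a section in the two charts\<close>

definition flat_laplacian :: "(complex \<Rightarrow> complex) \<Rightarrow> complex \<Rightarrow> complex" where
  "flat_laplacian g z = - d_dz (d_dzbar g) z"

text \<open>
  The intrinsic form of the canonical Laplacian: minus $\partial_z \partial_{\bar z}$ of the chart expression
  on each of the two open unit discs. The value 0 on the circle matches the convention of
  \<open>laplacian_tensor\<close>, so that the two can only differ at the points \<open>[1 : 0]\<close> and \<open>[0 : 1]\<close>.
\<close>

definition lap :: "nat \<Rightarrow> hom_fun \<Rightarrow> hom_fun" where
  "lap m s = (\<lambda>(x0, x1).
     if cmod x1 < cmod x0 then x0 ^ m * flat_laplacian (\<lambda>z. s (1, z)) (x1 / x0)
     else if cmod x0 < cmod x1 then x1 ^ m * flat_laplacian (\<lambda>w. s (w, 1)) (x0 / x1)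
     else 0)"

lemma smooth_on_flat_laplacian:
  assumes "smooth_on UNIV g" shows "smooth_on UNIV (flat_laplacian g)"
proof -
  have "smooth_on UNIV (\<lambda>z. (-1) * d_dz (d_dzbar g) z)"
    by (intro smooth_on_mult smooth_on_const smooth_on_d_dz smooth_on_d_dzbar assms open_UNIV)
  then show ?thesis by (rule smooth_on_cong[OF open_UNIV]) (simp add: flat_laplacian_def)
qed

lemma wirtinger_add:
  assumes "smooth_on UNIV f" "smooth_on UNIV g"
  shows "d_dz (\<lambda>z. f z + g z) = (\<lambda>z. d_dz f z + d_dz g z)"
    and "d_dzbar (\<lambda>z. f z + g z) = (\<lambda>z. d_dzbar f z + d_dzbar g z)"
proof -
  have "((\<lambda>z. f z + g z) has_derivative (\<lambda>v. (d_dz f z + d_dz g z) * v + (d_dzbar f z + d_dzbar g z) * cnj v)) (at z)" for z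
    by (rule has_derivative_eq_rhs[OF has_derivative_add[OF smooth_on_wirtinger[OF assms(1)] smooth_on_wirtinger[OF assms(2)]]])
      (auto simp: algebra_simps)
  from wirtinger_eqI[OF this]
  show "d_dz (\<lambda>z. f z + g z) = (\<lambda>z. d_dz f z + d_dz g z)"
    "d_dzbar (\<lambda>z. f z + g z) = (\<lambda>z. d_dzbar f z + d_dzbar g z)" by auto
qed

lemma wirtinger_scale:
  assumes "smooth_on UNIV f"
  shows "d_dz (\<lambda>z. c * f z) = (\<lambda>z. c * d_dz f z)"
    and "d_dzbar (\<lambda>z. c * f z) = (\<lambda>z. c * d_dzbar f z)"
proof -
  have "((\<lambda>z. c * f z) has_derivative (\<lambda>v. (c * d_dz f z) * v + (c * d_dzbar f z) * cnj v)) (at z)" for z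
    by (rule has_derivative_eq_rhs[OF has_derivative_mult_right[OF smooth_on_wirtinger[OF assms(1)]]])
      (auto simp: algebra_simps)
  from wirtinger_eqI[OF this]
  show "d_dz (\<lambda>z. c * f z) = (\<lambda>z. c * d_dz f z)" "d_dzbar (\<lambda>z. c * f z) = (\<lambda>z. c * d_dzbar f z)" by auto
qed

lemma flat_laplacian_add:
  assumes "smooth_on UNIV f" "smooth_on UNIV g"
  shows "flat_laplacian (\<lambda>z. f z + g z) z = flat_laplacian f z + flat_laplacian g z"
  unfolding flat_laplacian_def wirtinger_add(2)[OF assms]
    wirtinger_add(1)[OF smooth_on_d_dzbar[OF open_UNIV assms(1)] smooth_on_d_dzbar[OF open_UNIV assms(2)]]
  by simp

lemma flat_laplacian_scale:
  assumes "smooth_on UNIV f"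
  shows "flat_laplacian (\<lambda>z. c * f z) z = c * flat_laplacian f z"
  unfolding flat_laplacian_def wirtinger_scale(2)[OF assms]
    wirtinger_scale(1)[OF smooth_on_d_dzbar[OF open_UNIV assms(1)]]
  by simp

lemma lap_add:
  assumes "s \<in> smooth_sections m" "t \<in> smooth_sections m"
  shows "lap m (\<lambda>x. s x + t x) = (\<lambda>x. lap m s x + lap m t x)"
proof -
  have s: "smooth_on UNIV (\<lambda>z. s (1, z))" "smooth_on UNIV (\<lambda>w. s (w, 1))"
    "smooth_on UNIV (\<lambda>z. t (1, z))" "smooth_on UNIV (\<lambda>w. t (w, 1))"
    using assms unfolding smooth_sections_iff by blast+
  show ?thesis
    unfolding lap_def flat_laplacian_add[OF s(1,3)] flat_laplacian_add[OF s(2,4)]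
    by (auto simp: algebra_simps)
qed

lemma lap_scale:
  assumes "s \<in> smooth_sections m"
  shows "lap m (\<lambda>x. c * s x) = (\<lambda>x. c * lap m s x)"
proof -
  have s: "smooth_on UNIV (\<lambda>z. s (1, z))" "smooth_on UNIV (\<lambda>w. s (w, 1))"
    using assms unfolding smooth_sections_iff by blast+
  show ?thesis
    unfolding lap_def flat_laplacian_scale[OF s(1)] flat_laplacian_scale[OF s(2)]
    by (auto simp: algebra_simps)
qed

lemma is_section_lap: "is_section m (lap m s)"
  unfolding is_section_def
proof (intro conjI allI impI)
  show "lap m s 0 = 0" by (simp add: lap_def zero_prod_def)
  fix c x0 x1 :: complex assume "c \<noteq> 0"
  then show "lap m s (c * x0, c * x1) = c ^ m * lap m s (x0, x1)"
    by (simp add: lap_def norm_mult power_mult_distrib)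
qed

lemma lap_chart0: "lap m s (1, z) =
    (if cmod z < 1 then flat_laplacian (\<lambda>z. s (1, z)) z
     else if 1 < cmod z then z ^ m * flat_laplacian (\<lambda>w. s (w, 1)) (1 / z) else 0)"
  and lap_chart1: "lap m s (w, 1) =
    (if cmod w < 1 then flat_laplacian (\<lambda>w. s (w, 1)) w
     else if 1 < cmod w then w ^ m * flat_laplacian (\<lambda>z. s (1, z)) (1 / w) else 0)"
  by (auto simp: lap_def)

context
  fixes m :: nat and s :: hom_fun
  assumes s: "s \<in> smooth_sections m"
begin

lemma smooth_charts: "smooth_on UNIV (\<lambda>z. s (1, z))" "smooth_on UNIV (\<lambda>w. s (w, 1))"
  using s unfolding smooth_sections_iff by blast+

lemmas smooth_lap_charts = smooth_charts[THEN smooth_on_flat_laplacian]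

lemma measurable_section_lap: "measurable_section m (lap m s)"
proof -
  note [measurable] = smooth_lap_charts[THEN smooth_on_continuous, THEN borel_measurable_continuous_onI]
  show ?thesis
    unfolding measurable_section_def lap_chart0 lap_chart1 by (auto simp: is_section_lap)
qed

lemma lap_L2: "lap m s \<in> L2_sections m"
  by (rule L2_sectionsI[OF measurable_section_lap smooth_lap_charts(1)[THEN smooth_on_continuous] _
        smooth_lap_charts(2)[THEN smooth_on_continuous]])
    (simp_all add: lap_chart0 lap_chart1)

end

section \<open>The Laplacian lies in the closure of the smooth sections\<close>

text \<open>
  A smooth function on the plane that vanishes to infinite order on the unit circle and tends to 1 on
  the open unit disc as $n$ grows.
\<close>

definition cutoff :: "nat \<Rightarrow> complex \<Rightarrow> complex" where
  "cutoff n z = of_real (flat_exp 0 (real n * (1 - (cmod z)\<^sup>2)))"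

lemma smooth_on_cutoff: "smooth_on UNIV (cutoff n)"
proof -
  have "smooth_on UNIV (\<lambda>z. of_nat n * (1 - z * cnj z))"
    by (intro smooth_on_mult smooth_on_diff smooth_on_const smooth_on_cnj smooth_on_id open_UNIV)
  then have "smooth_on UNIV (\<lambda>z. complex_of_real (real n * (1 - (cmod z)\<^sup>2)))"
    by (rule smooth_on_cong[OF open_UNIV]) (simp add: complex_norm_square[symmetric] del: of_real_power)
  then show ?thesis
    unfolding smooth_on_def cutoff_def by (intro allI C_on_flat_exp open_UNIV) blast
qed

lemma cutoff_eq_0: "1 \<le> cmod z \<Longrightarrow> cutoff n z = 0"
proof -
  assume "1 \<le> cmod z"
  then have "1 \<le> (cmod z)\<^sup>2" by simp
  then have "real n * (1 - (cmod z)\<^sup>2) \<le> 0" by (simp add: mult_nonneg_nonpos)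
  then show ?thesis by (simp add: cutoff_def flat_exp_def)
qed

lemma norm_cutoff_le: "cmod (1 - cutoff n z) \<le> 1"
proof -
  have "0 \<le> flat_exp 0 x" "flat_exp 0 x \<le> 1" for x
    by (simp_all add: flat_exp_def)
  then have "\<bar>1 - flat_exp 0 x\<bar> \<le> 1" for x by (simp add: abs_le_iff)
  moreover have "1 - cutoff n z = of_real (1 - flat_exp 0 (real n * (1 - (cmod z)\<^sup>2)))"
    by (simp add: cutoff_def)
  ultimately show ?thesis by (simp only: norm_of_real)
qed

lemma cutoff_tendsto_1:
  assumes "cmod z < 1" shows "(\<lambda>n. cutoff n z) \<longlonglongrightarrow> 1"
proof -
  define d where "d = 1 - (cmod z)\<^sup>2"
  have d: "d > 0" using assms by (simp add: d_def power_less_one_iff abs_square_less_1)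
  have "(\<lambda>n. exp (- (1 / (real n * d)))) \<longlonglongrightarrow> exp (- 0)"
  proof (intro tendsto_exp tendsto_minus)
    have "(\<lambda>n. (1 / d) * inverse (real n)) \<longlonglongrightarrow> (1 / d) * 0"
      by (intro tendsto_mult tendsto_const lim_inverse_n)
    then show "(\<lambda>n. 1 / (real n * d)) \<longlonglongrightarrow> 0" by (simp add: field_simps)
  qed
  moreover have "\<forall>\<^sub>F n in sequentially. exp (- (1 / (real n * d))) = flat_exp 0 (real n * d)"
    using eventually_gt_at_top[of 0]
    by eventually_elim (use d in \<open>auto simp: flat_exp_def not_le\<close>)
  ultimately have "(\<lambda>n. flat_exp 0 (real n * d)) \<longlonglongrightarrow> 1"
    using Lim_transform_eventually by fastforce
  then show ?thesis unfolding cutoff_def d_def by (metis of_real_1 tendsto_of_real)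
qed

text \<open>
  The section that is $\varphi$ in the affine chart, for $\varphi$ supported in the unit disc; it vanishes near
  \<open>[0 : 1]\<close>.
\<close>

definition ext_by_0 :: "nat \<Rightarrow> (complex \<Rightarrow> complex) \<Rightarrow> hom_fun" where
  "ext_by_0 m \<phi> = (\<lambda>(x0, x1). if x0 = 0 then 0 else x0 ^ m * \<phi> (x1 / x0))"

lemma ext_by_0_smooth:
  assumes \<phi>: "smooth_on UNIV \<phi>" and 0: "\<And>z. 1 \<le> cmod z \<Longrightarrow> \<phi> z = 0"
  shows "ext_by_0 m \<phi> \<in> smooth_sections m"
proof -
  have "is_section m (ext_by_0 m \<phi>)"
    unfolding is_section_def ext_by_0_def by (auto simp: power_mult_distrib zero_prod_def)
  moreover have "smooth_on UNIV (\<lambda>z. ext_by_0 m \<phi> (1, z))"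
    using \<phi> by (simp add: ext_by_0_def)
  moreover have "smooth_on UNIV (\<lambda>w. ext_by_0 m \<phi> (w, 1))"
  proof -
    have op: "open (- {0 :: complex})" by (intro open_Compl closed_singleton)
    have "smooth_on (-{0}) (\<lambda>w. w ^ m * \<phi> (inverse w))"
      by (intro smooth_on_mult op smooth_on_power smooth_on_id smooth_on_compose[OF op open_UNIV subset_UNIV \<phi>] smooth_on_inverse) simp
    then have "smooth_on (-{0}) (\<lambda>w. ext_by_0 m \<phi> (w, 1))"
      by (rule smooth_on_cong[OF op]) (simp add: ext_by_0_def inverse_eq_divide)
    moreover have "smooth_on (ball 0 1) (\<lambda>w. ext_by_0 m \<phi> (w, 1))"
      by (rule smooth_on_cong[OF open_ball smooth_on_const[OF open_ball, of _ _ 0]])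
        (auto simp: ext_by_0_def norm_divide 0)
    ultimately have "smooth_on (-{0} \<union> ball 0 1) (\<lambda>w. ext_by_0 m \<phi> (w, 1))"
      by (intro smooth_on_Un op open_ball)
    moreover have "-{0} \<union> ball 0 1 = (UNIV :: complex set)" by auto
    ultimately show ?thesis by simp
  qed
  ultimately show ?thesis by (simp add: smooth_sections_iff)
qed

lemma swap_smooth:
  assumes "s \<in> smooth_sections m" shows "(\<lambda>(x0, x1). s (x1, x0)) \<in> smooth_sections m"
proof -
  have "is_section m (\<lambda>(x0, x1). s (x1, x0))"
    using assms unfolding smooth_sections_iff is_section_def by (auto simp: zero_prod_def)
  then show ?thesis using assms by (simp add: smooth_sections_iff)
qed

lemma cutoff_integral_tendsto_0:
  assumes u: "continuous_on UNIV u"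
  shows "(\<lambda>n. LINT z:ball 0 1|lborel. (u z - cutoff n z * u z) * cnj (u z - cutoff n z * u z)) \<longlonglongrightarrow> 0"
proof -
  let ?f = "\<lambda>n z. (u z - cutoff n z * u z) * cnj (u z - cutoff n z * u z)"
  have [measurable]: "u \<in> borel_measurable borel" "\<And>n. cutoff n \<in> borel_measurable borel"
    using u smooth_on_cutoff by (auto intro: borel_measurable_continuous_onI smooth_on_continuous)
  have w: "integrable lborel (\<lambda>z. indicator (ball 0 1) z *\<^sub>R (u z * cnj (u z)))"
  proof -
    have "continuous_on UNIV (\<lambda>z. u z * cnj (u z))" by (intro continuous_intros u)
    from set_integrable_unit_ball[OF this] show ?thesis by (simp only: set_integrable_def)
  qed
  have "(\<lambda>n. LINT z|lborel. indicator (ball 0 1) z *\<^sub>R ?f n z) \<longlonglongrightarrow> (LINT z|(lborel :: complex measure). 0)"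
  proof (rule integral_dominated_convergence[where w = "\<lambda>z. cmod (indicator (ball 0 1) z *\<^sub>R (u z * cnj (u z)))"])
    show "AE z in lborel. (\<lambda>n. indicator (ball 0 1) z *\<^sub>R ?f n z) \<longlonglongrightarrow> 0"
    proof (rule AE_I2)
      fix z :: complex
      show "(\<lambda>n. indicator (ball 0 1) z *\<^sub>R ?f n z) \<longlonglongrightarrow> 0"
      proof (cases "cmod z < 1")
        case True
        have "(\<lambda>n. ?f n z) \<longlonglongrightarrow> (u z - 1 * u z) * cnj (u z - 1 * u z)"
          by (intro tendsto_intros cutoff_tendsto_1 True)
        with True show ?thesis by simp
      qed (simp add: indicator_def)
    qed
    show "AE z in lborel. cmod (indicator (ball 0 1) z *\<^sub>R ?f n z) \<le> cmod (indicator (ball 0 1) z *\<^sub>R (u z * cnj (u z)))" for n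
    proof (rule AE_I2)
      fix z :: complex
      have "cmod (u z - cutoff n z * u z) = cmod (1 - cutoff n z) * cmod (u z)"
        by (simp add: left_diff_distrib flip: norm_mult)
      also have "\<dots> \<le> 1 * cmod (u z)" by (intro mult_right_mono norm_cutoff_le) simp
      finally have "cmod (u z - cutoff n z * u z) * cmod (u z - cutoff n z * u z) \<le> cmod (u z) * cmod (u z)"
        by (intro mult_mono) auto
      then show "cmod (indicator (ball 0 1) z *\<^sub>R ?f n z) \<le> cmod (indicator (ball 0 1) z *\<^sub>R (u z * cnj (u z)))"
        by (simp add: norm_mult indicator_def del: complex_cnj_diff complex_cnj_mult)
    qed
    show "integrable lborel (\<lambda>z. cmod (indicator (ball 0 1) z *\<^sub>R (u z * cnj (u z))))"
      using w by (rule integrable_norm)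
  qed auto
  then show ?thesis by (simp add: set_lebesgue_integral_def)
qed

text \<open>
  The Laplacian jumps across the circle, so it is first cut off on each disc separately; the two pieces
  extend by zero to smooth global sections whose sum approximates it.
\<close>

lemma lap_L2_closure:
  assumes s: "s \<in> smooth_sections m" shows "lap m s \<in> L2_closure m"
  unfolding L2_closure_iff
proof (intro conjI allI impI lap_L2[OF s])
  fix e :: real assume e: "e > 0"
  define u where "u = flat_laplacian (\<lambda>z. s (1, z))"
  define v where "v = flat_laplacian (\<lambda>w. s (w, 1))"
  have uv: "smooth_on UNIV u" "smooth_on UNIV v"
    unfolding u_def v_def using smooth_lap_charts[OF s] by auto
  define t where "t = (\<lambda>n x. ext_by_0 m (\<lambda>z. cutoff n z * u z) x + (\<lambda>(x0, x1). ext_by_0 m (\<lambda>w. cutoff n w * v w) (x1, x0)) x)"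
  have t: "t n \<in> smooth_sections m" for n
    unfolding t_def
    by (intro smooth_sections_add swap_smooth ext_by_0_smooth smooth_on_mult smooth_on_cutoff uv open_UNIV)
      (simp_all add: cutoff_eq_0)
  have t0: "lap m s (1, z) - t n (1, z) = u z - cutoff n z * u z" if "cmod z < 1" for z n
    using that by (auto simp: lap_chart0 t_def ext_by_0_def u_def cutoff_eq_0 norm_divide)
  have t1: "lap m s (w, 1) - t n (w, 1) = v w - cutoff n w * v w" if "cmod w < 1" for w n
    using that by (auto simp: lap_chart1 t_def ext_by_0_def v_def cutoff_eq_0 norm_divide)
  define I where "I = (\<lambda>u n. LINT z:ball 0 1|lborel. (u z - cutoff n z * u z) * cnj (u z - cutoff n z * u z))"
  have ns: "of_real (norm_sq m (\<lambda>x. lap m s x - t n x)) = (1 / pi) *\<^sub>R (I u n + I v n)" for n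
  proof -
    let ?d = "\<lambda>x. lap m s x - t n x"
    have d: "?d \<in> L2_sections m" by (intro L2_diff lap_L2 s smooth_sections_L2 t)
    then have "L2_product m ?d ?d = (1 / pi) *\<^sub>R ((LINT z:ball 0 1|lborel. ?d (1, z) * cnj (?d (1, z))) +
        (LINT w:ball 0 1|lborel. ?d (w, 1) * cnj (?d (w, 1))))"
      by (intro h_metric_two_discs(2)) (auto simp: L2_sections_iff)
    also have "(LINT z:ball 0 1|lborel. ?d (1, z) * cnj (?d (1, z))) = I u n"
      unfolding I_def by (rule set_lebesgue_integral_cong) (simp_all add: t0)
    also have "(LINT w:ball 0 1|lborel. ?d (w, 1) * cnj (?d (w, 1))) = I v n"
      unfolding I_def by (rule set_lebesgue_integral_cong) (simp_all add: t1)
    finally show ?thesis by (simp add: L2_product_self)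
  qed
  have "(\<lambda>n. (1 / pi) *\<^sub>R (I u n + I v n)) \<longlonglongrightarrow> (1 / pi) *\<^sub>R (0 + 0)"
    unfolding I_def
    by (rule tendsto_scaleR[OF tendsto_const tendsto_add[OF uv[THEN smooth_on_continuous, THEN cutoff_integral_tendsto_0]]])
  then have "(\<lambda>n. complex_of_real (norm_sq m (\<lambda>x. lap m s x - t n x))) \<longlonglongrightarrow> of_real 0"
    by (simp add: ns)
  then have "(\<lambda>n. norm_sq m (\<lambda>x. lap m s x - t n x)) \<longlonglongrightarrow> 0"
    by (simp only: tendsto_of_real_iff)
  then have "\<forall>\<^sub>F n in sequentially. norm_sq m (\<lambda>x. lap m s x - t n x) < e"
    using e by (rule order_tendstoD)
  then obtain n where "norm_sq m (\<lambda>x. lap m s x - t n x) < e"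
    using eventually_happens' sequentially_bot by blast
  then show "\<exists>t\<in>smooth_sections m. norm_sq m (\<lambda>x. lap m s x - t x) < e"
    using t[of n] by blast
qed

section \<open>The Laplacian of $f \otimes z^k$\<close>

text \<open>
  Antiholomorphic factors are constants for $\partial_z$, holomorphic ones for $\partial_{\bar z}$. This is
  how the factors of the metric leave the defining formula.
\<close>

lemma d_dz_antiholomorphic_mult:
  assumes "(\<phi> has_field_derivative c) (at z)" "(K has_derivative K') (at z)"
  shows "d_dz (\<lambda>w. cnj (\<phi> w) * K w) z = cnj (\<phi> z) * d_dz K z"
  using wirtinger_eqI(1)[OF has_wirtinger_mult[OF has_wirtinger_cnj[OF has_wirtinger_holomorphic[OF assms(1)]]
      has_wirtinger_derivative[OF assms(2)]]] by simp

lemma d_dzbar_holomorphic_mult: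
  assumes "(\<phi> has_field_derivative c) (at z)" "(K has_derivative K') (at z)"
  shows "d_dzbar (\<lambda>w. \<phi> w * K w) z = \<phi> z * d_dzbar K z"
  using wirtinger_eqI(2)[OF has_wirtinger_mult[OF has_wirtinger_holomorphic[OF assms(1)]
      has_wirtinger_derivative[OF assms(2)]]] by simp

lemma wirtinger_inversion:
  assumes "smooth_on UNIV b" "z \<noteq> 0"
  shows "d_dz (\<lambda>w. b (inverse w)) z = d_dz b (inverse z) * (- (inverse z)\<^sup>2)"
    and "d_dzbar (\<lambda>w. b (inverse w)) z = d_dzbar b (inverse z) * cnj (- (inverse z)\<^sup>2)"
proof -
  have inv: "(inverse has_field_derivative (- (inverse z)\<^sup>2)) (at z)"
    using DERIV_inverse[OF assms(2), of UNIV] by (simp add: power2_eq_square)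
  have b: "(b has_derivative (\<lambda>v. d_dz b (inverse z) * v + d_dzbar b (inverse z) * cnj v)) (at (inverse z))"
    by (rule smooth_on_wirtinger[OF assms(1)]) simp
  note wirtinger_eqI[OF has_wirtinger_compose[OF inv b]]
  then show "d_dz (\<lambda>w. b (inverse w)) z = d_dz b (inverse z) * (- (inverse z)\<^sup>2)"
    and "d_dzbar (\<lambda>w. b (inverse w)) z = d_dzbar b (inverse z) * cnj (- (inverse z)\<^sup>2)" .
qed

lemma is_section_tensor:
  assumes "k \<le> m" shows "is_section m (tensor m f k)"
  unfolding is_section_def
proof (intro conjI allI impI)
  show "tensor m f k 0 = 0" by (simp add: tensor_def zero_prod_def)
  fix c x0 x1 :: complex assume c: "c \<noteq> 0" and x: "(x0, x1) \<noteq> 0"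
  have "c ^ m = c ^ (m - k) * c ^ k" using assms by (simp flip: power_add)
  then show "tensor m f k (c * x0, c * x1) = c ^ m * tensor m f k (x0, x1)"
    using c x pt_scale[OF c x] by (auto simp: tensor_def zero_prod_def power_mult_distrib)
qed

lemma tensor_chart0: "tensor m f k (1, z) = f (pt 1 z) * z ^ k"
  and tensor_chart1: "tensor m f k (w, 1) = f (pt w 1) * w ^ (m - k)"
  by (simp_all add: tensor_def zero_prod_def)

lemma smooth_functions_iff:
  "f \<in> smooth_functions \<longleftrightarrow> smooth_on UNIV (\<lambda>z. f (pt 1 z)) \<and> smooth_on UNIV (\<lambda>w. f (pt w 1))"
  by (simp add: smooth_functions_def C_infinity_iff)

lemma tensor_smooth:
  assumes "f \<in> smooth_functions" "k \<le> m" shows "tensor m f k \<in> smooth_sections m"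
proof -
  have f: "smooth_on UNIV (\<lambda>z. f (pt 1 z))" "smooth_on UNIV (\<lambda>w. f (pt w 1))"
    using assms(1) by (auto simp: smooth_functions_iff)
  have "smooth_on UNIV (\<lambda>z. f (pt 1 z) * z ^ k)" "smooth_on UNIV (\<lambda>w. f (pt w 1) * w ^ (m - k))"
    by (intro smooth_on_mult f smooth_on_power smooth_on_id open_UNIV)+
  then show ?thesis
    using is_section_tensor[OF assms(2)] by (simp add: smooth_sections_iff tensor_chart0 tensor_chart1)
qed

lemma h_metric_monomial:
  assumes "k \<le> m"
  shows "h_metric m (tensor m (\<lambda>_. 1) k) (tensor m (\<lambda>_. 1) k) (pt 1 w) =
    w ^ k * cnj (w ^ k) / of_real (max 1 (cmod w) ^ (2 * m))"
  unfolding h_metric_affine[OF is_section_tensor[OF assms] is_section_tensor[OF assms]]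
  by (simp add: tensor_chart0)

text \<open>
  The metric $h_m(z^k,z^k)$ is a holomorphic function times its conjugate: $z^k$ inside the disc and
  $z^{-(m-k)}$ outside. The conjugate factor cancels against $h_m^{-1}$, and the holomorphic one turns
  $\partial_{\bar z} f$ into $\partial_{\bar z}$ of the section in the chart of the disc in question. At the excluded
  point $z = 0$ the defining formula divides by zero if $k > 0$.
\<close>

lemma laplacian_tensor_affine:
  assumes f: "f \<in> smooth_functions" and k: "k \<le> m" and z: "z \<noteq> 0"
  shows "laplacian_tensor m f k (1, z) = lap m (tensor m f k) (1, z)"
proof -
  define g where "g = (\<lambda>u. f (pt 1 u))"
  define G where "G = d_dzbar g"
  define h where "h = (\<lambda>w. h_metric m (tensor m (\<lambda>_. 1) k) (tensor m (\<lambda>_. 1) k) (pt 1 w))"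
  have h: "h w = w ^ k * cnj (w ^ k) / of_real (max 1 (cmod w) ^ (2 * m))" for w
    unfolding h_def by (rule h_metric_monomial[OF k])
  have g: "smooth_on UNIV g" and f1: "smooth_on UNIV (\<lambda>w. f (pt w 1))"
    using f by (simp_all add: smooth_functions_iff g_def)
  have G: "smooth_on UNIV G" unfolding G_def by (intro smooth_on_d_dzbar open_UNIV g)
  have dg: "(g has_derivative frechet_derivative g (at w)) (at w)"
    and dG: "(G has_derivative frechet_derivative G (at w)) (at w)" for w
    by (rule smooth_on_has_derivative[OF g UNIV_I], rule smooth_on_has_derivative[OF G UNIV_I])
  have coeff: "laplacian_coeff m f k z = - inverse (of_real (h_T z)) * inverse (h z) * d_dz (\<lambda>w. h w * G w) z"
    by (simp add: laplacian_coeff_def Let_def h_def G_def g_def)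
  have dpow: "((\<lambda>w. w ^ j) has_field_derivative of_nat j * w ^ (j - 1)) (at w)" for j and w :: complex
    by (auto intro!: derivative_eq_intros)
  consider "cmod z < 1" | "cmod z = 1" | "1 < cmod z" by linarith
  then show ?thesis
  proof cases
    case 1
    have lt: "laplacian_tensor m f k (1, z) = laplacian_coeff m f k z * z ^ k"
      using 1 by (simp add: laplacian_tensor_def tensor_chart0)
    let ?K = "\<lambda>w. w ^ k * G w"
    have K: "smooth_on UNIV ?K"
      by (intro smooth_on_mult smooth_on_power smooth_on_id G open_UNIV)
    have "d_dz (\<lambda>w. h w * G w) z = d_dz (\<lambda>w. cnj (w ^ k) * ?K w) z"
      by (rule wirtinger_cong(1)[OF open_ball[of 0 1]]) (use 1 in \<open>auto simp: h max_absorb1\<close>)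
    also have "\<dots> = cnj (z ^ k) * d_dz ?K z"
      by (rule d_dz_antiholomorphic_mult[OF dpow smooth_on_has_derivative[OF K UNIV_I]])
    finally have d: "d_dz (\<lambda>w. h w * G w) z = cnj (z ^ k) * d_dz ?K z" .
    have "laplacian_tensor m f k (1, z) = - d_dz ?K z"
      unfolding lt coeff d using 1 z by (simp add: h h_T_def max_absorb1 field_simps)
    moreover have "d_dzbar (\<lambda>w. g w * w ^ k) = ?K"
      using d_dzbar_holomorphic_mult[OF dpow dg, of k] by (simp add: G_def fun_eq_iff mult.commute)
    then have "lap m (tensor m f k) (1, z) = - d_dz ?K z"
      using 1 by (simp add: lap_chart0 flat_laplacian_def tensor_chart0 g_def)
    ultimately show ?thesis by simp
  next
    case 2
    then show ?thesis by (simp add: lap_chart0 laplacian_tensor_def tensor_chart0)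
  next
    case 3
    define n where "n = m - k"
    define p where "p = inverse z"
    have p0: "p \<noteq> 0" using z by (simp add: p_def)
    have lt: "laplacian_tensor m f k (1, z) = laplacian_coeff m f k z * z ^ k"
      using 3 by (simp add: laplacian_tensor_def tensor_chart0)
    define b where "b = (\<lambda>w. f (pt w 1) * w ^ n)"
    have b: "smooth_on UNIV b"
      unfolding b_def by (intro smooth_on_mult smooth_on_power smooth_on_id f1 open_UNIV)
    have b': "smooth_on UNIV (d_dzbar b)" by (intro smooth_on_d_dzbar b open_UNIV)
    have op: "open (- {0 :: complex})" "open (- cball (0 :: complex) 1)"
      by (intro open_Compl closed_singleton closed_cball)+
    have dinv: "((\<lambda>w. inverse w ^ n) has_field_derivative (of_nat n * inverse w ^ (n - 1) * (- (inverse w)\<^sup>2))) (at w)"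
      if "w \<noteq> 0" for w :: complex
      using that by (auto intro!: derivative_eq_intros simp: power2_eq_square)
    let ?K = "\<lambda>w. inverse w ^ n * G w"
    have bK: "?K w = cnj (- (inverse w)\<^sup>2) * d_dzbar b (inverse w)" if "w \<noteq> 0" for w
    proof -
      have "d_dzbar (\<lambda>w. b (inverse w)) w = d_dzbar (\<lambda>w. inverse w ^ n * g w) w"
      proof (rule wirtinger_cong(2)[OF op(1)])
        fix u :: complex assume "u \<in> - {0}"
        then have "pt (inverse u) 1 = pt 1 u" by (subst pt_affine) (auto simp: divide_inverse)
        then show "b (inverse u) = inverse u ^ n * g u" by (simp add: b_def g_def)
      qed (use that in simp)
      also have "\<dots> = ?K w"
        unfolding G_def by (rule d_dzbar_holomorphic_mult[OF dinv[OF that] dg])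
      finally show ?thesis unfolding wirtinger_inversion(2)[OF b that] by (metis mult.commute)
    qed
    have hout: "h w = cnj (inverse w ^ n) * inverse w ^ n" if "w \<in> - cball 0 1" for w
    proof -
      have w: "cmod w > 1" using that by (simp add: not_le)
      then have w0: "w \<noteq> 0" by auto
      have "complex_of_real (max 1 (cmod w) ^ (2 * m)) = (of_real ((cmod w)\<^sup>2)) ^ m"
        using w by (simp add: max_absorb2 power_mult)
      also have "\<dots> = (w * cnj w) ^ m" by (simp only: complex_norm_square)
      also have "\<dots> = w ^ k * cnj (w ^ k) * (w ^ n * cnj (w ^ n))"
        using k by (simp add: n_def power_mult_distrib flip: power_add)
          (simp add: mult_ac flip: power_add)
      finally show ?thesis
        using w0 by (simp add: h field_simps)
    qed
    have K: "(?K has_derivative (\<lambda>v. inverse z ^ n * frechet_derivative G (at z) v +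
        (of_nat n * inverse z ^ (n - 1) * (- (inverse z)\<^sup>2) * v) * G z)) (at z)"
      by (rule has_derivative_mult[OF dinv[OF z, unfolded has_field_derivative_def] dG])
    have "d_dz (\<lambda>w. h w * G w) z = d_dz (\<lambda>w. cnj (inverse w ^ n) * ?K w) z"
      by (rule wirtinger_cong(1)[OF op(2)]) (use 3 hout in \<open>auto simp: mult_ac\<close>)
    also have "\<dots> = cnj (p ^ n) * d_dz ?K z"
      unfolding p_def by (rule d_dz_antiholomorphic_mult[OF dinv[OF z] K])
    also have "d_dz ?K z = d_dz (\<lambda>w. cnj (- (inverse w)\<^sup>2) * d_dzbar b (inverse w)) z"
      by (rule wirtinger_cong(1)[OF op(1)]) (use z bK in auto)
    also have "\<dots> = cnj (- p\<^sup>2) * d_dz (\<lambda>w. d_dzbar b (inverse w)) z"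
      unfolding p_def
    proof (rule d_dz_antiholomorphic_mult)
      show "((\<lambda>w. - (inverse w)\<^sup>2) has_field_derivative (- (2 * inverse z * (- (inverse z)\<^sup>2)))) (at z)"
        using z by (auto intro!: derivative_eq_intros simp: power2_eq_square)
      have "((\<lambda>w. inverse w) has_derivative (\<lambda>v. - (inverse z)\<^sup>2 * v)) (at z)"
        using DERIV_inverse[OF z, of UNIV] unfolding has_field_derivative_def
        by (rule has_derivative_eq_rhs) (simp add: fun_eq_iff power2_eq_square)
      then show "((\<lambda>w. d_dzbar b (inverse w)) has_derivative
          (\<lambda>v. frechet_derivative (d_dzbar b) (at (inverse z)) (- (inverse z)\<^sup>2 * v))) (at z)"
        by (rule has_derivative_compose[OF _ smooth_on_has_derivative[OF b' UNIV_I]])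
    qed
    also have "d_dz (\<lambda>w. d_dzbar b (inverse w)) z = d_dz (d_dzbar b) p * (- p\<^sup>2)"
      unfolding p_def by (rule wirtinger_inversion(1)[OF b' z])
    finally have d: "d_dz (\<lambda>w. h w * G w) z = cnj (p ^ n) * (cnj (- p\<^sup>2) * (d_dz (d_dzbar b) p * (- p\<^sup>2)))" .
    have hT: "complex_of_real (h_T z) = (p * cnj p)\<^sup>2"
    proof -
      have "h_T z = ((cmod p)\<^sup>2)\<^sup>2"
        using 3 by (simp add: h_T_def max_absorb2 p_def norm_inverse power_inverse divide_inverse flip: power_mult)
      then have "complex_of_real (h_T z) = (complex_of_real ((cmod p)\<^sup>2))\<^sup>2" by simp
      then show ?thesis by (simp only: complex_norm_square)
    qed
    have hz: "h z = cnj (p ^ n) * p ^ n" using hout[of z] 3 by (simp add: p_def)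
    have "laplacian_coeff m f k z = - inverse ((p * cnj p)\<^sup>2) * inverse (cnj (p ^ n) * p ^ n) *
        (cnj (p ^ n) * (cnj (- p\<^sup>2) * (d_dz (d_dzbar b) p * (- p\<^sup>2))))"
      unfolding coeff d hT hz ..
    also have "\<dots> = - inverse (p ^ n) * d_dz (d_dzbar b) p"
      using p0 by (simp add: field_simps power_mult_distrib)
    finally have "laplacian_tensor m f k (1, z) = - (z ^ n * z ^ k * d_dz (d_dzbar b) p)"
      unfolding lt by (simp add: p_def power_inverse)
    also have "z ^ n * z ^ k = z ^ m" using k by (simp add: n_def flip: power_add)
    finally show ?thesis
      using 3 by (simp add: lap_chart0 flat_laplacian_def tensor_chart1 p_def inverse_eq_divide b_def n_def)
  qed
qed

lemma section_eq_at_pt: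
  assumes "is_section m s" "is_section m t"
  shows "s (hcoords (pt 1 z)) = t (hcoords (pt 1 z)) \<longleftrightarrow> s (1, z) = t (1, z)"
proof -
  have nz: "(1, z) \<noteq> (0 :: complex \<times> complex)" by (simp add: zero_prod_def)
  obtain c where "c \<noteq> 0" "hcoords (pt 1 z) = (c * 1, c * z)" using hcoords_pt[OF nz] by blast
  then show ?thesis
    using is_sectionD(2)[OF assms(1) _ nz, of c] is_sectionD(2)[OF assms(2) _ nz, of c] by simp
qed

lemma section_AE_iff:
  assumes "measurable_section m s" "measurable_section m t"
  shows "(AE p in omega. s (hcoords p) = t (hcoords p)) \<longleftrightarrow> (AE z in lborel. s (1, z) = t (1, z))"
proof -
  have [measurable]: "(\<lambda>z. s (1, z)) \<in> borel_measurable borel" "(\<lambda>z. t (1, z)) \<in> borel_measurable borel"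
    using assms by (auto simp: measurable_section_def)
  have eq: "s (hcoords (pt 1 z)) = t (hcoords (pt 1 z)) \<longleftrightarrow> s (1, z) = t (1, z)" for z
    using assms by (intro section_eq_at_pt) (auto simp: measurable_section_def)
  show ?thesis
    using omega_AE_iff[of "\<lambda>p. s (hcoords p) = t (hcoords p)"] unfolding eq by measurable
qed

text \<open>
  Altering an element of the closure on a null set changes neither integrability nor distances, so the
  altered section lies in the closure as well.
\<close>

lemma ae_equalI:
  assumes s: "s \<in> L2_closure m" and t: "measurable_section m t"
    and AE: "AE z in lborel. t (1, z) = s (1, z)"
  shows "(t, s) \<in> ae_equal m"
proof -
  have ms: "measurable_section m s" using s by (simp add: L2_closure_iff L2_sections_iff)
  have ts: "AE p in omega. t (hcoords p) = s (hcoords p)"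
    using AE section_AE_iff[OF t ms] by simp
  have "AE p in omega. h_metric m t t p = h_metric m s s p"
    using ts by eventually_elim (simp add: h_metric_eq)
  then have "integrable omega (h_metric m t t) \<longleftrightarrow> integrable omega (h_metric m s s)"
    by (intro integrable_cong_AE h_metric_measurable t ms)
  then have tL2: "t \<in> L2_sections m"
    using s t by (simp add: L2_closure_iff L2_sections_iff)
  have "norm_sq m (\<lambda>x. t x - u x) = norm_sq m (\<lambda>x. s x - u x)" if "u \<in> smooth_sections m" for u
  proof -
    have mu: "measurable_section m u" using that by (rule smooth_sections_measurable)
    have "AE p in omega. cmod (h_metric m (\<lambda>x. t x - u x) (\<lambda>x. t x - u x) p) = cmod (h_metric m (\<lambda>x. s x - u x) (\<lambda>x. s x - u x) p)"
      using ts by eventually_elim (simp add: h_metric_eq)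
    then show ?thesis unfolding norm_sq_def
      by (intro integral_cong_AE borel_measurable_norm[THEN measurable_compose[rotated]] measurable_compose[OF h_metric_measurable borel_measurable_norm] measurable_section_diff t ms mu) auto
  qed
  then have "t \<in> L2_closure m"
    using s tL2 unfolding L2_closure_iff by simp
  then show ?thesis using s ts by (simp add: ae_equal_def)
qed

lemma laplacian_tensor_ae_equal:
  assumes f: "f \<in> smooth_functions" and k: "k \<le> m"
  shows "(laplacian_tensor m f k, lap m (tensor m f k)) \<in> ae_equal m"
proof (rule ae_equalI)
  note sm = tensor_smooth[OF f k]
  show "lap m (tensor m f k) \<in> L2_closure m" by (rule lap_L2_closure[OF sm])
  note lapm = measurable_section_lap[OF sm]
  then have [measurable]: "(\<lambda>z. lap m (tensor m f k) (1, z)) \<in> borel_measurable borel"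
    "(\<lambda>w. lap m (tensor m f k) (w, 1)) \<in> borel_measurable borel"
    by (auto simp: measurable_section_def)
  have sec: "is_section m (laplacian_tensor m f k)"
    unfolding laplacian_tensor_def by (rule is_section_tensor[OF k])
  have "(\<lambda>z. laplacian_tensor m f k (1, z)) =
      (\<lambda>z. if z = 0 then laplacian_tensor m f k (1, 0) else lap m (tensor m f k) (1, z))"
    using laplacian_tensor_affine[OF f k] by auto
  moreover have "(\<lambda>w. laplacian_tensor m f k (w, 1)) =
      (\<lambda>w. if w = 0 then laplacian_tensor m f k (0, 1) else lap m (tensor m f k) (w, 1))"
  proof
    fix w
    show "laplacian_tensor m f k (w, 1) = (if w = 0 then laplacian_tensor m f k (0, 1) else lap m (tensor m f k) (w, 1))"
      using section_eq_chart0[OF sec, of w 1] section_eq_chart0[OF is_section_lap, of w m "tensor m f k" 1]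
        laplacian_tensor_affine[OF f k, of "1 / w"] by simp
  qed
  ultimately show "measurable_section m (laplacian_tensor m f k)"
    unfolding measurable_section_def using sec by simp
  show "AE z in lborel. laplacian_tensor m f k (1, z) = lap m (tensor m f k) (1, z)"
    using AE_lborel_singleton[of "0::complex"] by eventually_elim (rule laplacian_tensor_affine[OF f k])
qed

section \<open>Every smooth section is a combination of the $f_k \otimes z^k$\<close>

text \<open>
  The coefficient of $z^k$ obtained by expanding $(x_1 \bar x_1 + x_0 \bar x_0)^m$ in
  $s \cdot (x_1 \bar x_1 + x_0 \bar x_0)^m / (x_1 \bar x_1 + x_0 \bar x_0)^m$. It has degree 0 in the homogeneous
  coordinates, hence is a function on the projective line.
\<close>

definition component :: "nat \<Rightarrow> hom_fun \<Rightarrow> nat \<Rightarrow> P1 \<Rightarrow> complex" where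
  "component m s k p = (let x = hcoords p in
     of_nat (m choose k) * cnj (fst x) ^ (m - k) * cnj (snd x) ^ k * s x /
       (snd x * cnj (snd x) + fst x * cnj (fst x)) ^ m)"

lemma norm_form_nonzero:
  assumes "(x0, x1) \<noteq> (0 :: complex \<times> complex)"
  shows "x1 * cnj x1 + x0 * cnj x0 \<noteq> 0"
proof -
  have "x1 * cnj x1 + x0 * cnj x0 = of_real ((cmod x1)\<^sup>2 + (cmod x0)\<^sup>2)"
    by (simp only: of_real_add complex_norm_square)
  moreover have "(cmod x1)\<^sup>2 + (cmod x0)\<^sup>2 \<noteq> 0"
    using assms by (auto simp: sum_power2_eq_zero_iff zero_prod_def)
  ultimately show ?thesis by (simp only: of_real_eq_0_iff) simp
qed

lemma component_pt:
  assumes s: "is_section m s" and k: "k \<le> m" and x: "(x0, x1) \<noteq> 0"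
  shows "component m s k (pt x0 x1) = of_nat (m choose k) * cnj x0 ^ (m - k) * cnj x1 ^ k * s (x0, x1) /
       (x1 * cnj x1 + x0 * cnj x0) ^ m"
proof -
  obtain c where c: "c \<noteq> 0" "hcoords (pt x0 x1) = (c * x0, c * x1)" using hcoords_pt[OF x] by blast
  let ?C = "c ^ m * cnj c ^ m"
  have "cnj c ^ m = cnj c ^ (m - k) * cnj c ^ k" using k by (simp flip: power_add)
  then have num: "of_nat (m choose k) * cnj (c * x0) ^ (m - k) * cnj (c * x1) ^ k * (c ^ m * s (x0, x1)) =
      ?C * (of_nat (m choose k) * cnj x0 ^ (m - k) * cnj x1 ^ k * s (x0, x1))"
    by (simp add: power_mult_distrib mult_ac)
  have "c * x1 * cnj (c * x1) + c * x0 * cnj (c * x0) = c * cnj c * (x1 * cnj x1 + x0 * cnj x0)"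
    by (simp add: algebra_simps)
  then have den: "(c * x1 * cnj (c * x1) + c * x0 * cnj (c * x0)) ^ m = ?C * (x1 * cnj x1 + x0 * cnj x0) ^ m"
    by (simp add: power_mult_distrib)
  have C: "?C \<noteq> 0" using c by simp
  show ?thesis
    unfolding component_def c(2) Let_def fst_conv snd_conv is_sectionD(2)[OF s c(1) x] num den
    by (rule mult_divide_mult_cancel_left[OF C])
qed

lemma component_smooth:
  assumes s: "s \<in> smooth_sections m" and k: "k \<le> m"
  shows "component m s k \<in> smooth_functions"
proof -
  have sec: "is_section m s" using s by (simp add: smooth_sections_iff)
  have nz: "(1, z) \<noteq> (0 :: complex \<times> complex)" "(z, 1) \<noteq> (0 :: complex \<times> complex)" for z
    by (simp_all add: zero_prod_def)
  have "smooth_on UNIV (\<lambda>z. of_nat (m choose k) * cnj 1 ^ (m - k) * cnj z ^ k * s (1, z) * inverse ((z * cnj z + 1 * cnj 1) ^ m))"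
    by (intro smooth_on_mult smooth_on_inverse smooth_on_power smooth_on_add smooth_on_cnj smooth_on_id smooth_on_const
        smooth_charts[OF s] open_UNIV power_not_zero norm_form_nonzero nz)
  moreover have "smooth_on UNIV (\<lambda>w. of_nat (m choose k) * cnj w ^ (m - k) * cnj 1 ^ k * s (w, 1) * inverse ((1 * cnj 1 + w * cnj w) ^ m))"
    by (intro smooth_on_mult smooth_on_inverse smooth_on_power smooth_on_add smooth_on_cnj smooth_on_id smooth_on_const
        smooth_charts[OF s] open_UNIV power_not_zero norm_form_nonzero nz)
  ultimately show ?thesis
    unfolding smooth_functions_iff component_pt[OF sec k nz(1)] component_pt[OF sec k nz(2)] divide_inverse
    by blast
qed

lemma sum_components:
  assumes s: "is_section m s"
  shows "(\<lambda>x. \<Sum>k\<le>m. tensor m (component m s k) k x) = s"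
proof
  fix x :: "complex \<times> complex"
  obtain x0 x1 where x: "x = (x0, x1)" by (cases x)
  show "(\<Sum>k\<le>m. tensor m (component m s k) k x) = s x"
  proof (cases "x = 0")
    case True
    then show ?thesis using is_sectionD(1)[OF s] by (simp add: tensor_def zero_prod_def)
  next
    case False
    let ?a = "x1 * cnj x1" and ?b = "x0 * cnj x0"
    have nz: "(x0, x1) \<noteq> 0" using False by (simp add: x)
    have "tensor m (component m s k) k x = (of_nat (m choose k) * ?a ^ k * ?b ^ (m - k)) * (s x / (?a + ?b) ^ m)"
      if "k \<le> m" for k
      using nz by (simp add: x tensor_def component_pt[OF s that nz] power_mult_distrib mult_ac)
    then have "(\<Sum>k\<le>m. tensor m (component m s k) k x) =
        (\<Sum>k\<le>m. of_nat (m choose k) * ?a ^ k * ?b ^ (m - k)) * (s x / (?a + ?b) ^ m)"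
      unfolding sum_distrib_right by (intro sum.cong) auto
    also have "(\<Sum>k\<le>m. of_nat (m choose k) * ?a ^ k * ?b ^ (m - k)) = (?a + ?b) ^ m"
      by (rule binomial_ring[symmetric])
    finally show ?thesis using norm_form_nonzero[OF nz] by simp
  qed
qed

section \<open>The operator\<close>

text \<open>
  The prescribed values on tensors determine the operator: induction over the partial sums of the
  decomposition of $s$ uses only additivity.
\<close>

lemma canonical_laplacian_eq:
  assumes D: "is_canonical_laplacian m D" and s: "s \<in> smooth_sections m"
  shows "D s = H_class m (lap m s)"
proof -
  let ?T = "\<lambda>k. tensor m (component m s k) k"
  let ?S = "\<lambda>n x. \<Sum>k\<le>n. ?T k x"
  have T: "?T k \<in> smooth_sections m" "D (?T k) = H_class m (lap m (?T k))" if "k \<le> m" for k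
  proof -
    note c = component_smooth[OF s that]
    show "?T k \<in> smooth_sections m" by (rule tensor_smooth[OF c that])
    have "D (?T k) = H_class m (laplacian_tensor m (component m s k) k)"
      using D c that by (simp add: is_canonical_laplacian_def)
    also have "\<dots> = H_class m (lap m (?T k))"
      using laplacian_tensor_ae_equal[OF c that] ae_equalD H_class_eq_iff by blast
    finally show "D (?T k) = H_class m (lap m (?T k))" .
  qed
  have "n \<le> m \<Longrightarrow> ?S n \<in> smooth_sections m \<and> D (?S n) = H_class m (lap m (?S n))" for n
  proof (induction n)
    case 0
    then show ?case using T[of 0] by simp
  next
    case (Suc n)
    then have IH: "?S n \<in> smooth_sections m" "D (?S n) = H_class m (lap m (?S n))" by auto
    have eq: "?S (Suc n) = (\<lambda>x. ?S n x + ?T (Suc n) x)" by simp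
    have "D (?S (Suc n)) = H_add m (D (?S n)) (D (?T (Suc n)))"
      unfolding eq using D IH(1) T(1)[OF Suc.prems]
      by (simp only: is_canonical_laplacian_def is_linear_operator_def)
    also have "\<dots> = H_class m (\<lambda>x. lap m (?S n) x + lap m (?T (Suc n)) x)"
      unfolding IH(2) T(2)[OF Suc.prems] by (intro H_add_class lap_L2_closure IH(1) T(1) Suc.prems)
    also have "\<dots> = H_class m (lap m (?S (Suc n)))"
      unfolding eq lap_add[OF IH(1) T(1)[OF Suc.prems]] ..
    finally show ?case
      using smooth_sections_add[OF IH(1) T(1)[OF Suc.prems]] unfolding eq by blast
  qed
  then have S: "D (?S m) = H_class m (lap m (?S m))" by simp
  have "?S m = s"
    by (rule sum_components) (use s in \<open>simp add: smooth_sections_iff\<close>)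
  with S show ?thesis by (simp only:)
qed

lemma canonical_laplacian_exists:
  "is_canonical_laplacian m (restrict (\<lambda>s. H_class m (lap m s)) (smooth_sections m))" (is "is_canonical_laplacian m ?D")
  unfolding is_canonical_laplacian_def is_linear_operator_def
proof (intro conjI ballI allI impI)
  show "?D \<in> smooth_sections m \<rightarrow>\<^sub>E Hilbert m"
    using H_class_in_Hilbert lap_L2_closure by auto
next
  fix s t assume st: "s \<in> smooth_sections m" "t \<in> smooth_sections m"
  then show "?D (\<lambda>x. s x + t x) = H_add m (?D s) (?D t)"
    using smooth_sections_add[OF st]
    by (simp add: lap_add H_add_class lap_L2_closure)
next
  fix c s assume s: "s \<in> smooth_sections m"
  then show "?D (\<lambda>x. c * s x) = H_scale m c (?D s)"
    using smooth_sections_scale[OF s] by (simp add: lap_scale H_scale_class lap_L2_closure)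
next
  fix f k assume f: "f \<in> smooth_functions" "k \<le> m"
  then show "?D (tensor m f k) = H_class m (laplacian_tensor m f k)"
    using tensor_smooth[OF f] laplacian_tensor_ae_equal[OF f] ae_equalD H_class_eq_iff
    by (metis (no_types, lifting) restrict_apply')
qed

lemma canonical_laplacian_unique:
  assumes "is_canonical_laplacian m D" "is_canonical_laplacian m D'"
  shows "D = D'"
proof (rule PiE_ext)
  show "D \<in> smooth_sections m \<rightarrow>\<^sub>E Hilbert m" "D' \<in> smooth_sections m \<rightarrow>\<^sub>E Hilbert m"
    using assms by (simp_all add: is_canonical_laplacian_def is_linear_operator_def)
  fix s assume s: "s \<in> smooth_sections m"
  show "D s = D' s"
    unfolding canonical_laplacian_eq[OF assms(1) s] canonical_laplacian_eq[OF assms(2) s] ..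
qed

section \<open>The Dirichlet form\<close>

text \<open>
  The form $(\bar\partial s, \bar\partial t)$ on the projective line: the $L^2$ product of $(0,1)$-forms does not
  involve a metric on the base, and the metric of $\mathcal{O}(m)$ is trivial on each disc.
\<close>

definition dirichlet :: "nat \<Rightarrow> hom_fun \<Rightarrow> hom_fun \<Rightarrow> complex" where
  "dirichlet m s t = (1 / pi) *\<^sub>R
     ((LINT z:ball 0 1|lborel. d_dzbar (\<lambda>z. s (1, z)) z * cnj (d_dzbar (\<lambda>z. t (1, z)) z)) +
      (LINT w:ball 0 1|lborel. d_dzbar (\<lambda>w. s (w, 1)) w * cnj (d_dzbar (\<lambda>w. t (w, 1)) w)))"

text \<open>
  Green's formula for $P = a\,\overline{\partial_{\bar z} b}$, since
  $\partial_{\bar z}\overline{\partial_{\bar z} b} = \overline{\partial_z \partial_{\bar z} b}$.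
\<close>

lemma disc_integration_by_parts:
  assumes a: "smooth_on UNIV a" and b: "smooth_on UNIV b"
  shows "(LINT z:ball 0 1|lborel. a z * cnj (flat_laplacian b z)) =
    (LINT z:ball 0 1|lborel. d_dzbar a z * cnj (d_dzbar b z)) -
    (1 / 2) * integral {- pi..pi} (\<lambda>\<theta>. cis \<theta> * (a (cis \<theta>) * cnj (d_dzbar b (cis \<theta>))))"
proof -
  let ?P = "\<lambda>z. a z * cnj (d_dzbar b z)"
  have b': "smooth_on UNIV (d_dzbar b)" by (intro smooth_on_d_dzbar b open_UNIV)
  have P: "smooth_on UNIV ?P" by (intro smooth_on_mult smooth_on_cnj a b' open_UNIV)
  have dP: "d_dzbar ?P z = d_dzbar a z * cnj (d_dzbar b z) - a z * cnj (flat_laplacian b z)" for z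
    using wirtinger_eqI(2)[OF has_wirtinger_mult[OF smooth_on_wirtinger[OF a UNIV_I]
        has_wirtinger_cnj[OF smooth_on_wirtinger[OF b' UNIV_I]]]]
    by (simp add: flat_laplacian_def)
  have int: "set_integrable lborel (ball 0 1) (\<lambda>z. d_dzbar a z * cnj (d_dzbar b z))"
    "set_integrable lborel (ball 0 1) (\<lambda>z. a z * cnj (flat_laplacian b z))"
    by (intro set_integrable_unit_ball smooth_on_continuous smooth_on_mult smooth_on_cnj smooth_on_d_dzbar
        smooth_on_flat_laplacian a b open_UNIV)+
  have "(LINT z:ball 0 1|lborel. d_dzbar ?P z) =
      (LINT z:ball 0 1|lborel. d_dzbar a z * cnj (d_dzbar b z)) - (LINT z:ball 0 1|lborel. a z * cnj (flat_laplacian b z))"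
    unfolding dP by (rule set_integral_diff(2)[OF int])
  then show ?thesis using green_disc[OF P] by (simp add: algebra_simps)
qed

context
  fixes m :: nat and s :: hom_fun
  assumes s: "s \<in> smooth_sections m"
begin

lemma section_charts_inversion:
  assumes "z \<noteq> 0"
  shows "s (z, 1) = z ^ m * s (1, inverse z)" "s (1, z) = z ^ m * s (inverse z, 1)"
  using section_eq_chart0[of m s z 1] section_eq_chart1[of m s z 1] s assms
  by (simp_all add: smooth_sections_iff inverse_eq_divide)

lemma d_dzbar_chart_change:
  assumes z: "z \<noteq> 0"
  shows "d_dzbar (\<lambda>w. s (w, 1)) z = z ^ m * (d_dzbar (\<lambda>z. s (1, z)) (inverse z) * cnj (- (inverse z)\<^sup>2))"
    and "d_dzbar (\<lambda>z. s (1, z)) z = z ^ m * (d_dzbar (\<lambda>w. s (w, 1)) (inverse z) * cnj (- (inverse z)\<^sup>2))"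
proof -
  have op: "open (- {0 :: complex})" by (intro open_Compl closed_singleton)
  have key: "d_dzbar f z = z ^ m * (d_dzbar g (inverse z) * cnj (- (inverse z)\<^sup>2))"
    if g: "smooth_on UNIV g" and fg: "\<And>w. w \<noteq> 0 \<Longrightarrow> f w = w ^ m * g (inverse w)" for f g
  proof -
    have inv: "(inverse has_field_derivative (- (inverse z)\<^sup>2)) (at z)"
      using DERIV_inverse[OF z, of UNIV] by (simp add: power2_eq_square)
    have pow: "((\<lambda>w. w ^ m) has_field_derivative of_nat m * z ^ (m - 1)) (at z)"
      by (auto intro!: derivative_eq_intros)
    have "d_dzbar f z = d_dzbar (\<lambda>w. w ^ m * g (inverse w)) z"
      by (rule wirtinger_cong(2)[OF op]) (use z fg in auto)
    also have "\<dots> = z ^ m * d_dzbar (\<lambda>w. g (inverse w)) z"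
      by (rule d_dzbar_holomorphic_mult[OF pow has_wirtinger_compose[OF inv smooth_on_wirtinger[OF g UNIV_I]]])
    finally show ?thesis unfolding wirtinger_inversion(2)[OF g z] .
  qed
  show "d_dzbar (\<lambda>w. s (w, 1)) z = z ^ m * (d_dzbar (\<lambda>z. s (1, z)) (inverse z) * cnj (- (inverse z)\<^sup>2))"
    by (rule key[OF smooth_charts(1)[OF s]]) (rule section_charts_inversion)
  show "d_dzbar (\<lambda>z. s (1, z)) z = z ^ m * (d_dzbar (\<lambda>w. s (w, 1)) (inverse z) * cnj (- (inverse z)\<^sup>2))"
    by (rule key[OF smooth_charts(2)[OF s]]) (rule section_charts_inversion)
qed

end

text \<open>
  On the circle $w = e^{i\theta}$ corresponds to $z = e^{-i\theta}$. The factors $w^m$ of $s$ and of the conjugate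
  of $\partial_{\bar w} t$ multiply to 1, and the factor $-w^{-2}$ from the derivative of $1/w$ turns $e^{i\theta}$ into
  $-e^{-i\theta}$; the reflection $\theta \mapsto -\theta$ finishes the comparison.
\<close>

lemma boundary_terms_cancel:
  assumes s: "s \<in> smooth_sections m" and t: "t \<in> smooth_sections m"
  shows "integral {- pi..pi} (\<lambda>\<theta>. cis \<theta> * (s (cis \<theta>, 1) * cnj (d_dzbar (\<lambda>w. t (w, 1)) (cis \<theta>)))) =
    - integral {- pi..pi} (\<lambda>\<theta>. cis \<theta> * (s (1, cis \<theta>) * cnj (d_dzbar (\<lambda>z. t (1, z)) (cis \<theta>))))"
proof -
  let ?P = "\<lambda>z. s (1, z) * cnj (d_dzbar (\<lambda>z. t (1, z)) z)"
  have "cis \<theta> * (s (cis \<theta>, 1) * cnj (d_dzbar (\<lambda>w. t (w, 1)) (cis \<theta>))) = - (cis (- \<theta>) * ?P (cis (- \<theta>)))" for \<theta>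
  proof -
    have c: "cis \<theta> \<noteq> 0" by simp
    have inv: "inverse (cis \<theta>) = cis (- \<theta>)" by simp
    have "cis \<theta> ^ m * cnj (cis \<theta>) ^ m = (cis \<theta> * cnj (cis \<theta>)) ^ m" by (rule power_mult_distrib[symmetric])
    also have "cis \<theta> * cnj (cis \<theta>) = 1" by (simp add: cis_cnj cis_mult)
    finally have one: "cis \<theta> ^ m * cnj (cis \<theta>) ^ m = 1" by simp
    have "cis \<theta> * (s (cis \<theta>, 1) * cnj (d_dzbar (\<lambda>w. t (w, 1)) (cis \<theta>))) =
        (cis \<theta> ^ m * cnj (cis \<theta>) ^ m) * (cis \<theta> * (- (cis (- \<theta>))\<^sup>2) * ?P (cis (- \<theta>)))"
      unfolding section_charts_inversion(1)[OF s c] d_dzbar_chart_change(1)[OF t c] inv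
      by (simp add: mult_ac)
    also have "\<dots> = - ((cis \<theta> * cis (- \<theta>)) * (cis (- \<theta>) * ?P (cis (- \<theta>))))"
      unfolding one by (simp add: power2_eq_square mult_ac)
    also have "cis \<theta> * cis (- \<theta>) = 1" by (simp add: cis_mult)
    finally show ?thesis by simp
  qed
  then have "integral {- pi..pi} (\<lambda>\<theta>. cis \<theta> * (s (cis \<theta>, 1) * cnj (d_dzbar (\<lambda>w. t (w, 1)) (cis \<theta>)))) =
      integral {- pi..pi} (\<lambda>\<theta>. - (cis (- \<theta>) * ?P (cis (- \<theta>))))" by simp
  also have "\<dots> = - integral {- pi..pi} (\<lambda>\<theta>. cis (- \<theta>) * ?P (cis (- \<theta>)))" by (rule integral_neg)
  also have "integral {- pi..pi} (\<lambda>\<theta>. cis (- \<theta>) * ?P (cis (- \<theta>))) = integral {- pi..pi} (\<lambda>\<theta>. cis \<theta> * ?P (cis \<theta>))"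
    using Henstock_Kurzweil_Integration.integral_reflect_real[of pi "- pi" "\<lambda>\<theta>. cis \<theta> * ?P (cis \<theta>)"] by (simp only: minus_minus)
  finally show ?thesis .
qed

lemma L2_product_lap:
  assumes s: "s \<in> smooth_sections m" and t: "t \<in> smooth_sections m"
  shows "L2_product m s (lap m t) = dirichlet m s t"
proof -
  have "L2_product m s (lap m t) = (1 / pi) *\<^sub>R ((LINT z:ball 0 1|lborel. s (1, z) * cnj (lap m t (1, z))) +
      (LINT w:ball 0 1|lborel. s (w, 1) * cnj (lap m t (w, 1))))"
    by (intro h_metric_two_discs(2) smooth_sections_measurable s measurable_section_lap t
        integrable_h_metric smooth_sections_L2 lap_L2)
  also have "(LINT z:ball 0 1|lborel. s (1, z) * cnj (lap m t (1, z))) =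
      (LINT z:ball 0 1|lborel. s (1, z) * cnj (flat_laplacian (\<lambda>z. t (1, z)) z))"
    by (rule set_lebesgue_integral_cong) (simp_all add: lap_chart0)
  also have "(LINT w:ball 0 1|lborel. s (w, 1) * cnj (lap m t (w, 1))) =
      (LINT w:ball 0 1|lborel. s (w, 1) * cnj (flat_laplacian (\<lambda>w. t (w, 1)) w))"
    by (rule set_lebesgue_integral_cong) (simp_all add: lap_chart1)
  finally show ?thesis
    unfolding disc_integration_by_parts[OF smooth_charts(1)[OF s] smooth_charts(1)[OF t]]
      disc_integration_by_parts[OF smooth_charts(2)[OF s] smooth_charts(2)[OF t]]
      boundary_terms_cancel[OF s t] dirichlet_def
    by simp
qed

lemma L2_product_cnj: "L2_product m t s = cnj (L2_product m s t)"
proof -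
  have "h_metric m t s = (\<lambda>p. cnj (h_metric m s t p))"
    by (rule ext) (simp add: h_metric_eq mult.commute)
  then show ?thesis by (simp add: L2_product_def)
qed

lemma dirichlet_cnj: "dirichlet m t s = cnj (dirichlet m s t)"
proof -
  have key: "(LINT z:A|M. g z * cnj (f z)) = cnj (LINT z:A|M. f z * cnj (g z))" for A M and f g :: "complex \<Rightarrow> complex"
  proof -
    have "(LINT z|M. indicator A z *\<^sub>R (g z * cnj (f z))) = (LINT z|M. cnj (indicator A z *\<^sub>R (f z * cnj (g z))))"
      by (simp add: mult.commute)
    also have "\<dots> = cnj (LINT z|M. indicator A z *\<^sub>R (f z * cnj (g z)))"
      by (rule Bochner_Integration.integral_cnj)
    finally show ?thesis by (simp only: set_lebesgue_integral_def)
  qed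
  show ?thesis
    unfolding dirichlet_def key[of _ _ "d_dzbar (\<lambda>z. t (1, z))" "d_dzbar (\<lambda>z. s (1, z))"]
      key[of _ _ "d_dzbar (\<lambda>w. t (w, 1))" "d_dzbar (\<lambda>w. s (w, 1))"]
    by (simp only: complex_cnj_scaleR complex_cnj_add)
qed

section \<open>Positivity and the kernel\<close>

text \<open>
  A continuous function that vanishes almost everywhere on an open set vanishes there, since nonempty
  open sets are not negligible.
\<close>

lemma disc_integral_norm_sq:
  fixes g :: "complex \<Rightarrow> complex"
  assumes g: "continuous_on UNIV g"
  obtains r where "(LINT z:ball 0 1|lborel. g z * cnj (g z)) = complex_of_real r" "0 \<le> r"
    "r = 0 \<Longrightarrow> (\<forall>z. cmod z < 1 \<longrightarrow> g z = 0)"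
proof
  let ?q = "\<lambda>z. indicator (ball 0 1) z * (cmod (g z))\<^sup>2 :: real"
  have "indicator (ball 0 1) z *\<^sub>R (g z * cnj (g z)) = complex_of_real (?q z)" for z
    by (simp only: complex_norm_square[symmetric] scaleR_conv_of_real of_real_mult)
  then show "(LINT z:ball 0 1|lborel. g z * cnj (g z)) = complex_of_real (LINT z|lborel. ?q z)"
    by (simp only: set_lebesgue_integral_def integral_complex_of_real)
  show "0 \<le> (LINT z|lborel. ?q z)" by simp
  assume 0: "(LINT z|lborel. ?q z) = 0"
  have "continuous_on UNIV (\<lambda>z. complex_of_real ((cmod (g z))\<^sup>2))" by (intro continuous_intros g)
  from set_integrable_unit_ball[OF this]
  have "integrable lborel (\<lambda>z. complex_of_real (?q z))"
    by (simp only: set_integrable_def scaleR_conv_of_real of_real_mult)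
  then have "integrable lborel ?q" by (simp only: complex_of_real_integrable_eq)
  then have AE: "AE z in lborel. ?q z = 0"
    using 0 by (subst (asm) integral_nonneg_eq_0_iff_AE) auto
  let ?N = "{z. cmod z < 1 \<and> g z \<noteq> 0}"
  have N: "open ?N"
    by (intro open_Collect_conj open_Collect_less open_Collect_neq continuous_intros g)
  have "AE z in lborel. z \<notin> ?N" using AE by eventually_elim (auto simp: indicator_def)
  then have "?N \<in> null_sets lborel" using N by (subst AE_iff_null_sets) auto
  then have "negligible ?N"
    using N null_sets_completion_iff[of ?N lborel] by (simp add: negligible_iff_null_sets)
  have "?N = {}"
  proof (rule ccontr)
    assume "?N \<noteq> {}"
    from open_not_negligible[OF N this] \<open>negligible ?N\<close> show False by contradiction
  qed
  then show "\<forall>z. cmod z < 1 \<longrightarrow> g z = 0" by simp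
qed

lemma dirichlet_self:
  assumes s: "s \<in> smooth_sections m"
  shows "dirichlet m s s \<in> \<real>\<^sub>\<ge>\<^sub>0"
    and "dirichlet m s s = 0 \<Longrightarrow> cmod z < 1 \<Longrightarrow>
      d_dzbar (\<lambda>z. s (1, z)) z = 0 \<and> d_dzbar (\<lambda>w. s (w, 1)) z = 0"
proof -
  note cont = smooth_charts[OF s, THEN smooth_on_d_dzbar[OF open_UNIV], THEN smooth_on_continuous]
  obtain r0 where r0: "(LINT z:ball 0 1|lborel. d_dzbar (\<lambda>z. s (1, z)) z * cnj (d_dzbar (\<lambda>z. s (1, z)) z)) = complex_of_real r0"
    "0 \<le> r0" "r0 = 0 \<Longrightarrow> \<forall>z. cmod z < 1 \<longrightarrow> d_dzbar (\<lambda>z. s (1, z)) z = 0"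
    using disc_integral_norm_sq[OF cont(1)] by blast
  obtain r1 where r1: "(LINT w:ball 0 1|lborel. d_dzbar (\<lambda>w. s (w, 1)) w * cnj (d_dzbar (\<lambda>w. s (w, 1)) w)) = complex_of_real r1"
    "0 \<le> r1" "r1 = 0 \<Longrightarrow> \<forall>z. cmod z < 1 \<longrightarrow> d_dzbar (\<lambda>w. s (w, 1)) z = 0"
    using disc_integral_norm_sq[OF cont(2)] by blast
  have eq: "dirichlet m s s = complex_of_real ((1 / pi) * (r0 + r1))"
    unfolding dirichlet_def r0(1) r1(1) by (simp add: scaleR_conv_of_real)
  show "dirichlet m s s \<in> \<real>\<^sub>\<ge>\<^sub>0"
    unfolding eq using r0(2) r1(2) by (simp add: complex_nonneg_Reals_iff)
  assume "dirichlet m s s = 0" and z: "cmod z < 1"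
  then have "r0 = 0 \<and> r1 = 0"
    using r0(2) r1(2) unfolding eq by (simp only: of_real_eq_0_iff) (simp add: add_nonneg_eq_0_iff)
  then show "d_dzbar (\<lambda>z. s (1, z)) z = 0 \<and> d_dzbar (\<lambda>w. s (w, 1)) z = 0"
    using r0(3) r1(3) z by blast
qed

lemma holomorphic_iff_d_dzbar_0:
  assumes "smooth_on UNIV g"
  shows "g holomorphic_on UNIV \<longleftrightarrow> (\<forall>z. d_dzbar g z = 0)"
proof
  assume "g holomorphic_on UNIV"
  then have "(g has_field_derivative deriv g z) (at z)" for z
    by (rule holomorphic_derivI) auto
  then show "\<forall>z. d_dzbar g z = 0" using wirtinger_eqI(2)[OF has_wirtinger_holomorphic] by blast
next
  assume 0: "\<forall>z. d_dzbar g z = 0"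
  have "(g has_field_derivative d_dz g z) (at z)" for z
    using smooth_on_wirtinger[OF assms UNIV_I, of z] 0 by (simp add: has_field_derivative_def)
  then show "g holomorphic_on UNIV"
    by (auto simp: holomorphic_on_def intro: field_differentiable_at_within simp: field_differentiable_def)
qed

lemma vanishing_off_circle:
  fixes g :: "complex \<Rightarrow> complex"
  assumes "continuous_on UNIV g" "\<And>z. cmod z \<noteq> 1 \<Longrightarrow> g z = 0"
  shows "g z = 0"
proof -
  let ?N = "{z. g z \<noteq> 0}"
  have N: "open ?N" by (rule open_Collect_neq[OF assms(1) continuous_on_const])
  have "?N \<subseteq> sphere 0 1"
  proof
    fix w assume w: "w \<in> ?N"
    have "cmod w = 1"
    proof (rule ccontr)
      assume "cmod w \<noteq> 1"
      from assms(2)[OF this] w show False by simp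
    qed
    then show "w \<in> sphere 0 1" by simp
  qed
  then have neg: "negligible ?N" by (rule negligible_subset[OF negligible_sphere])
  have "?N = {}"
  proof (rule ccontr)
    assume "?N \<noteq> {}"
    from open_not_negligible[OF N this] neg show False by contradiction
  qed
  then have "z \<notin> {z. g z \<noteq> 0}" by simp
  then show ?thesis by simp
qed

text \<open>
  The vanishing of the form gives $\partial_{\bar z}$-closedness in each chart inside its own unit disc; the
  transition formula carries it to the outside of the other one.
\<close>

lemma dirichlet_0_imp_holomorphic:
  assumes s: "s \<in> smooth_sections m" and 0: "dirichlet m s s = 0"
  shows "s \<in> holomorphic_sections m"
proof -
  let ?a = "\<lambda>z. s (1, z)" and ?b = "\<lambda>w. s (w, 1)"
  note inner = dirichlet_self(2)[OF s 0]
  note cont = smooth_charts[OF s, THEN smooth_on_d_dzbar[OF open_UNIV], THEN smooth_on_continuous]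
  have outer: "d_dzbar ?a z = 0 \<and> d_dzbar ?b z = 0" if "cmod z > 1" for z
  proof -
    have z: "z \<noteq> 0" using that by auto
    have "cmod (inverse z) < 1" using that by (simp add: norm_inverse inverse_less_1_iff)
    from inner[OF this] show ?thesis
      unfolding d_dzbar_chart_change[OF s z] by simp
  qed
  have off: "d_dzbar ?a z = 0" "d_dzbar ?b z = 0" if "cmod z \<noteq> 1" for z
    using that inner[of z] outer[of z] by (auto simp: neq_iff)
  have "\<forall>z. d_dzbar ?a z = 0" "\<forall>z. d_dzbar ?b z = 0"
    using vanishing_off_circle[OF cont(1) off(1)] vanishing_off_circle[OF cont(2) off(2)] by auto
  then show ?thesis
    using s holomorphic_iff_d_dzbar_0[OF smooth_charts(1)[OF s]] holomorphic_iff_d_dzbar_0[OF smooth_charts(2)[OF s]]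
    by (simp add: holomorphic_sections_def smooth_sections_iff)
qed

lemma holomorphic_sections_smooth: "holomorphic_sections m \<subseteq> smooth_sections m"
  using smooth_on_holomorphic[OF open_UNIV] by (auto simp: holomorphic_sections_def smooth_sections_iff)

lemma lap_holomorphic:
  assumes "s \<in> holomorphic_sections m" shows "lap m s = (\<lambda>x. 0)"
proof -
  have s: "s \<in> smooth_sections m" using assms holomorphic_sections_smooth by blast
  have "d_dzbar (\<lambda>z. s (1, z)) = (\<lambda>z. 0)" "d_dzbar (\<lambda>w. s (w, 1)) = (\<lambda>w. 0)"
    using assms holomorphic_iff_d_dzbar_0[OF smooth_charts(1)[OF s]] holomorphic_iff_d_dzbar_0[OF smooth_charts(2)[OF s]]
    by (auto simp: holomorphic_sections_def)
  moreover have "d_dz (\<lambda>z. 0) z = 0" for z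
    by (rule wirtinger_eqI(1)[where b = 0]) simp
  ultimately show ?thesis by (auto simp: lap_def flat_laplacian_def)
qed

theorem mainTheorem1:
  fixes m :: nat
  shows "(\<exists>!D. is_canonical_laplacian m D) \<and>
    (\<forall>D. is_canonical_laplacian m D \<longrightarrow>
       {\<xi> \<in> smooth_sections m. D \<xi> = H_zero m} = holomorphic_sections m \<and>
       (\<forall>\<xi>\<in>smooth_sections m. \<forall>\<eta>\<in>smooth_sections m.
          H_product m (H_class m \<xi>) (D \<eta>) = H_product m (D \<xi>) (H_class m \<eta>)) \<and>
       (\<forall>\<xi>\<in>smooth_sections m. H_product m (H_class m \<xi>) (D \<xi>) \<in> \<real>\<^sub>\<ge>\<^sub>0))"
proof (intro conjI allI impI ballI)
  show "\<exists>!D. is_canonical_laplacian m D"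
    using canonical_laplacian_exists canonical_laplacian_unique by blast
  fix D assume D: "is_canonical_laplacian m D"
  have cl: "\<xi> \<in> L2_closure m" "lap m \<xi> \<in> L2_closure m" if "\<xi> \<in> smooth_sections m" for \<xi>
    using that smooth_sections_closure lap_L2_closure by blast+
  have prod: "H_product m (H_class m \<xi>) (D \<eta>) = dirichlet m \<xi> \<eta>"
    if "\<xi> \<in> smooth_sections m" "\<eta> \<in> smooth_sections m" for \<xi> \<eta>
    using that by (simp add: canonical_laplacian_eq[OF D] H_product_class cl L2_product_lap)
  show "H_product m (H_class m \<xi>) (D \<xi>) \<in> \<real>\<^sub>\<ge>\<^sub>0" if "\<xi> \<in> smooth_sections m" for \<xi>
    using prod[OF that that] dirichlet_self(1)[OF that] by simp
  show "H_product m (H_class m \<xi>) (D \<eta>) = H_product m (D \<xi>) (H_class m \<eta>)"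
    if \<xi>: "\<xi> \<in> smooth_sections m" and \<eta>: "\<eta> \<in> smooth_sections m" for \<xi> \<eta>
  proof -
    have "H_product m (D \<xi>) (H_class m \<eta>) = L2_product m (lap m \<xi>) \<eta>"
      by (simp add: canonical_laplacian_eq[OF D] H_product_class cl \<xi> \<eta>)
    also have "\<dots> = cnj (dirichlet m \<eta> \<xi>)"
      using L2_product_cnj[of m "lap m \<xi>" \<eta>] L2_product_lap[OF \<eta> \<xi>] by simp
    also have "\<dots> = dirichlet m \<xi> \<eta>" by (rule dirichlet_cnj[symmetric])
    finally show ?thesis using prod[OF \<xi> \<eta>] by simp
  qed
  show "{\<xi> \<in> smooth_sections m. D \<xi> = H_zero m} = holomorphic_sections m"
  proof (intro equalityI subsetI)
    fix \<xi> assume "\<xi> \<in> {\<xi> \<in> smooth_sections m. D \<xi> = H_zero m}"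
    then have \<xi>: "\<xi> \<in> smooth_sections m" and 0: "D \<xi> = H_class m (\<lambda>x. 0)"
      by (auto simp: H_zero_def)
    have "dirichlet m \<xi> \<xi> = L2_product m \<xi> (\<lambda>x. 0)"
      using prod[OF \<xi> \<xi>] unfolding 0 by (simp add: H_product_class cl \<xi> L2_closure_zero)
    also have "\<dots> = 0"
      by (simp add: L2_product_def h_metric_eq[abs_def])
    finally show "\<xi> \<in> holomorphic_sections m" by (rule dirichlet_0_imp_holomorphic[OF \<xi>])
  next
    fix \<xi> assume "\<xi> \<in> holomorphic_sections m"
    then show "\<xi> \<in> {\<xi> \<in> smooth_sections m. D \<xi> = H_zero m}"
      using holomorphic_sections_smooth[of m]
      by (auto simp: canonical_laplacian_eq[OF D] lap_holomorphic H_zero_def)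
  qed
qed

end
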